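(* Let $n\ge 1$ and $0<\lambda\le\Lambda$. There exist constants $\epsilon=\epsilon(n,\lambda,\Lambda)>0$ and $C=C(n,\lambda,\Lambda)>0$ such that for every nonnegative viscosity supersolution $u\in C(\overline{Q_2})$ of $u_t-\mathcal{M}^{-}_{\lambda,\Lambda}(D_x^2u)\ge 0$ on $Q_2$ with $u(0,0)>0$, and for every $t>0$, $$\big|\{(x,\tau)\in\mathcal{B}_1 : u(x,\tau)\ge C\,u(0,0)\,t\}\big|\le |\mathcal{B}_1|\,t^{-\epsilon}.$$ In particular, $\epsilon$ can be taken of order $\lambda^n(n\Lambda+1)^{-n}$, i.e. $\epsilon=c(n)\,\lambda^n(n\Lambda+1)^{-n}$ for a constant $c(n)>0$ depending only on $n$.
   Context: Points of $\mathbb{R}^n\times\mathbb{R}$ are written $(x,t)$ (space, time); $|\cdot|$ of a set is $(n+1)$-dimensional Lebesgue measure. $Sym(n)$ is the set of real symmetric $n\times n$ matrices. Pucci operator: for $N\in Sym(n)$, $\mathcal{M}^{-}_{\lambda,\Lambda}(N)=\inf\{\mathrm{tr}(AN): A\in Sym(n),\ \lambda I\le A\le\Lambda I\}=\lambda\,(\text{sum of positive eigenvalues of }N)+\Lambda\,(\text{sum of negative eigenvalues of }N)$. Parabolic sets: $Q_r^B((x_0,t_0))=\{(x,t): |x-x_0|<r,\ t_0-r^2<t\le t_0\}$; $Q_r=Q_r^B((0,0))$; $\mathcal{B}_{(x_0,t_0)}=\{(x,t): t-t_0<-|x-x_0|^2\}$; $\mathcal{B}_1=\mathcal{B}_{(0,0)}\cap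 Q_1$. Touching: a smooth function $\varphi$ touches $v$ from below at $(x,t)$ if $\varphi(x,t)=v(x,t)$ and, for some $r>0$, $\varphi\le v$ on $Q_r^B((x,t))$ (intersected with the domain). Viscosity supersolution: $v\in C(\overline{Q_2})$ is a viscosity supersolution of $v_t-\mathcal{M}^{-}_{\lambda,\Lambda}(D_x^2v)\ge0$ on $Q_2$ if for every smooth $\varphi$ touching $v$ from below at some $(x,t)\in Q_2$ one has $\varphi_t(x,t)-\mathcal{M}^{-}_{\lambda,\Lambda}(D_x^2\varphi(x,t))\ge 0$. *)

theory Defs
  imports "HOL-Analysis.Analysis"
begin

definition loewner_le :: "real^'n^'n \<Rightarrow> real^'n^'n \<Rightarrow> bool" where
  "loewner_le A B \<longleftrightarrow> (\<forall>v. v \<bullet> (A *v v) \<le> v \<bullet> (B *v v))"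

text \<open>For \<open>0 < lam \<le> Lam\<close> the set below is nonempty and its traces are bounded, so \<open>Inf\<close> on
  the reals is the true infimum.\<close>

definition pucci_minus :: "real \<Rightarrow> real \<Rightarrow> real^'n^'n \<Rightarrow> real" where
  "pucci_minus lam Lam N =
     Inf {trace (A ** N) | A. transpose A = A \<and> loewner_le (mat lam) A \<and> loewner_le A (mat Lam)}"

text \<open>Half-open cylinders: the top time is included, the bottom time is not.\<close>

definition parabolic_cylinder :: "real \<Rightarrow> (real^'n) \<times> real \<Rightarrow> ((real^'n) \<times> real) set" where
  "parabolic_cylinder r z =
     {(x, t). norm (x - fst z) < r \<and> snd z - r\<^sup>2 < t \<and> t \<le> snd z}"

definition backward_paraboloid :: "(real^'n) \<times> real \<Rightarrow> ((real^'n) \<times> real) set" where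
  "backward_paraboloid z = {(x, t). t - snd z < - (norm (x - fst z))\<^sup>2}"

definition B1 :: "((real^'n) \<times> real) set" where
  "B1 = backward_paraboloid (0, 0) \<inter> parabolic_cylinder 1 (0, 0)"

definition dir_deriv :: "'a::real_normed_vector \<Rightarrow> ('a \<Rightarrow> real) \<Rightarrow> 'a \<Rightarrow> real" where
  "dir_deriv v f = (\<lambda>z. frechet_derivative f (at z) v)"

primrec C_diff :: "nat \<Rightarrow> ('a::real_normed_vector \<Rightarrow> real) \<Rightarrow> bool" where
  "C_diff 0 f \<longleftrightarrow> continuous_on UNIV f"
| "C_diff (Suc k) f \<longleftrightarrow> (\<forall>z. f differentiable (at z)) \<and> (\<forall>v. C_diff k (dir_deriv v f))"

text \<open>Test functions are smooth on all of space-time. Since touching only involves values near the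
  point, test functions given only near it would yield the same supersolutions (multiply by a
  cutoff).\<close>

definition smooth :: "('a::real_normed_vector \<Rightarrow> real) \<Rightarrow> bool" where
  "smooth f \<longleftrightarrow> (\<forall>k. C_diff k f)"

definition time_deriv :: "((real^'n) \<times> real \<Rightarrow> real) \<Rightarrow> (real^'n) \<times> real \<Rightarrow> real" where
  "time_deriv f = dir_deriv (0, 1) f"

definition space_hessian :: "((real^'n) \<times> real \<Rightarrow> real) \<Rightarrow> (real^'n) \<times> real \<Rightarrow> real^'n^'n" where
  "space_hessian f z = (\<chi> i j. dir_deriv (axis i 1, 0) (dir_deriv (axis j 1, 0) f) z)"

definition touches_below ::
  "((real^'n) \<times> real) set \<Rightarrow> ((real^'n) \<times> real \<Rightarrow> real) \<Rightarrow> ((real^'n) \<times> real \<Rightarrow> real)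
    \<Rightarrow> (real^'n) \<times> real \<Rightarrow> bool" where
  "touches_below D \<phi> v z \<longleftrightarrow>
     \<phi> z = v z \<and> (\<exists>r>0. \<forall>w \<in> parabolic_cylinder r z \<inter> D. \<phi> w \<le> v w)"

text \<open>The function \<open>v\<close> has domain \<open>closure Q\<close>; its values elsewhere are irrelevant.\<close>

definition viscosity_supersolution ::
  "real \<Rightarrow> real \<Rightarrow> ((real^'n) \<times> real) set \<Rightarrow> ((real^'n) \<times> real \<Rightarrow> real) \<Rightarrow> bool" where
  "viscosity_supersolution lam Lam Q v \<longleftrightarrow>
     continuous_on (closure Q) v \<and>
     (\<forall>\<phi> z. smooth \<phi> \<longrightarrow> z \<in> Q \<longrightarrow> touches_below (closure Q) \<phi> v z \<longrightarrow>
        time_deriv \<phi> z - pucci_minus lam Lam (space_hessian \<phi> z) \<ge> 0)"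

end

theory Submission
  imports Defs
begin

text \<open>
  Write \<open>\<beta> = 1 + n Lam\<close>. The proof follows \<open>u\<close> through the paraboloids
  \<open>h + a \<beta> t - a/2 |x - y|\<^sup>2\<close> of opening \<open>a\<close>, concave in space and rising in time. Call a point a
  contact point for \<open>a\<close> if such a paraboloid touches \<open>u\<close> from below there, only earlier times being
  considered. Two facts give the theorem. First, at a contact point of \<open>B1\<close> outside a thin layer
  along the boundary of \<open>B1\<close>, \<open>u\<close> is smaller than \<open>a\<close> (\<open>contact_value_bound\<close>). Second, up to the
  measure of such a layer, the points of \<open>B1\<close> that become contact points when \<open>a\<close> is replaced by
  \<open>2 a\<close> fill at least a fraction \<open>\<theta> = c(n) (lam / \<beta>)\<^sup>n\<close> of the points of \<open>B1\<close> that were not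
  (\<open>measure_non_contact\<close>). Starting from \<open>a\<close> of order \<open>u (0, 0)\<close>, the set of non-contact points
  therefore decays like \<open>(1 - \<theta>/2)\<^sup>k\<close> after \<open>k\<close> doublings, which is a power of \<open>a\<close> with
  exponent of order \<open>\<theta>\<close>. The factor between consecutive openings is 2, whatever \<open>lam\<close> and \<open>Lam\<close>
  are; this is why the exponent has the stated order.

  The second fact is proved for all these points at once. Let \<open>z = (x, t)\<close> not be a contact point for
  \<open>a\<close>. Among the paraboloids of opening \<open>a\<close> lying below \<open>u\<close> up to time \<open>t\<close> let \<open>P\<close> be one that is
  highest at \<open>x\<close>, and add \<open>a \<beta> (t' - t) - a/2 |x' - x|\<^sup>2\<close>. The sum \<open>Q\<close> is a paraboloid of opening
  \<open>2 a\<close>, below \<open>P\<close> up to time \<open>t\<close> and rising faster afterwards; let it rise until it first touches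
  \<open>u\<close>, at \<open>z'\<close>. A supersolution cannot be touched at one point by two paraboloids of the same
  opening with different vertices, since their maximum has a convex kink. So a paraboloid of opening
  \<open>a\<close> touching at \<open>z'\<close> would be determined by \<open>Q\<close>, and it would be higher than \<open>P\<close> at \<open>z\<close>. Hence
  \<open>z'\<close> is a contact point for \<open>2 a\<close> and not for \<open>a\<close> (\<open>doubled_contact_new\<close>).

  It remains to compare measures when \<open>z\<close> is sent to the vertex and height of \<open>Q\<close>, and these to
  \<open>z'\<close>. The first step multiplies volume by at least a multiple of \<open>a \<beta>\<close>: it is expansive in space
  at fixed time and in time at fixed vertex, and Fubini applies (\<open>measure_compact_relation\<close>). As to
  the second step, two paraboloids whose contact points lie in a common box of width \<open>r\<close> and duration
  \<open>r\<^sup>2 / lam\<close> have vertices at distance at most of order \<open>(\<beta> / lam) r\<close>, and their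
  values in the box differ by at most of order \<open>a (\<beta> / lam) r\<^sup>2\<close> (\<open>contact_box_bound\<close>). Counting boxes
  shows that the parameters have measure at most a multiple of \<open>(\<beta> / lam)\<^sup>n a \<beta>\<close> times that of the
  contact points. These bounds come from comparing \<open>u\<close> with quadratic
  polynomials only and take the place of second order differentiability almost everywhere.

  Contact at \<open>z'\<close> has to happen close to \<open>z\<close>, inside \<open>B1\<close>. A barrier shows that if \<open>u\<close> is at
  least \<open>\<mu>\<close> on a ball of radius \<open>\<kappa>\<close> at a time in the past, then \<open>u (0, 0)\<close> is at least a multiple of
  \<open>\<kappa>\<^sup>p \<mu>\<close>, with \<open>p\<close> of order \<open>\<beta> / lam\<close> (\<open>spread_lower_bound\<close>). So \<open>u\<close> has values small compared
  with \<open>a \<delta>\<^sup>2\<close> in all balls of radius \<open>\<delta>\<close> well inside \<open>B1\<close>, where \<open>\<delta>\<close> is a negative power of \<open>a\<close>; this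
  confines \<open>z'\<close>, and the excluded layers have width of order \<open>\<delta>\<close>. Since \<open>p\<close> is at most of order
  \<open>1 / \<theta>\<close>, the layers shrink fast enough.
\<close>

section \<open>Quadratic test functions\<close>

lemma dir_deriv_affine:
  fixes L :: "'a::real_normed_vector \<Rightarrow> real"
  assumes L: "bounded_linear L"
  shows "((\<lambda>z. c + L z) has_derivative L) (at z)" and "dir_deriv v (\<lambda>z. c + L z) = (\<lambda>z. L v)"
proof -
  show der: "((\<lambda>z. c + L z) has_derivative L) (at z)" for z
    using L by (auto intro!: derivative_eq_intros bounded_linear_imp_has_derivative)
  show "dir_deriv v (\<lambda>z. c + L z) = (\<lambda>z. L v)"
    using frechet_derivative_at[OF der] by (simp add: dir_deriv_def fun_eq_iff)
qed

lemma C_diff_affine: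
  fixes L :: "'a::real_normed_vector \<Rightarrow> real"
  assumes L: "bounded_linear L"
  shows "C_diff k (\<lambda>z. c + L z)"
proof -
  have dd0: "dir_deriv v (\<lambda>z::'a. c) = (\<lambda>z. 0)" for c :: real and v
    using dir_deriv_affine(2)[OF bounded_linear_zero, of v c] by simp
  have zero: "C_diff k (\<lambda>z::'a. c)" for c :: real and k
    by (induction k arbitrary: c) (auto simp: dd0)
  show ?thesis
  proof (cases k)
    case 0
    have "continuous_on UNIV (\<lambda>z. c + L z)"
      by (intro continuous_on_add continuous_on_const linear_continuous_on L)
    then show ?thesis using 0 by simp
  next
    case (Suc j)
    then show ?thesis
      using differentiableI[OF dir_deriv_affine(1)[OF L]] zero
      by (auto simp: dir_deriv_affine(2)[OF L])
  qed
qed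

lemma dir_deriv_quadratic:
  assumes L: "bounded_linear L" and B: "bounded_bilinear B"
  shows "((\<lambda>z. c + L z + B z z) has_derivative (\<lambda>v. L v + (B z v + B v z))) (at z)"
    and "dir_deriv v (\<lambda>z. c + L z + B z z) = (\<lambda>z. L v + (B z v + B v z))"
proof -
  show der: "((\<lambda>z. c + L z + B z z) has_derivative (\<lambda>v. L v + (B z v + B v z))) (at z)" for z
    by (auto intro!: derivative_eq_intros bounded_linear_imp_has_derivative L
        bounded_bilinear.FDERIV[OF B])
  show "dir_deriv v (\<lambda>z. c + L z + B z z) = (\<lambda>z. L v + (B z v + B v z))"
    using frechet_derivative_at[OF der] by (simp add: dir_deriv_def fun_eq_iff)
qed

lemma smooth_quadratic:
  assumes L: "bounded_linear L" and B: "bounded_bilinear B"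
  shows "smooth (\<lambda>z. c + L z + B z z)"
  unfolding smooth_def
proof
  fix k
  have aff: "C_diff k (dir_deriv v (\<lambda>z. c + L z + B z z))" for k v
    unfolding dir_deriv_quadratic(2)[OF L B]
    by (intro C_diff_affine bounded_linear_add bounded_bilinear.bounded_linear_left[OF B]
        bounded_bilinear.bounded_linear_right[OF B])
  show "C_diff k (\<lambda>z. c + L z + B z z)"
  proof (cases k)
    case 0
    have "(\<lambda>z. c + L z + B z z) differentiable (at z)" for z
      using dir_deriv_quadratic(1)[OF L B] differentiable_def by blast
    then show ?thesis
      using 0 by (simp add: continuous_at_imp_continuous_on differentiable_imp_continuous_within)
  next
    case (Suc j)
    then show ?thesis
      using aff differentiableI[OF dir_deriv_quadratic(1)[OF L B]] by auto
  qed
qed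

lemma trace_eq_sum_axis: "trace (A :: real^'n^'n) = (\<Sum>i\<in>UNIV. axis i 1 \<bullet> (A *v axis i 1))"
  by (simp add: trace_def inner_axis' matrix_vector_mult_basis column_def)

lemma loewner_scalar_bounds:
  fixes A :: "real^'n^'n"
  assumes "loewner_le (mat lam) A" "loewner_le A (mat Lam)"
  shows "lam * (norm e)\<^sup>2 \<le> e \<bullet> (A *v e)" and "trace A \<le> real CARD('n) * Lam"
proof -
  have m: "mat l *v v = l *\<^sub>R v" for l :: real and v :: "real^'n"
    by (simp add: vec_eq_iff matrix_vector_mult_def mat_def if_distrib[of "\<lambda>x. x * _"]
        cong: if_cong)
  show "lam * (norm e)\<^sup>2 \<le> e \<bullet> (A *v e)"
    using assms(1) by (simp add: loewner_le_def m power2_norm_eq_inner)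
  have "axis i 1 \<bullet> (A *v axis i 1) \<le> Lam" for i
    using assms(2) by (auto simp: loewner_le_def m inner_axis_axis dest!: spec[of _ "axis i 1"])
  then have "trace A \<le> (\<Sum>i\<in>(UNIV::'n set). Lam)"
    unfolding trace_eq_sum_axis by (intro sum_mono) auto
  then show "trace A \<le> real CARD('n) * Lam" by simp
qed

text \<open>
  All test functions below have Hessian \<open>- \<alpha> I + \<gamma> e e\<^sup>T\<close>. For admissible \<open>A\<close> the trace of \<open>A\<close> times
  this matrix is \<open>- \<alpha> tr A + \<gamma> e \<bullet> A e\<close>, and the two bounds on \<open>A\<close> control the two terms separately.
\<close>

lemma pucci_minus_rank_one_ge:
  fixes e :: "real^'n"
  assumes "0 < lam" "lam \<le> Lam" "0 \<le> \<alpha>" "0 \<le> \<gamma>"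
  shows "\<gamma> * lam * (norm e)\<^sup>2 - real CARD('n) * Lam * \<alpha>
    \<le> pucci_minus lam Lam (\<chi> i j. - \<alpha> * (if i = j then 1 else 0) + \<gamma> * (e $ i * e $ j))"
    (is "_ \<le> pucci_minus lam Lam ?N")
  unfolding pucci_minus_def
proof (rule cInf_greatest)
  have m: "mat l *v v = l *\<^sub>R v" for l :: real and v :: "real^'n"
    by (simp add: vec_eq_iff matrix_vector_mult_def mat_def if_distrib[of "\<lambda>x. x * _"]
        cong: if_cong)
  have "transpose (mat lam) = (mat lam :: real^'n^'n)" "loewner_le (mat lam :: real^'n^'n) (mat lam)"
       "loewner_le (mat lam :: real^'n^'n) (mat Lam)"
    using assms by (auto simp: loewner_le_def m mult_right_mono transpose_mat)
  then show "{trace (A ** ?N) |A. transpose A = A \<and> loewner_le (mat lam) A \<and> loewner_le A (mat Lam)}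
      \<noteq> {}" by blast
  fix x assume "x \<in> {trace (A ** ?N) |A. transpose A = A \<and> loewner_le (mat lam) A \<and> loewner_le A (mat Lam)}"
  then obtain A where A: "x = trace (A ** ?N)" "loewner_le (mat lam) A" "loewner_le A (mat Lam)"
    by blast
  have "x = (\<Sum>i\<in>UNIV. \<Sum>k\<in>UNIV. A $ i $ k * (- \<alpha> * (if k = i then 1 else 0) + \<gamma> * (e $ k * e $ i)))"
    by (simp add: A(1) trace_def matrix_matrix_mult_def)
  also have "\<dots> = (\<Sum>i\<in>UNIV. \<Sum>k\<in>UNIV. - \<alpha> * (if k = i then A $ i $ k else 0)) +
      (\<Sum>i\<in>UNIV. \<Sum>k\<in>UNIV. \<gamma> * (e $ i * (A $ i $ k * e $ k)))"
    unfolding sum.distrib[symmetric] by (intro sum.cong refl) (simp add: algebra_simps)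
  also have "(\<Sum>i\<in>UNIV. \<Sum>k\<in>UNIV. - \<alpha> * (if k = i then A $ i $ k else 0)) = - \<alpha> * trace A"
    unfolding sum_distrib_left[symmetric] trace_def by simp
  also have "- \<alpha> * trace A + (\<Sum>i\<in>UNIV. \<Sum>k\<in>UNIV. \<gamma> * (e $ i * (A $ i $ k * e $ k)))
      = - \<alpha> * trace A + \<gamma> * (e \<bullet> (A *v e))"
    by (simp add: sum_distrib_left inner_vec_def matrix_vector_mult_def)
  finally have x: "x = - \<alpha> * trace A + \<gamma> * (e \<bullet> (A *v e))" .
  have "\<gamma> * (lam * (norm e)\<^sup>2) \<le> \<gamma> * (e \<bullet> (A *v e))" "\<alpha> * trace A \<le> \<alpha> * (real CARD('n) * Lam)"
    using loewner_scalar_bounds[OF A(2,3)] assms(3,4) by (auto intro!: mult_left_mono)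
  then show "\<gamma> * lam * (norm e)\<^sup>2 - real CARD('n) * Lam * \<alpha> \<le> x"
    unfolding x by (simp add: algebra_simps)
qed

abbreviation Q2bar :: "((real^'n) \<times> real) set" where
  "Q2bar \<equiv> cball 0 2 \<times> {-4..0}"

lemma closure_cylinder: "closure (parabolic_cylinder 2 (0, 0)) = (Q2bar :: ((real^'n) \<times> real) set)"
proof -
  have "parabolic_cylinder 2 (0, 0) = ball (0::real^'n) 2 \<times> {-4<..(0::real)}"
    by (auto simp: parabolic_cylinder_def)
  then show ?thesis by (simp add: closure_Times)
qed

text \<open>
  The only way in which the equation enters: the supersolution property, read off for a quadratic
  polynomial below \<open>u\<close> in a backward neighbourhood.
\<close>

lemma supersolution_quadratic_test:
  fixes u :: "(real^'n) \<times> real \<Rightarrow> real"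
  assumes lam: "0 < lam" "lam \<le> Lam"
    and u: "viscosity_supersolution lam Lam (parabolic_cylinder 2 (0, 0)) u"
    and nn: "0 \<le> \<alpha>" "0 \<le> \<gamma>"
    and z0: "norm x0 < 2" "-4 < t0" "t0 \<le> 0"
    and r: "r > 0"
    and min: "\<And>x t. norm (x - x0) < r \<Longrightarrow> t0 - r < t \<Longrightarrow> t \<le> t0 \<Longrightarrow>
      u (x0, t0) + b * (t - t0) + p \<bullet> (x - x0) - \<alpha> / 2 * (norm (x - x0))\<^sup>2 + \<gamma> / 2 * (e \<bullet> (x - x0))\<^sup>2
      \<le> u (x, t)"
  shows "\<gamma> * lam * (norm e)\<^sup>2 - real CARD('n) * Lam * \<alpha> \<le> b"
proof -
  define B where "B = (\<lambda>(z::(real^'n) \<times> real) (w::(real^'n) \<times> real). - \<alpha> / 2 * (fst z \<bullet> fst w) + \<gamma> / 2 * ((e \<bullet> fst z) * (e \<bullet> fst w)))"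
  define L where "L = (\<lambda>z::(real^'n) \<times> real. b * snd z + p \<bullet> fst z + \<alpha> * (x0 \<bullet> fst z) - \<gamma> * ((e \<bullet> x0) * (e \<bullet> fst z)))"
  define c where "c = u (x0, t0) - b * t0 - p \<bullet> x0 - \<alpha> / 2 * (norm x0)\<^sup>2 + \<gamma> / 2 * (e \<bullet> x0)\<^sup>2"
  define q where "q = (\<lambda>z. c + L z + B z z)"
  have L: "bounded_linear L" unfolding L_def
    by (intro bounded_linear_intros bounded_linear_add bounded_linear_sub
        bounded_linear_const_mult bounded_linear_inner_right_comp bounded_linear_fst bounded_linear_snd)
  have B: "bounded_bilinear B" unfolding B_def
  proof (rule bounded_bilinear.intro, goal_cases)
    case 5
    have "norm (- \<alpha> / 2 * (fst z \<bullet> fst w) + \<gamma> / 2 * ((e \<bullet> fst z) * (e \<bullet> fst w)))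
        \<le> norm z * norm w * (\<alpha> / 2 + \<gamma> / 2 * (norm e)\<^sup>2)" for z w :: "(real^'n) \<times> real"
    proof -
      have n: "norm (fst z) \<le> norm z" "norm (fst w) \<le> norm w"
        by (metis norm_fst_le prod.collapse)+
      have 1: "\<bar>fst z \<bullet> fst w\<bar> \<le> norm z * norm w"
        using Cauchy_Schwarz_ineq2[of "fst z" "fst w"] mult_mono[OF n] by auto
      have "\<bar>e \<bullet> fst z\<bar> * \<bar>e \<bullet> fst w\<bar> \<le> (norm e * norm z) * (norm e * norm w)"
        by (intro mult_mono order_trans[OF Cauchy_Schwarz_ineq2] mult_left_mono n) auto
      then have 2: "\<bar>(e \<bullet> fst z) * (e \<bullet> fst w)\<bar> \<le> (norm e)\<^sup>2 * (norm z * norm w)"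
        by (simp add: abs_mult power2_eq_square algebra_simps)
      have "norm (- \<alpha> / 2 * (fst z \<bullet> fst w) + \<gamma> / 2 * ((e \<bullet> fst z) * (e \<bullet> fst w)))
        \<le> \<alpha> / 2 * \<bar>fst z \<bullet> fst w\<bar> + \<gamma> / 2 * \<bar>(e \<bullet> fst z) * (e \<bullet> fst w)\<bar>"
        using nn by (intro order_trans[OF norm_triangle_ineq]) (simp add: abs_mult)
      also have "\<dots> \<le> \<alpha> / 2 * (norm z * norm w) + \<gamma> / 2 * ((norm e)\<^sup>2 * (norm z * norm w))"
        using 1 2 nn by (intro add_mono mult_left_mono) auto
      finally show ?thesis by (simp add: algebra_simps)
    qed
    then show ?case by blast
  qed (simp_all add: algebra_simps)
  have q: "q (x, t) = u (x0, t0) + b * (t - t0) + p \<bullet> (x - x0) - \<alpha> / 2 * (norm (x - x0))\<^sup>2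
      + \<gamma> / 2 * (e \<bullet> (x - x0))\<^sup>2" for x t
    unfolding q_def c_def L_def B_def power2_norm_eq_inner
    by (simp add: algebra_simps power2_eq_square inner_commute)
  have sm: "smooth q" unfolding q_def by (rule smooth_quadratic[OF L B])
  have dd: "dir_deriv v q = (\<lambda>z. L v + (B z v + B v z))" for v
    unfolding q_def by (rule dir_deriv_quadratic(2)[OF L B])
  have dd2: "dir_deriv w (dir_deriv v q) = (\<lambda>z. B w v + B v w)" for v w
    unfolding dd
    by (intro dir_deriv_affine(2) bounded_linear_add bounded_bilinear.bounded_linear_left[OF B]
        bounded_bilinear.bounded_linear_right[OF B])
  have td: "time_deriv q z = b" for z
    unfolding time_deriv_def dd by (simp add: L_def B_def)
  have sh: "space_hessian q z = (\<chi> i j. - \<alpha> * (if i = j then 1 else 0) + \<gamma> * (e $ i * e $ j))" for z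
    unfolding space_hessian_def dd2 B_def
    by (simp add: vec_eq_iff inner_axis inner_axis_axis algebra_simps) (simp add: axis_def)
  define s where "s = min r (min 1 (sqrt r))"
  have s: "s > 0" "s \<le> r" using r by (auto simp: s_def)
  have s2: "s\<^sup>2 \<le> r"
  proof -
    have "s\<^sup>2 \<le> (sqrt r)\<^sup>2" using s by (intro power_mono) (auto simp: s_def)
    then show ?thesis using r by simp
  qed
  have "touches_below (closure (parabolic_cylinder 2 (0, 0))) q u (x0, t0)"
    unfolding touches_below_def
  proof (intro conjI exI[of _ s] ballI)
    show "q (x0, t0) = u (x0, t0)" by (simp add: q)
    fix w assume "w \<in> parabolic_cylinder s (x0, t0) \<inter> closure (parabolic_cylinder 2 (0, 0))"
    then have "norm (fst w - x0) < r" "t0 - r < snd w" "snd w \<le> t0"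
      using s s2 by (auto simp: parabolic_cylinder_def)
    from min[OF this] show "q w \<le> u w" by (cases w) (simp add: q)
  qed (use s in auto)
  moreover have "(x0, t0) \<in> parabolic_cylinder 2 (0, 0)"
    using z0 by (simp add: parabolic_cylinder_def)
  ultimately have "time_deriv q (x0, t0) - pucci_minus lam Lam (space_hessian q (x0, t0)) \<ge> 0"
    using u sm unfolding viscosity_supersolution_def by blast
  then show ?thesis
    using pucci_minus_rank_one_ge[OF lam nn, of e] unfolding td sh by linarith
qed

section \<open>Paraboloids touching from below\<close>

locale nonneg_supersolution =
  fixes lam Lam :: real and u :: "(real^'n) \<times> real \<Rightarrow> real"
  assumes lam: "0 < lam" "lam \<le> Lam"
    and supersol: "viscosity_supersolution lam Lam (parabolic_cylinder 2 (0, 0)) u"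
    and nonneg: "\<And>z. z \<in> Q2bar \<Longrightarrow> 0 \<le> u z"
begin

definition \<beta> :: real where
  "\<beta> = 1 + real CARD('n) * Lam"

lemma beta: "1 \<le> \<beta>" "lam \<le> \<beta>" "real CARD('n) * Lam = \<beta> - 1" "1 \<le> \<beta> / lam"
proof -
  have "1 * Lam \<le> real CARD('n) * Lam"
    using lam by (intro mult_right_mono) (auto simp: Suc_le_eq)
  then have "Lam \<le> real CARD('n) * Lam" by linarith
  then show "lam \<le> \<beta>" "1 \<le> \<beta>" using lam unfolding \<beta>_def by linarith+
  then show "real CARD('n) * Lam = \<beta> - 1" "1 \<le> \<beta> / lam" using lam by (auto simp: \<beta>_def)
qed

lemma continuous_on_u: "continuous_on Q2bar u"
  using supersol by (simp add: viscosity_supersolution_def closure_cylinder)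

text \<open>
  Comparison on the cylinder \<open>E \<times> [t1, t2]\<close> with a strict subsolution: at a negative minimum of
  \<open>u - q\<close>, which the boundary data force into the interior, \<open>q\<close> is a test function and
  contradicts the equation.
\<close>

lemma quadratic_comparison:
  assumes q: "\<And>x t. q (x, t) = k + b * t + p \<bullet> x - \<alpha> / 2 * (x \<bullet> x) + \<gamma> / 2 * (e \<bullet> x)\<^sup>2"
    and nn: "0 \<le> \<alpha>" "0 \<le> \<gamma>"
    and strict: "b < \<gamma> * lam * (norm e)\<^sup>2 - real CARD('n) * Lam * \<alpha>"
    and E: "compact E" "E \<subseteq> ball 0 2" "open G" "G \<subseteq> E"
    and t: "-4 \<le> t1" "t2 \<le> 0"
    and bottom: "\<And>x. x \<in> E \<Longrightarrow> q (x, t1) \<le> u (x, t1)"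
    and lateral: "\<And>x t. x \<in> E - G \<Longrightarrow> t1 \<le> t \<Longrightarrow> t \<le> t2 \<Longrightarrow> q (x, t) \<le> u (x, t)"
    and x: "x \<in> E" "t1 \<le> t" "t \<le> t2"
  shows "q (x, t) \<le> u (x, t)"
proof (rule ccontr)
  assume "\<not> q (x, t) \<le> u (x, t)"
  let ?K = "E \<times> {t1..t2}"
  have sub: "?K \<subseteq> Q2bar"
    using E(2) t by auto
  have "continuous_on ?K (\<lambda>z. u z - q z)"
  proof (intro continuous_on_diff continuous_on_subset[OF continuous_on_u sub])
    have "q = (\<lambda>z. k + b * snd z + p \<bullet> fst z - \<alpha> / 2 * (fst z \<bullet> fst z) + \<gamma> / 2 * (e \<bullet> fst z)\<^sup>2)"
      using q by (auto simp: fun_eq_iff)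
    then show "continuous_on ?K q" by (auto intro!: continuous_intros)
  qed
  moreover have "compact ?K" "?K \<noteq> {}" using E(1) x by (auto intro!: compact_Times)
  ultimately obtain z0 where z0: "z0 \<in> ?K" "\<And>z. z \<in> ?K \<Longrightarrow> u z0 - q z0 \<le> u z - q z"
    using continuous_attains_inf[of ?K "\<lambda>z. u z - q z"] by blast
  obtain x0 t0 where z0_eq: "z0 = (x0, t0)" by fastforce
  have neg: "u z0 - q z0 < 0"
    using z0(2)[of "(x, t)"] x \<open>\<not> q (x, t) \<le> u (x, t)\<close> by auto
  have "t1 \<noteq> t0" using neg bottom[of x0] z0(1) by (auto simp: z0_eq)
  then have t0: "t1 < t0" "t0 \<le> t2" using z0(1) by (auto simp: z0_eq)
  have "x0 \<in> G" using neg lateral[of x0 t0] z0(1) t0 by (force simp: z0_eq)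
  then obtain r where r: "r > 0" "ball x0 r \<subseteq> G" using E(3) openE by blast
  have "\<gamma> * lam * (norm e)\<^sup>2 - real CARD('n) * Lam * \<alpha> \<le> b"
  proof (rule supersolution_quadratic_test[OF lam supersol nn, where ?x0.0 = x0 and ?t0.0 = t0
        and r = "min r (t0 - t1)" and p = "p - \<alpha> *\<^sub>R x0 + (\<gamma> * (e \<bullet> x0)) *\<^sub>R e"])
    show "norm x0 < 2" using z0(1) E(2) by (auto simp: z0_eq dist_norm)
    show "-4 < t0" "t0 \<le> 0" "0 < min r (t0 - t1)" using t0 t r by auto
    fix x t assume a: "norm (x - x0) < min r (t0 - t1)" "t0 - min r (t0 - t1) < t" "t \<le> t0"
    have "x \<in> ball x0 r" using a(1) by (simp add: dist_norm norm_minus_commute)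
    moreover have "t1 \<le> t" using a(2) by (auto simp: min_def split: if_splits)
    ultimately have "(x, t) \<in> ?K" using r(2) E(4) a(3) t0 by auto
    from z0(2)[OF this] have "u (x0, t0) + (q (x, t) - q (x0, t0)) \<le> u (x, t)"
      by (simp add: z0_eq)
    moreover have "q (x, t) - q (x0, t0) = b * (t - t0)
        + (p - \<alpha> *\<^sub>R x0 + (\<gamma> * (e \<bullet> x0)) *\<^sub>R e) \<bullet> (x - x0)
        - \<alpha> / 2 * (norm (x - x0))\<^sup>2 + \<gamma> / 2 * (e \<bullet> (x - x0))\<^sup>2"
      unfolding q power2_norm_eq_inner
      by (simp add: inner_simps power2_eq_square inner_commute field_simps)
    ultimately show "u (x0, t0) + b * (t - t0)
        + (p - \<alpha> *\<^sub>R x0 + (\<gamma> * (e \<bullet> x0)) *\<^sub>R e) \<bullet> (x - x0)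
        - \<alpha> / 2 * (norm (x - x0))\<^sup>2 + \<gamma> / 2 * (e \<bullet> (x - x0))\<^sup>2 \<le> u (x, t)"
      by linarith
  qed
  with strict show False by simp
qed

text \<open>
  The slope in time is \<open>A \<beta>\<close> because \<open>\<beta>\<close> bounds, up to a constant, the speed at which \<open>u\<close> can
  decrease above a paraboloid of opening 1. With this choice the Jacobian below carries the factor
  \<open>\<beta>\<^sup>n\<close> and not \<open>\<beta>\<^sup>n\<^sup>+\<^sup>1\<close>.
\<close>

definition paraboloid :: "real \<Rightarrow> real^'n \<Rightarrow> real \<Rightarrow> (real^'n) \<times> real \<Rightarrow> real" where
  "paraboloid A y h z = h + A * \<beta> * snd z - A / 2 * (norm (fst z - y))\<^sup>2"

definition below :: "real \<Rightarrow> real^'n \<Rightarrow> real \<Rightarrow> real \<Rightarrow> bool" where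
  "below A y h t \<longleftrightarrow> (\<forall>z \<in> Q2bar. snd z \<le> t \<longrightarrow> paraboloid A y h z \<le> u z)"

definition touch :: "real \<Rightarrow> real^'n \<Rightarrow> real \<Rightarrow> (real^'n) \<times> real \<Rightarrow> bool" where
  "touch A y h z \<longleftrightarrow> z \<in> Q2bar \<and> below A y h (snd z) \<and> u z = paraboloid A y h z"

definition contact :: "real \<Rightarrow> ((real^'n) \<times> real) set" where
  "contact A = {z. \<exists>y h. touch A y h z}"

text \<open>
  The maximum of the two paraboloids has a convex kink of strength \<open>A |y1 - y2|\<close> along a hyperplane
  at distance at most \<open>r\<close> from the contact point. If the kink is strong compared with \<open>r\<close>, a quadratic
  polynomial fits below this maximum on the boundary of a small cylinder, is above it at the contact
  point, and is so convex across the hyperplane that it is a strict subsolution.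
\<close>

lemma kink_bound:
  assumes A: "0 < A" and touch: "touch A y1 h1 (x1, t1)" and below: "below A y2 h2 t1"
    and x1: "norm x1 \<le> 1" "-1 \<le> t1" "t1 \<le> 0"
    and r: "0 < r" "norm (y1 - y2) * r < 1/2"
    and s1: "paraboloid A y1 h1 (x1, t1) - paraboloid A y2 h2 (x1, t1) \<le> A * norm (y1 - y2) * r"
  shows "norm (y1 - y2) \<le> 24 * (\<beta> / lam) * r"
proof (rule ccontr)
  assume "\<not> norm (y1 - y2) \<le> 24 * (\<beta> / lam) * r"
  then have big: "24 * \<beta> * r < lam * norm (y1 - y2)"
    using lam by (simp add: field_simps)
  define d where "d = norm (y1 - y2)"
  have d: "d > 0"
  proof -
    have "0 \<le> 24 * \<beta> * r" using beta(1) r by auto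
    then have "0 < lam * d" using big unfolding d_def by linarith
    then show ?thesis using lam by (simp add: zero_less_mult_iff)
  qed
  define e where "e = (1 / d) *\<^sub>R (y1 - y2)"
  have e: "norm e = 1" "y1 - y2 = d *\<^sub>R e" using d by (auto simp: e_def d_def)
  let ?P1 = "paraboloid A y1 h1" and ?P2 = "paraboloid A y2 h2"
  define s0 where "s0 = (h2 - h1 + A / 2 * (y1 \<bullet> y1) - A / 2 * (y2 \<bullet> y2)) / (A * d)"
  define s where "s = (\<lambda>x. e \<bullet> x - s0)"
  have diff: "?P1 (x, t) - ?P2 (x, t) = A * d * s x" for x t
  proof -
    have "?P1 (x, t) - ?P2 (x, t) = h1 - h2 + A * ((y1 - y2) \<bullet> x) - A / 2 * (y1 \<bullet> y1) + A / 2 * (y2 \<bullet> y2)"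
      unfolding paraboloid_def power2_norm_eq_inner
      by (simp add: inner_diff_left inner_diff_right inner_commute algebra_simps)
    also have "\<dots> = A * d * s x"
      using d A by (simp add: s_def s0_def e(2) field_simps)
    finally show ?thesis .
  qed
  \<comment> \<open>The kink at \<open>s\<close> has height \<open>A d |s| / 2\<close> above the mean of the two paraboloids. With this \<open>N\<close> the parabola
    \<open>N/2 s\<^sup>2\<close> is at most half of that for \<open>|s| \<le> 4 r\<close>, and \<open>N/2 s\<^sup>2 + c\<close> equals it at \<open>|s| = 4 r\<close>; \<open>R\<close> and \<open>T\<close>
    are such that the other two terms absorb \<open>c\<close> on the rest of the boundary.\<close>
  define N where "N = A * d / (8 * r)"
  define c where "c = A * d * r"
  define q where "q = (\<lambda>z. (?P1 z + ?P2 z) / 2 + N / 2 * (s (fst z))\<^sup>2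
     - A / 2 * (norm (fst z - x1))\<^sup>2 + c + A * (snd z - t1))"
  define T where "T = d * r"
  define R where "R = sqrt (2 * d * r)"
  have T: "0 < T" "T < 1/2" "0 < R" "R\<^sup>2 = 2 * d * r" "R < 1" using r d
    by (auto simp: T_def R_def d_def)
  define E where "E = cball x1 R \<inter> {x. \<bar>s x\<bar> \<le> 4 * r}"
  define G where "G = ball x1 R \<inter> {x. \<bar>s x\<bar> < 4 * r}"
  have scont: "continuous_on UNIV s" unfolding s_def by (intro continuous_intros)
  have below1: "?P1 z \<le> u z" "?P2 z \<le> u z" if "z \<in> Q2bar" "snd z \<le> t1" for z
    using touch below that by (auto simp: touch_def below_def)
  have q_le: "q (x, t) \<le> u (x, t)"
    if "x \<in> E" "t1 - T \<le> t" "t \<le> t1"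
      "N / 2 * (s x)\<^sup>2 - A / 2 * (norm (x - x1))\<^sup>2 + c + A * (t - t1) \<le> A * d * \<bar>s x\<bar> / 2" for x t
  proof -
    have "norm x \<le> norm x1 + norm (x - x1)" by (metis norm_triangle_sub)
    then have "(x, t) \<in> Q2bar"
      using that x1 T by (auto simp: E_def dist_norm norm_minus_commute)
    then have "max (?P1 (x, t)) (?P2 (x, t)) \<le> u (x, t)" using below1 that by auto
    moreover have "max (?P1 (x, t)) (?P2 (x, t)) = (?P1 (x, t) + ?P2 (x, t)) / 2 + \<bar>A * d * s x\<bar> / 2"
      unfolding diff[of x t, symmetric] by (simp add: max_def abs_if field_simps)
    ultimately show ?thesis
      using that(4) A d by (simp add: q_def abs_mult)
  qed
  have quad: "N / 2 * (s x)\<^sup>2 \<le> A * d * \<bar>s x\<bar> / 4" if "x \<in> E" for x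
  proof -
    have "N / 2 * (s x)\<^sup>2 = N / 2 * \<bar>s x\<bar> * \<bar>s x\<bar>" by (simp add: power2_eq_square)
    also have "\<dots> \<le> N / 2 * \<bar>s x\<bar> * (4 * r)"
      using that A d r by (intro mult_left_mono) (auto simp: E_def N_def)
    also have "\<dots> = A * d * \<bar>s x\<bar> / 4" using r by (simp add: N_def)
    finally show ?thesis .
  qed
  have "q (x1, t1) \<le> u (x1, t1)"
  proof (rule quadratic_comparison[where q = q and k = "q (0, 0)" and b = "A * \<beta> + A" and \<alpha> = "2 * A" and \<gamma> = N
        and e = e and p = "(A / 2) *\<^sub>R (y1 + y2) + A *\<^sub>R x1 - (N * s0) *\<^sub>R e" and E = E and G = G
        and ?t1.0 = "t1 - T" and ?t2.0 = t1])
    show "q (x, t) = q (0, 0) + (A * \<beta> + A) * t + ((A / 2) *\<^sub>R (y1 + y2) + A *\<^sub>R x1 - (N * s0) *\<^sub>R e) \<bullet> x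
       - 2 * A / 2 * (x \<bullet> x) + N / 2 * (e \<bullet> x)\<^sup>2" for x t
      unfolding q_def s_def paraboloid_def power2_norm_eq_inner
      by (simp add: inner_simps power2_eq_square inner_commute field_simps)
    show "0 \<le> 2 * A" "0 \<le> N" using A d r by (auto simp: N_def)
    show "A * \<beta> + A < N * lam * (norm e)\<^sup>2 - real CARD('n) * Lam * (2 * A)"
    proof -
      have "A * (24 * \<beta> * r) < A * (lam * d)" using big A by (simp add: d_def)
      then have "3 * A * \<beta> < N * lam" using r by (simp add: N_def field_simps)
      moreover have "A * 1 \<le> A * \<beta>" using beta(1) A by (intro mult_left_mono) auto
      ultimately show ?thesis using A unfolding e beta(3) by (simp add: algebra_simps)
    qed
    show "compact E" unfolding E_def
      by (intro compact_Int_closed compact_cball closed_Collect_le continuous_intros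
          continuous_on_compose2[OF scont]) auto
    show "open G" unfolding G_def
      by (intro open_Int open_ball open_Collect_less continuous_intros
          continuous_on_compose2[OF scont]) auto
    show "G \<subseteq> E" by (auto simp: E_def G_def)
    show "E \<subseteq> ball 0 2"
    proof
      fix x assume "x \<in> E"
      moreover have "norm x \<le> norm x1 + norm (x - x1)" by (metis norm_triangle_sub)
      ultimately show "x \<in> ball 0 2" using x1 T by (auto simp: E_def dist_norm norm_minus_commute)
    qed
    show "-4 \<le> t1 - T" "t1 \<le> 0" "t1 - T \<le> t1" "t1 \<le> t1" using x1 T by auto
    show "x1 \<in> E"
    proof -
      have "0 \<le> ?P1 (x1, t1) - ?P2 (x1, t1)"
        using touch below1(2)[of "(x1, t1)"] by (auto simp: touch_def)
      moreover have "0 < A * d" using A d by simp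
      ultimately have "0 \<le> s x1" "s x1 \<le> r" using s1 unfolding diff d_def[symmetric]
        using zero_le_mult_iff[of "A * d" "s x1"] mult_le_cancel_left_pos[of "A * d" "s x1" r] by auto
      then show ?thesis using T r by (auto simp: E_def)
    qed
    fix x assume x: "x \<in> E"
    have n: "0 \<le> A * d * \<bar>s x\<bar>" "0 \<le> A / 2 * (norm (x - x1))\<^sup>2" using A d by auto
    show "q (x, t1 - T) \<le> u (x, t1 - T)"
      using quad[OF x] x T n by (intro q_le) (auto simp: c_def T_def)
  next
    fix x t assume x: "x \<in> E - G" and t: "t1 - T \<le> t" "t \<le> t1"
    have n: "0 \<le> A * d * \<bar>s x\<bar>" "0 \<le> A / 2 * (norm (x - x1))\<^sup>2" "A * (t - t1) \<le> 0"
      using A d t by (auto simp: mult_nonneg_nonpos)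
    consider "\<bar>s x\<bar> = 4 * r" | "norm (x - x1) = R"
      using x by (auto simp: E_def G_def dist_norm norm_minus_commute)
    then show "q (x, t) \<le> u (x, t)"
    proof cases
      case 1
      have "(s x)\<^sup>2 = (4 * r)\<^sup>2" using 1 by (metis power2_abs)
      then have "N / 2 * (s x)\<^sup>2 = A * d * r" using r by (simp add: N_def power2_eq_square)
      then show ?thesis using x t n 1 by (intro q_le) (auto simp: c_def)
    next
      case 2
      have "A / 2 * (norm (x - x1))\<^sup>2 = c" unfolding 2 T c_def by simp
      then show ?thesis using x t n quad[of x] by (intro q_le) auto
    qed
  qed
  moreover have "u (x1, t1) = ?P1 (x1, t1)" using touch by (simp add: touch_def)
  moreover have "?P1 (x1, t1) \<le> (?P1 (x1, t1) + ?P2 (x1, t1)) / 2 + c / 2"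
    using s1 unfolding c_def d_def[symmetric] by (simp add: field_simps)
  moreover have "0 \<le> N / 2 * (s x1)\<^sup>2" "0 < c" using A d r by (auto simp: N_def c_def)
  ultimately show False by (simp add: q_def)
qed

text \<open>
  After contact \<open>u\<close> cannot fall below the paraboloid faster than at a rate of order \<open>A \<beta>\<close>: compare with
  the paraboloid lowered at that rate and bent down away from \<open>x2\<close>. On the lateral boundary the
  bending leaves room \<open>A/32\<close>, which uniform continuity of \<open>u\<close> uses up only after a time \<open>\<tau>\<close>
  that is independent of the paraboloid.
\<close>

lemma drop_bound:
  assumes A: "0 < A"
  obtains \<tau> where "\<tau> > 0"
    "\<And>y h x1 t1 x2 t2. touch A y h (x1, t1) \<Longrightarrow> -1 \<le> t1 \<Longrightarrow> t1 \<le> t2 \<Longrightarrow> t2 < t1 + \<tau> \<Longrightarrow>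
       t2 \<le> 0 \<Longrightarrow> norm x2 \<le> 1 \<Longrightarrow> paraboloid A y h (x2, t2) - 3 * A * \<beta> * (t2 - t1) \<le> u (x2, t2)"
proof -
  have "uniformly_continuous_on Q2bar u"
    by (intro compact_uniformly_continuous continuous_on_u compact_Times) auto
  moreover have "A / 32 > 0" using A by simp
  ultimately obtain \<tau> where \<tau>: "\<tau> > 0" "\<And>z z'. z \<in> Q2bar \<Longrightarrow> z' \<in> Q2bar \<Longrightarrow> dist z' z < \<tau> \<Longrightarrow> dist (u z') (u z) < A / 32"
    unfolding uniformly_continuous_on_def by blast
  show ?thesis
  proof (rule that[OF \<tau>(1)])
    fix y x1 x2 :: "real^'n" and h t1 t2
    assume touch: "touch A y h (x1, t1)" and t: "-1 \<le> t1" "t1 \<le> t2" "t2 < t1 + \<tau>" "t2 \<le> 0"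
      and x2: "norm x2 \<le> 1"
    have P: "paraboloid A y h z \<le> u z" if "z \<in> Q2bar" "snd z \<le> t1" for z
      using touch that by (auto simp: touch_def below_def)
    define q where "q = (\<lambda>z. paraboloid A y h z - A / 2 * (norm (fst z - x2))\<^sup>2 - 3 * A * \<beta> * (snd z - t1))"
    have ball: "x \<in> ball 0 2" if "norm (x - x2) \<le> 1/4" for x
    proof -
      have "norm x \<le> norm x2 + norm (x - x2)" by (metis norm_triangle_sub)
      then show ?thesis using x2 that by simp
    qed
    have "q (x2, t2) \<le> u (x2, t2)"
    proof (rule quadratic_comparison[where q = q and k = "q (0, 0)" and b = "A * \<beta> - 3 * A * \<beta>" and \<alpha> = "2 * A"
        and \<gamma> = 0 and e = 0 and p = "A *\<^sub>R (y + x2)" and E = "cball x2 (1/4)" and G = "ball x2 (1/4)"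
        and ?t1.0 = t1 and ?t2.0 = t2])
      show "q (x, t) = q (0, 0) + (A * \<beta> - 3 * A * \<beta>) * t + A *\<^sub>R (y + x2) \<bullet> x
        - 2 * A / 2 * (x \<bullet> x) + 0 / 2 * (0 \<bullet> x)\<^sup>2" for x t
        unfolding q_def paraboloid_def power2_norm_eq_inner
        by (simp add: inner_simps power2_eq_square inner_commute field_simps)
      show "A * \<beta> - 3 * A * \<beta> < 0 * lam * (norm (0::real^'n))\<^sup>2 - real CARD('n) * Lam * (2 * A)"
        using A unfolding beta(3) by (simp add: algebra_simps)
      show "cball x2 (1/4) \<subseteq> ball 0 2"
        using ball by (auto simp: dist_norm norm_minus_commute)
      fix x assume x: "x \<in> cball x2 (1/4)"
      then have "x \<in> ball 0 2" using ball by (auto simp: dist_norm norm_minus_commute)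
      then have "paraboloid A y h (x, t1) \<le> u (x, t1)" using P[of "(x, t1)"] t by auto
      then show "q (x, t1) \<le> u (x, t1)"
        using A by (auto simp: q_def intro: order_trans[rotated])
    next
      fix x t assume x: "x \<in> cball x2 (1/4) - ball x2 (1/4)" and t': "t1 \<le> t" "t \<le> t2"
      then have n: "norm (x - x2) = 1/4" by (auto simp: dist_norm norm_minus_commute)
      then have b: "x \<in> ball 0 2" using ball by auto
      then have "dist (u (x, t1)) (u (x, t)) < A / 32"
        using t t' by (intro \<tau>(2)) (auto simp: dist_Pair_Pair dist_real_def)
      then have "u (x, t1) - A / 32 \<le> u (x, t)" unfolding dist_real_def by linarith
      moreover have "paraboloid A y h (x, t1) \<le> u (x, t1)" using P[of "(x, t1)"] t b by auto
      moreover have "paraboloid A y h (x, t) = paraboloid A y h (x, t1) + A * \<beta> * (t - t1)"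
        by (simp add: paraboloid_def algebra_simps)
      moreover have "0 \<le> A * \<beta> * (t - t1)" using A t' beta(1) by auto
      moreover have q: "q (x, t) = paraboloid A y h (x, t) - A / 32 - 3 * (A * \<beta> * (t - t1))"
        by (simp add: q_def n power2_eq_square)
      ultimately show "q (x, t) \<le> u (x, t)"
        unfolding q by linarith
    qed (use A t x2 in auto)
    then show "paraboloid A y h (x2, t2) - 3 * A * \<beta> * (t2 - t1) \<le> u (x2, t2)"
      by (simp add: q_def)
  qed
qed

lemma paraboloid_difference_bound:
  "\<bar>(paraboloid A y1 h1 (x1, t1) - paraboloid A y2 h2 (x1, t1))
    - (paraboloid A y1 h1 (x2, t2) - paraboloid A y2 h2 (x2, t2))\<bar> \<le> \<bar>A\<bar> * norm (y1 - y2) * norm (x1 - x2)"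
proof -
  have "(paraboloid A y1 h1 (x1, t1) - paraboloid A y2 h2 (x1, t1))
    - (paraboloid A y1 h1 (x2, t2) - paraboloid A y2 h2 (x2, t2)) = A * ((y1 - y2) \<bullet> (x1 - x2))"
    unfolding paraboloid_def power2_norm_eq_inner
    by (simp add: inner_diff_left inner_diff_right inner_commute field_simps)
  then show ?thesis using Cauchy_Schwarz_ineq2[of "y1 - y2" "x1 - x2"]
    by (simp add: abs_mult mult.assoc mult_left_mono)
qed

text \<open>
  Let the first contact be the earlier one. Then the difference of the paraboloids is nonnegative at
  \<open>(x1, t1)\<close>, and at \<open>(x2, t2)\<close> it is at most of order \<open>A (\<beta> / lam) r\<^sup>2\<close>, by \<open>drop_bound\<close>. Being
  affine in \<open>x\<close>, it vanishes within distance of order \<open>r\<close> from \<open>x1\<close> unless its slope is small already,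
  and \<open>kink_bound\<close> applies. The duration \<open>r\<^sup>2 / lam\<close> is, up to constants, the longest for which the drop
  does not exceed the variation \<open>A |y1 - y2| r\<close> of the difference over the box.
\<close>

lemma contact_box_bound:
  assumes A: "0 < A"
  obtains \<tau> where "\<tau> > 0"
    "\<And>y1 h1 x1 t1 y2 h2 x2 t2 r. touch A y1 h1 (x1, t1) \<Longrightarrow> touch A y2 h2 (x2, t2) \<Longrightarrow>
      norm x1 \<le> 1 \<Longrightarrow> norm x2 \<le> 1 \<Longrightarrow> -1 \<le> t1 \<Longrightarrow> t1 \<le> t2 \<Longrightarrow> t2 \<le> 0 \<Longrightarrow>
      0 < r \<Longrightarrow> norm (x1 - x2) \<le> r \<Longrightarrow> t2 - t1 \<le> r\<^sup>2 / lam \<Longrightarrow> t2 < t1 + \<tau> \<Longrightarrow> norm (y1 - y2) * r < 1/4 \<Longrightarrow>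
      norm (y1 - y2) \<le> 48 * (\<beta> / lam) * r \<and>
      \<bar>paraboloid A y1 h1 (x1, t1) - paraboloid A y2 h2 (x1, t1)\<bar> \<le> 51 * A * (\<beta> / lam) * r\<^sup>2"
proof -
  obtain \<tau> where \<tau>: "\<tau> > 0"
    "\<And>y h x1 t1 x2 t2. touch A y h (x1, t1) \<Longrightarrow> -1 \<le> t1 \<Longrightarrow> t1 \<le> t2 \<Longrightarrow> t2 < t1 + \<tau> \<Longrightarrow>
       t2 \<le> 0 \<Longrightarrow> norm x2 \<le> 1 \<Longrightarrow> paraboloid A y h (x2, t2) - 3 * A * \<beta> * (t2 - t1) \<le> u (x2, t2)"
    using drop_bound[OF A] by metis
  show ?thesis
  proof (rule that[OF \<tau>(1)])
    fix y1 x1 y2 x2 :: "real^'n" and h1 t1 h2 t2 r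
    assume t1: "touch A y1 h1 (x1, t1)" and t2: "touch A y2 h2 (x2, t2)"
      and x: "norm x1 \<le> 1" "norm x2 \<le> 1" "-1 \<le> t1" "t1 \<le> t2" "t2 \<le> 0"
      and r: "0 < r" "norm (x1 - x2) \<le> r" "t2 - t1 \<le> r\<^sup>2 / lam" "t2 < t1 + \<tau>" "norm (y1 - y2) * r < 1/4"
    define d where "d = norm (y1 - y2)"
    define D1 where "D1 = paraboloid A y1 h1 (x1, t1) - paraboloid A y2 h2 (x1, t1)"
    define D2 where "D2 = paraboloid A y1 h1 (x2, t2) - paraboloid A y2 h2 (x2, t2)"
    define m where "m = \<beta> / lam"
    have below2: "below A y2 h2 t1" using t2 x by (auto simp: touch_def below_def)
    have "paraboloid A y2 h2 (x1, t1) \<le> u (x1, t1)"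
      using below2[unfolded below_def, rule_format, of "(x1, t1)"] t1 by (simp add: touch_def)
    then have "0 \<le> D1" using t1 by (simp add: touch_def D1_def)
    have "D2 \<le> 3 * A * \<beta> * (t2 - t1)"
      using \<tau>(2)[OF t1 x(3,4) r(4) x(5,2)] t2 by (simp add: touch_def D2_def)
    also have "\<dots> \<le> 3 * A * \<beta> * (r\<^sup>2 / lam)"
      using r(3) A beta(1) by (intro mult_left_mono) auto
    finally have D2: "D2 \<le> 3 * A * m * r\<^sup>2" by (simp add: m_def)
    have D12: "D1 \<le> D2 + A * d * r"
    proof -
      have "\<bar>D1 - D2\<bar> \<le> A * d * norm (x1 - x2)"
        using paraboloid_difference_bound[of A y1 h1 x1 t1 y2 h2 x2 t2] A by (simp add: D1_def D2_def d_def)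
      also have "\<dots> \<le> A * d * r" using r(2) A by (intro mult_left_mono) (auto simp: d_def)
      finally show ?thesis by linarith
    qed
    have m: "0 < m" using beta lam by (simp add: m_def)
    have d: "d \<le> 48 * m * r"
    proof (cases "d \<le> 3 * m * r")
      case True
      moreover have "0 < m * r" using m r by simp
      ultimately show ?thesis by simp
    next
      case False
      have "3 * m * r * r \<le> d * r" using False r by (intro mult_right_mono) auto
      then have "A * (3 * m * r * r) \<le> A * (d * r)" using A by (intro mult_left_mono) auto
      then have "D1 \<le> A * d * (2 * r)"
        using D2 D12 by (simp add: power2_eq_square algebra_simps)
      then have "d \<le> 24 * m * (2 * r)"
        unfolding d_def m_def D1_def using r x
        by (intro kink_bound[OF A t1 below2]) auto
      then show ?thesis by simp
    qed
    then have "A * d * r \<le> A * (48 * m * r) * r" using A r by (intro mult_right_mono mult_left_mono) auto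
    then have "D1 \<le> 51 * A * m * r\<^sup>2" using D12 D2 by (simp add: power2_eq_square algebra_simps)
    with d \<open>0 \<le> D1\<close> show "norm (y1 - y2) \<le> 48 * (\<beta> / lam) * r \<and>
      \<bar>paraboloid A y1 h1 (x1, t1) - paraboloid A y2 h2 (x1, t1)\<bar> \<le> 51 * A * (\<beta> / lam) * r\<^sup>2"
      unfolding D1_def[symmetric] d_def[symmetric] m_def[symmetric] by simp
  qed
qed

end

section \<open>Spreading of a lower bound forward in time\<close>

text \<open>
  Second order expansion of the barrier used in \<open>spread_lower_bound\<close>, backwards in time by \<open>s\<close> and with
  error \<open>\<eta> (s + |h|\<^sup>2)\<close>. Here \<open>\<xi>\<close> is the value of \<open>radius\<^sup>2 - |x - centre|\<^sup>2\<close> at the point, \<open>y\<close> the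
  position relative to the centre, \<open>v\<close> the velocity with which the centre moves backwards, \<open>a\<close> the
  growth rate of the squared radius, and \<open>g\<close> the logarithmic decay rate of the amplitude.
\<close>

lemma barrier_expansion:
  fixes y v :: "'a::real_inner"
  assumes "0 < \<xi>" "0 \<le> g" "0 \<le> a" "0 < \<eta>"
  obtains r where "r > 0"
    "\<And>h s X. norm h < r \<Longrightarrow> 0 \<le> s \<Longrightarrow> s < r \<Longrightarrow>
      X = \<xi> - a * s - ((norm (y + h - s *\<^sub>R v))\<^sup>2 - (norm y)\<^sup>2) \<Longrightarrow>
      0 \<le> X \<and> \<xi>\<^sup>2 + s * (g * \<xi>\<^sup>2 - 2 * \<xi> * (a + 2 * (norm y * norm v)) - \<eta>)
        - 4 * \<xi> * (y \<bullet> h) - (2 * \<xi> + \<eta>) * (norm h)\<^sup>2 + 4 * (y \<bullet> h)\<^sup>2 \<le> (1 + g * s) * X\<^sup>2"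
proof -
  \<comment> \<open>\<open>\<zeta>\<close> absorbs the errors in the first order terms in \<open>s\<close>, \<open>\<delta>\<close> the change of \<open>\<xi>\<^sup>2\<close> in the term with \<open>g\<close>.\<close>
  define b where "b = a + 2 * (norm y * norm v)"
  have b: "0 \<le> b" using assms by (simp add: b_def)
  define \<zeta> where "\<zeta> = min (min 1 \<eta>) (\<eta> / (2 * (2 * \<xi> + b + 1)))"
  have \<zeta>: "0 < \<zeta>" "\<zeta> \<le> 1" "\<zeta> \<le> \<eta>" "\<zeta> * (2 * \<xi> + b + \<zeta>) \<le> \<eta> / 2"
  proof -
    show z: "0 < \<zeta>" "\<zeta> \<le> 1" "\<zeta> \<le> \<eta>" using assms b by (auto simp: \<zeta>_def)
    have "\<zeta> * (2 * \<xi> + b + \<zeta>) \<le> \<eta> / (2 * (2 * \<xi> + b + 1)) * (2 * \<xi> + b + 1)"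
      using z assms b by (intro mult_mono) (auto simp: \<zeta>_def)
    also have "\<dots> = \<eta> / 2" using assms b by (simp add: field_simps)
    finally show "\<zeta> * (2 * \<xi> + b + \<zeta>) \<le> \<eta> / 2" .
  qed
  define \<delta> where "\<delta> = min \<xi> (\<eta> / (4 * (g * \<xi> + 1)))"
  have gx: "0 \<le> g * \<xi>" using assms by simp
  then have gx1: "0 < 4 * (g * \<xi> + 1)" using add_nonneg_pos[OF gx zero_less_one] by simp
  have \<delta>: "0 < \<delta>" "\<delta> \<le> \<xi>" "2 * g * \<xi> * \<delta> \<le> \<eta> / 2"
  proof -
    show d: "0 < \<delta>" "\<delta> \<le> \<xi>" using assms divide_pos_pos[OF assms(4) gx1] by (auto simp: \<delta>_def)
    have "2 * g * \<xi> * \<delta> \<le> (2 * (g * \<xi> + 1)) * (\<eta> / (4 * (g * \<xi> + 1)))"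
      by (rule mult_mono) (use assms d gx1 in \<open>auto simp: \<delta>_def\<close>)
    also have "\<dots> = \<eta> / 2" using gx1 by (simp add: field_simps)
    finally show "2 * g * \<xi> * \<delta> \<le> \<eta> / 2" .
  qed
  define r where "r = min 1 (min (\<zeta> / (2 * norm v + (norm v)\<^sup>2 + 4 * norm y + 1)) (\<delta> / (2 * norm y + 1 + b + \<zeta>)))"
  have pos: "0 < 2 * norm v + (norm v)\<^sup>2 + 4 * norm y + 1" "0 < 2 * norm y + 1 + b + \<zeta>"
    using b \<zeta> by (auto simp: add_nonneg_pos add_pos_nonneg)
  have r: "0 < r" "r \<le> 1" using \<zeta> \<delta> pos by (auto simp: r_def)
  have "r \<le> \<zeta> / (2 * norm v + (norm v)\<^sup>2 + 4 * norm y + 1)" "r \<le> \<delta> / (2 * norm y + 1 + b + \<zeta>)"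
    by (auto simp: r_def)
  then have r1: "r * (2 * norm v + (norm v)\<^sup>2 + 4 * norm y + 1) \<le> \<zeta>" and r2: "r * (2 * norm y + 1 + b + \<zeta>) \<le> \<delta>"
    using pos by (simp_all add: pos_le_divide_eq)
  show ?thesis
  proof (rule that[OF r(1)])
    fix h s X assume h: "norm h < r" and s: "0 \<le> s" "s < r"
      and X: "X = \<xi> - a * s - ((norm (y + h - s *\<^sub>R v))\<^sup>2 - (norm y)\<^sup>2)"
    define Y where "Y = y \<bullet> h"
    define W where "W = (norm h)\<^sup>2 + s * (b + \<zeta>)"
    have Y: "\<bar>Y\<bar> \<le> norm y * r"
      unfolding Y_def using h by (intro order_trans[OF Cauchy_Schwarz_ineq2] mult_left_mono) auto
    have W0: "0 \<le> W" using s b \<zeta> by (simp add: W_def)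
    have "norm h * norm h \<le> r * 1" using h r by (intro mult_mono) auto
    then have W: "W \<le> r * (1 + b + \<zeta>)"
      using mult_right_mono[of s r "b + \<zeta>"] s b \<zeta>
      unfolding W_def power2_eq_square by (simp add: algebra_simps)
    have s1: "0 \<le> s * r" "s * s * (norm v)\<^sup>2 \<le> s * (r * (norm v)\<^sup>2)" "s * (norm h * norm v) \<le> s * (r * norm v)"
      using s r h by (auto intro!: mult_left_mono mult_right_mono simp: mult.assoc)
    have "2 * (r * norm v) + r * (norm v)\<^sup>2 \<le> r * (2 * norm v + (norm v)\<^sup>2 + 4 * norm y + 1)"
      using r by (simp add: algebra_simps)
    then have "2 * (r * norm v) + r * (norm v)\<^sup>2 \<le> \<zeta>" using r1 by linarith
    from mult_left_mono[OF this s(1)] have s2: "2 * (s * (r * norm v)) + s * (r * (norm v)\<^sup>2) \<le> s * \<zeta>"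
      by (simp add: algebra_simps)
    have "\<bar>s * (y \<bullet> v)\<bar> \<le> s * (norm y * norm v)" "\<bar>s * (h \<bullet> v)\<bar> \<le> s * (norm h * norm v)"
      using s by (auto simp: abs_mult intro!: mult_left_mono Cauchy_Schwarz_ineq2)
    moreover have "X = \<xi> - 2 * Y - (norm h)\<^sup>2 - a * s + 2 * (s * (y \<bullet> v)) + 2 * (s * (h \<bullet> v)) - s * s * (norm v)\<^sup>2"
      unfolding X Y_def power2_norm_eq_inner
      by (simp add: inner_simps inner_commute algebra_simps)
    moreover have "W = (norm h)\<^sup>2 + a * s + 2 * (s * (norm y * norm v)) + s * \<zeta>"
      by (simp add: W_def b_def algebra_simps)
    ultimately have X_ge: "\<xi> - 2 * Y - W \<le> X"
      using s1 s2 by linarith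
    have sm: "2 * \<bar>Y\<bar> + W \<le> \<delta>"
      using Y W r2 by (simp add: algebra_simps)
    have Y4: "4 * \<bar>Y\<bar> \<le> \<zeta>"
    proof -
      have "4 * (norm y * r) \<le> r * (2 * norm v + (norm v)\<^sup>2 + 4 * norm y + 1)"
        using r by (simp add: algebra_simps)
      then show ?thesis using Y r1 by linarith
    qed
    define X' where "X' = \<xi> - 2 * Y - W"
    have X': "\<xi> - \<delta> \<le> X'" "0 \<le> X'" using sm \<delta>(2) by (auto simp: X'_def)
    have X'2: "X'\<^sup>2 \<le> X\<^sup>2" using X' X_ge by (intro power_mono) (auto simp: X'_def)
    have "(\<xi> - \<delta>)\<^sup>2 \<le> X'\<^sup>2" using X' \<delta> by (intro power_mono) auto
    then have "\<xi>\<^sup>2 - 2 * \<xi> * \<delta> \<le> X'\<^sup>2"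
      using zero_le_power2[of \<delta>] unfolding power2_diff by linarith
    then have "g * s * (\<xi>\<^sup>2 - 2 * \<xi> * \<delta>) \<le> g * s * X'\<^sup>2"
      using assms s by (intro mult_left_mono) auto
    moreover have "s * (2 * g * \<xi> * \<delta>) \<le> s * (\<eta> / 2)" using \<delta>(3) s by (intro mult_left_mono) auto
    ultimately have 1: "s * (g * \<xi>\<^sup>2 - \<eta> / 2) \<le> g * s * X'\<^sup>2"
      by (simp add: algebra_simps)
    have "- (4 * Y * W) \<le> \<zeta> * W" using mult_right_mono[OF Y4 W0] W0
      by (smt (verit) abs_ge_minus_self mult_minus_left mult_right_mono mult.assoc)
    moreover have "X'\<^sup>2 = \<xi>\<^sup>2 - 4 * \<xi> * Y + 4 * Y\<^sup>2 - 2 * \<xi> * W + 4 * Y * W + W\<^sup>2"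
      unfolding X'_def power2_eq_square by (simp add: algebra_simps)
    ultimately have 2: "\<xi>\<^sup>2 - 4 * \<xi> * Y + 4 * Y\<^sup>2 - (2 * \<xi> + \<zeta>) * W \<le> X'\<^sup>2"
      using zero_le_power2[of W] unfolding distrib_right by linarith
    have "s * (\<zeta> * (2 * \<xi> + b + \<zeta>)) \<le> s * (\<eta> / 2)" using \<zeta>(4) s by (intro mult_left_mono) auto
    moreover have "\<zeta> * (norm h)\<^sup>2 \<le> \<eta> * (norm h)\<^sup>2" using \<zeta>(3) by (intro mult_right_mono) auto
    ultimately have 3: "(2 * \<xi> + \<zeta>) * W \<le> (2 * \<xi> + \<eta>) * (norm h)\<^sup>2 + s * (2 * \<xi> * b + \<eta> / 2)"
      unfolding W_def by (simp add: algebra_simps)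
    have "(1 + g * s) * X'\<^sup>2 \<le> (1 + g * s) * X\<^sup>2" using X'2 assms s by (intro mult_left_mono) auto
    moreover have "(1 + g * s) * X'\<^sup>2 = X'\<^sup>2 + g * s * X'\<^sup>2" by (simp add: algebra_simps)
    moreover have "s * (g * \<xi>\<^sup>2 - 2 * \<xi> * b - \<eta>) = s * (g * \<xi>\<^sup>2 - \<eta> / 2) - s * (2 * \<xi> * b + \<eta> / 2)"
      by (simp add: field_simps)
    ultimately have "\<xi>\<^sup>2 + s * (g * \<xi>\<^sup>2 - 2 * \<xi> * b - \<eta>) - 4 * \<xi> * Y - (2 * \<xi> + \<eta>) * (norm h)\<^sup>2 + 4 * Y\<^sup>2
      \<le> (1 + g * s) * X\<^sup>2"
      using 1 2 3 by linarith
    then show "0 \<le> X \<and> \<xi>\<^sup>2 + s * (g * \<xi>\<^sup>2 - 2 * \<xi> * (a + 2 * (norm y * norm v)) - \<eta>)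
        - 4 * \<xi> * (y \<bullet> h) - (2 * \<xi> + \<eta>) * (norm h)\<^sup>2 + 4 * (y \<bullet> h)\<^sup>2 \<le> (1 + g * s) * X\<^sup>2"
      using X' X_ge unfolding b_def Y_def X'_def by auto
  qed
qed

context nonneg_supersolution
begin

definition spread_exp :: real where "spread_exp = 16 * \<beta> / lam"

definition spread_const :: real where "spread_const = (1 + \<beta>) powr (- spread_exp) * exp (- (128 * \<beta>\<^sup>2 / lam))"

text \<open>
  The barrier is \<open>f (\<rho> - |x - c|\<^sup>2)\<^sub>+\<^sup>2\<close>. Its support is a ball around a centre \<open>c\<close> that moves on a straight
  line from \<open>x1\<close> to the origin, so that it stays inside the domain; the squared radius \<open>\<rho>\<close> grows
  from \<open>\<kappa>\<^sup>2\<close> at speed \<open>\<beta>\<close> until it reaches \<open>1/8\<close>. With \<open>\<xi> = \<rho> - |x - c|\<^sup>2\<close> the barrier is a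
  subsolution if \<open>g \<xi>\<^sup>2 - B \<xi> + 8 lam \<rho> > 0\<close>, where \<open>g\<close> is the logarithmic decay rate of the amplitude \<open>f\<close>
  and \<open>B\<close> is of order \<open>\<beta>\<close>. So \<open>g\<close> of order \<open>\<beta>\<^sup>2 / (lam \<rho>)\<close> suffices; while \<open>\<rho>\<close> grows at speed
  \<open>\<beta>\<close>, integrating \<open>g\<close> gives a power of \<open>\<rho>\<close> of order \<open>\<beta> / lam\<close>.
\<close>

lemma spread_lower_bound:
  assumes x1: "norm x1 \<le> 1" "-1 \<le> t1" "t1 < 0" "(norm x1)\<^sup>2 \<le> - t1"
    and \<kappa>: "0 < \<kappa>" "\<kappa> \<le> 1/4" "\<kappa>\<^sup>2 \<le> - t1"
    and \<mu>: "0 < \<mu>" "\<And>x. x \<in> cball x1 \<kappa> \<Longrightarrow> \<mu> \<le> u (x, t1)"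
  shows "spread_const * \<kappa> powr (2 * spread_exp) * \<mu> \<le> u (0, 0)"
proof -
  define T where "T = - t1"
  have T: "0 < T" "T \<le> 1" "(norm x1)\<^sup>2 \<le> T" "\<kappa>\<^sup>2 \<le> T" using x1 \<kappa> by (auto simp: T_def)
  define M where "M = 128 * \<beta>\<^sup>2 / lam"
  have M: "0 < M" "0 < spread_exp" using lam beta by (auto simp: M_def spread_exp_def)
  define S where "S = (\<lambda>t. \<kappa>\<^sup>2 + \<beta> * (t - t1))"
  \<comment> \<open>The kink of \<open>\<rho>\<close> is harmless: backwards in time only \<open>\<rho> (t - s) \<ge> \<rho> t - \<beta> s\<close> is used.\<close>
  define \<rho> where "\<rho> = (\<lambda>t. min (S t) (1/8))"
  define f where "f = (\<lambda>t. \<mu> / \<kappa>^4 * exp (- (spread_exp * ln (S t / \<kappa>\<^sup>2) + M * (t - t1))))"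
  define c where "c = (\<lambda>t. (- t / T) *\<^sub>R x1)"
  define \<xi> where "\<xi> = (\<lambda>z. \<rho> (snd z) - (norm (fst z - c (snd z)))\<^sup>2)"
  define \<Phi> where "\<Phi> = (\<lambda>z. f (snd z) * (max 0 (\<xi> z))\<^sup>2)"
  have S: "\<kappa>\<^sup>2 \<le> S t" "0 < S t" if "t1 \<le> t" for t
    using that beta \<kappa> by (auto simp: S_def intro!: add_pos_nonneg)
  have \<kappa>2: "\<kappa>\<^sup>2 \<le> 1/16" using power_mono[of \<kappa> "1/4" 2] \<kappa> by (simp add: power2_eq_square)
  have fpos: "0 < f t" for t using \<mu> \<kappa> by (simp add: f_def)
  have t1_le: "\<Phi> (x, t1) \<le> u (x, t1)" if "x \<in> cball 0 2" for x
  proof -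
    have nn: "0 \<le> u (x, t1)" using nonneg that x1 by auto
    have e: "c t1 = x1" "\<rho> t1 = \<kappa>\<^sup>2" "f t1 = \<mu> / \<kappa>^4"
      using T \<kappa>2 \<kappa> by (auto simp: c_def \<rho>_def S_def f_def T_def)
    show ?thesis
    proof (cases "norm (x - x1) \<le> \<kappa>")
      case True
      have "(max 0 (\<xi> (x, t1)))\<^sup>2 \<le> (\<kappa>\<^sup>2)\<^sup>2"
        by (intro power_mono) (auto simp: \<xi>_def e)
      then have "\<Phi> (x, t1) \<le> \<mu> / \<kappa>^4 * (\<kappa>\<^sup>2)\<^sup>2"
        unfolding \<Phi>_def snd_conv e using \<mu> \<kappa> by (intro mult_left_mono) auto
      also have "\<dots> = \<mu>" using \<kappa> by simp
      also have "\<mu> \<le> u (x, t1)" using \<mu>(2)[of x] True by (simp add: dist_norm norm_minus_commute)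
      finally show ?thesis .
    next
      case False
      then have "\<kappa>\<^sup>2 \<le> (norm (x - x1))\<^sup>2" using \<kappa> by (intro power_mono) auto
      then show ?thesis using nn by (simp add: \<Phi>_def \<xi>_def e)
    qed
  qed
  have main: "\<Phi> (0, 0) \<le> u (0, 0)"
  proof (rule ccontr)
    assume neg00: "\<not> \<Phi> (0, 0) \<le> u (0, 0)"
    let ?K = "cball (0::real^'n) 2 \<times> {t1..0}"
    have sub: "?K \<subseteq> Q2bar" using x1 by auto
    have "continuous_on ?K (\<lambda>z. u z - \<Phi> z)"
      unfolding \<Phi>_def \<xi>_def \<rho>_def f_def c_def
      by (intro continuous_on_diff continuous_on_subset[OF continuous_on_u sub])
        (use S \<kappa> T in \<open>auto intro!: continuous_intros simp: S_def\<close>, fastforce+)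
    moreover have "compact ?K" "?K \<noteq> {}" using x1 by (auto intro!: compact_Times)
    ultimately obtain z0 where z0: "z0 \<in> ?K" "\<And>z. z \<in> ?K \<Longrightarrow> u z0 - \<Phi> z0 \<le> u z - \<Phi> z"
      using continuous_attains_inf[of ?K "\<lambda>z. u z - \<Phi> z"] by blast
    obtain x0 t0 where z0_eq: "z0 = (x0, t0)" by fastforce
    have neg: "u (x0, t0) < \<Phi> (x0, t0)"
      using z0(2)[of "(0, 0)"] x1 neg00 by (auto simp: z0_eq)
    then have "t1 \<noteq> t0" using t1_le[of x0] z0(1) by (auto simp: z0_eq)
    then have t0: "t1 < t0" "t0 \<le> 0" using z0(1) by (auto simp: z0_eq)
    define X0 where "X0 = \<xi> (x0, t0)"
    have "0 \<le> u (x0, t0)" using nonneg sub z0(1) z0_eq by blast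
    then have X0: "0 < X0" using neg unfolding \<Phi>_def X0_def by (cases "\<xi> (x0, t0) \<le> 0") auto
    define y where "y = x0 - c t0"
    define v where "v = (1 / T) *\<^sub>R x1"
    define \<rho>0 where "\<rho>0 = \<rho> t0"
    have y2: "(norm y)\<^sup>2 = \<rho>0 - X0" by (simp add: X0_def \<xi>_def y_def \<rho>0_def)
    have \<rho>0: "0 < \<rho>0" "\<rho>0 \<le> 1/8" "\<rho>0 \<le> S t0" using S[of t0] t0 by (auto simp: \<rho>0_def \<rho>_def)
    have x0: "norm x0 < 2"
    proof -
      have "(norm y)\<^sup>2 < 1\<^sup>2" using y2 X0 \<rho>0 by simp
      then have "norm y < 1" by (rule power_less_imp_less_base) simp
      moreover have "norm (c t0) \<le> 1 * 1"
        unfolding c_def norm_scaleR using t0 T x1 by (intro mult_mono) (auto simp: T_def)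
      moreover have "norm x0 \<le> norm y + norm (c t0)" unfolding y_def by (metis norm_triangle_sub add.commute)
      ultimately show ?thesis by simp
    qed
    \<comment> \<open>The drift: since \<open>|x1|\<^sup>2 \<le> T\<close>, the centre moves at speed at most \<open>1 / \<surd>T\<close>, and \<open>|y|\<^sup>2 \<le> \<kappa>\<^sup>2 + \<beta> T\<close>.\<close>
    define V where "V = norm y * norm v"
    have V: "V \<le> 2 * \<beta>"
    proof -
      have "V\<^sup>2 = (norm y)\<^sup>2 * (norm x1)\<^sup>2 / T\<^sup>2" using T by (simp add: V_def v_def power_mult_distrib power_divide)
      also have "\<dots> \<le> (T + \<beta> * T) * T / T\<^sup>2"
      proof (intro divide_right_mono mult_mono)
        have "\<beta> * (t0 - t1) \<le> \<beta> * T" using t0 beta by (intro mult_left_mono) (auto simp: T_def)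
        then show "(norm y)\<^sup>2 \<le> T + \<beta> * T" using y2 X0 \<rho>0 T by (simp add: S_def)
      qed (use T beta in auto)
      also have "\<dots> = 1 + \<beta>" using T by (simp add: field_simps power2_eq_square)
      also have "\<dots> \<le> (2 * \<beta>)\<^sup>2"
      proof -
        have "\<beta> * 1 \<le> \<beta> * \<beta>" using beta by (intro mult_left_mono) auto
        moreover have "(2 * \<beta>)\<^sup>2 = 4 * (\<beta> * \<beta>)" by (simp add: power2_eq_square)
        ultimately show ?thesis using beta(1) by linarith
      qed
      finally show ?thesis using beta by (intro power2_le_imp_le[of V "2 * \<beta>"]) auto
    qed
    define g where "g = spread_exp * \<beta> / S t0 + M"
    have g: "0 < g" using M S[of t0] t0 beta by (auto simp: g_def intro!: add_nonneg_pos)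
    have g\<rho>: "512 * \<beta>\<^sup>2 \<le> 32 * lam * (g * \<rho>0)"
    proof (cases "S t0 \<le> 1/8")
      case True
      have "spread_exp * \<beta> \<le> g * \<rho>0"
        using True S[of t0] t0 M by (simp add: g_def \<rho>0_def \<rho>_def distrib_right)
      then have "32 * lam * (spread_exp * \<beta>) \<le> 32 * lam * (g * \<rho>0)" using lam by (intro mult_left_mono) auto
      moreover have "32 * lam * (spread_exp * \<beta>) = 512 * \<beta>\<^sup>2" using lam by (simp add: spread_exp_def power2_eq_square)
      ultimately show ?thesis by simp
    next
      case False
      then have \<rho>8: "\<rho>0 = 1/8" by (simp add: \<rho>0_def \<rho>_def)
      have "M \<le> g" using M S[of t0] t0 beta by (simp add: g_def)
      then have "32 * lam * (M * (1/8)) \<le> 32 * lam * (g * \<rho>0)"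
        using lam unfolding \<rho>8 by (intro mult_left_mono mult_right_mono) auto
      then show ?thesis using lam by (simp add: M_def)
    qed
    define B where "B = 2 * \<beta> + 4 * V + 4 * (\<beta> - 1) + 8 * lam"
    have "0 \<le> V" by (simp add: V_def)
    then have "B \<le> 22 * \<beta>" "0 \<le> B" using V beta(1,2) lam(1) by (simp_all add: B_def)
    then have "B\<^sup>2 \<le> (22 * \<beta>)\<^sup>2" by (intro power_mono)
    then have "B\<^sup>2 \<le> 484 * \<beta>\<^sup>2" by (simp add: power_mult_distrib)
    moreover have "0 < \<beta>\<^sup>2" using beta(1) by simp
    ultimately have B: "B\<^sup>2 < 32 * lam * (g * \<rho>0)"
      using g\<rho> by linarith
    \<comment> \<open>The quadratic in \<open>X0\<close> has negative discriminant.\<close>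
    define Q where "Q = g * X0\<^sup>2 - B * X0 + 8 * lam * \<rho>0"
    have Q: "0 < Q"
    proof -
      have "4 * g * Q = (2 * g * X0 - B)\<^sup>2 + (32 * lam * (g * \<rho>0) - B\<^sup>2)"
        by (simp add: Q_def power2_eq_square algebra_simps)
      then have "0 < 4 * g * Q" using B by (simp add: add_nonneg_pos)
      then show ?thesis using g by (simp add: zero_less_mult_iff)
    qed
    define \<eta> where "\<eta> = Q / (2 * \<beta>)"
    have \<eta>: "0 < \<eta>" using Q beta by (simp add: \<eta>_def)
    obtain r where r: "r > 0" "\<And>h s X. norm h < r \<Longrightarrow> 0 \<le> s \<Longrightarrow> s < r \<Longrightarrow>
      X = X0 - \<beta> * s - ((norm (y + h - s *\<^sub>R v))\<^sup>2 - (norm y)\<^sup>2) \<Longrightarrow>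
      0 \<le> X \<and> X0\<^sup>2 + s * (g * X0\<^sup>2 - 2 * X0 * (\<beta> + 2 * (norm y * norm v)) - \<eta>)
        - 4 * X0 * (y \<bullet> h) - (2 * X0 + \<eta>) * (norm h)\<^sup>2 + 4 * (y \<bullet> h)\<^sup>2 \<le> (1 + g * s) * X\<^sup>2"
      by (rule barrier_expansion[of X0 g \<beta> \<eta> y v]) (use X0 g \<eta> beta(1) in \<open>auto simp: less_imp_le\<close>)
    define f0 where "f0 = f t0"
    define G where "G = g * X0\<^sup>2 - 2 * X0 * (\<beta> + 2 * V) - \<eta>"
    have "8 * f0 * lam * (norm y)\<^sup>2 - real CARD('n) * Lam * (2 * f0 * (2 * X0 + \<eta>)) \<le> - f0 * G"
    proof (rule supersolution_quadratic_test[OF lam supersol, where ?x0.0 = x0 and ?t0.0 = t0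
          and r = "min (min r (t0 - t1)) (2 - norm x0)" and p = "- (4 * f0 * X0) *\<^sub>R y"])
      show "0 \<le> 2 * f0 * (2 * X0 + \<eta>)" "0 \<le> 8 * f0" using fpos[of t0] X0 \<eta> by (auto simp: f0_def)
      show "norm x0 < 2" "-4 < t0" "t0 \<le> 0" using x0 t0 x1 by auto
      show "0 < min (min r (t0 - t1)) (2 - norm x0)" using r t0 x0 by auto
      fix x t assume a: "norm (x - x0) < min (min r (t0 - t1)) (2 - norm x0)"
        "t0 - min (min r (t0 - t1)) (2 - norm x0) < t" "t \<le> t0"
      define h where "h = x - x0"
      define s where "s = t0 - t"
      have hs: "norm h < r" "0 \<le> s" "s < r" using a by (auto simp: h_def s_def)
      have t: "t1 \<le> t" using a(2) by (auto simp: min_def split: if_splits)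
      have "norm x \<le> norm x0 + norm (x - x0)" by (metis norm_triangle_sub)
      then have "(x, t) \<in> ?K" using a t t0 by auto
      from z0(2)[OF this] have 1: "u (x0, t0) - \<Phi> (x0, t0) \<le> u (x, t) - \<Phi> (x, t)" by (simp add: z0_eq)
      define X where "X = X0 - \<beta> * s - ((norm (y + h - s *\<^sub>R v))\<^sup>2 - (norm y)\<^sup>2)"
      note ex = r(2)[OF hs X_def]
      have fge: "f0 * (1 + g * s) \<le> f t"
      proof -
        have St: "S t = S t0 - \<beta> * s" by (simp add: S_def s_def algebra_simps)
        have "ln (S t / S t0) \<le> S t / S t0 - 1" using S t t0 by (intro ln_le_minus_one) auto
        moreover have "S t / S t0 - 1 = - (\<beta> * s / S t0)" unfolding St using S[of t0] t0 by (simp add: field_simps)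
        moreover have "ln (S t / S t0) = ln (S t / \<kappa>\<^sup>2) - ln (S t0 / \<kappa>\<^sup>2)"
          using S[of t0] S[of t] t t0 \<kappa> by (simp add: ln_div)
        ultimately have "\<beta> * s / S t0 \<le> ln (S t0 / \<kappa>\<^sup>2) - ln (S t / \<kappa>\<^sup>2)" by linarith
        from mult_left_mono[OF this, of spread_exp] have "spread_exp * (\<beta> * s / S t0) \<le> spread_exp * (ln (S t0 / \<kappa>\<^sup>2) - ln (S t / \<kappa>\<^sup>2))"
          using M by simp
        then have "g * s \<le> spread_exp * (ln (S t0 / \<kappa>\<^sup>2) - ln (S t / \<kappa>\<^sup>2)) + M * s"
          by (simp add: g_def distrib_right)
        also have "\<dots> = (spread_exp * ln (S t0 / \<kappa>\<^sup>2) + M * (t0 - t1)) - (spread_exp * ln (S t / \<kappa>\<^sup>2) + M * (t - t1))" (is "_ = ?a - ?b")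
          by (simp add: s_def algebra_simps)
        finally have "1 + g * s \<le> exp (?a - ?b)" using exp_ge_add_one_self[of "?a - ?b"] by linarith
        then have "f0 * (1 + g * s) \<le> f0 * exp (?a - ?b)" using fpos[of t0] by (intro mult_left_mono) (auto simp: f0_def)
        also have "\<dots> = f t"
          unfolding f0_def f_def mult.assoc exp_add[symmetric] by simp
        finally show ?thesis .
      qed
      have "X \<le> \<xi> (x, t)"
      proof -
        have "x - c t = y + h - s *\<^sub>R v"
          using T by (simp add: y_def h_def s_def c_def v_def algebra_simps diff_divide_distrib)
        moreover have "\<rho>0 - \<beta> * s \<le> \<rho> t"
        proof -
          have "0 \<le> \<beta> * s" using hs(2) beta(1) by simp
          moreover have "S t = S t0 - \<beta> * s" by (simp add: S_def s_def algebra_simps)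
          ultimately show ?thesis unfolding \<rho>0_def \<rho>_def by (auto simp: min_def)
        qed
        ultimately show ?thesis using y2 by (simp add: X_def \<xi>_def)
      qed
      then have "X\<^sup>2 \<le> (max 0 (\<xi> (x, t)))\<^sup>2" using ex by (intro power_mono) auto
      then have "f0 * (1 + g * s) * X\<^sup>2 \<le> \<Phi> (x, t)"
        unfolding \<Phi>_def snd_conv using fge fpos[of t0] fpos[of t] g hs
        by (intro mult_mono) (auto simp: f0_def)
      moreover have "f0 * (X0\<^sup>2 + s * G - 4 * X0 * (y \<bullet> h) - (2 * X0 + \<eta>) * (norm h)\<^sup>2 + 4 * (y \<bullet> h)\<^sup>2)
          \<le> f0 * ((1 + g * s) * X\<^sup>2)"
        using ex fpos[of t0] unfolding G_def V_def by (intro mult_left_mono) (auto simp: f0_def)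
      moreover have "\<Phi> (x0, t0) = f0 * X0\<^sup>2" using X0 by (simp add: \<Phi>_def f0_def X0_def)
      ultimately have "u (x0, t0) + f0 * (s * G - 4 * X0 * (y \<bullet> h) - (2 * X0 + \<eta>) * (norm h)\<^sup>2 + 4 * (y \<bullet> h)\<^sup>2)
          \<le> u (x, t)"
        using 1 by (simp add: algebra_simps)
      then show "u (x0, t0) + - f0 * G * (t - t0) + (- (4 * f0 * X0) *\<^sub>R y) \<bullet> (x - x0)
         - 2 * f0 * (2 * X0 + \<eta>) / 2 * (norm (x - x0))\<^sup>2 + 8 * f0 / 2 * (y \<bullet> (x - x0))\<^sup>2 \<le> u (x, t)"
        unfolding h_def[symmetric] by (simp add: s_def algebra_simps add_divide_distrib)
    qed
    then have "f0 * (8 * lam * (norm y)\<^sup>2 - (\<beta> - 1) * (2 * (2 * X0 + \<eta>)) + G) \<le> 0"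
      unfolding beta(3) by (simp add: algebra_simps)
    then have "8 * lam * (norm y)\<^sup>2 - (\<beta> - 1) * (2 * (2 * X0 + \<eta>)) + G \<le> 0"
      using fpos[of t0] by (simp add: f0_def mult_le_0_iff)
    moreover have "8 * lam * (norm y)\<^sup>2 - (\<beta> - 1) * (2 * (2 * X0 + \<eta>)) + G = Q - (2 * \<beta> - 1) * \<eta>"
      unfolding y2 G_def Q_def B_def by (simp add: algebra_simps)
    moreover have "(2 * \<beta> - 1) * \<eta> = Q - \<eta>" using beta by (simp add: \<eta>_def field_simps)
    ultimately show False using \<eta> by linarith
  qed
  have ST: "S 0 \<le> 1 + \<beta>"
  proof -
    have "\<beta> * - t1 \<le> \<beta> * 1" using beta T by (intro mult_left_mono) (auto simp: T_def)
    then show ?thesis using \<kappa>2 by (simp add: S_def)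
  qed
  have "spread_const * \<kappa> powr (2 * spread_exp) * \<mu> \<le> f 0 * \<kappa>^4"
  proof -
    have "ln (S 0 / \<kappa>\<^sup>2) \<le> ln (1 + \<beta>) - 2 * ln \<kappa>"
      using ST S[of 0] x1 \<kappa> beta by (simp add: ln_div ln_realpow)
    then have "spread_exp * ln (S 0 / \<kappa>\<^sup>2) + M * (0 - t1) \<le> spread_exp * (ln (1 + \<beta>) - 2 * ln \<kappa>) + M * 1"
      using M T by (intro add_mono mult_left_mono) (auto simp: T_def)
    then have "exp (- (spread_exp * (ln (1 + \<beta>) - 2 * ln \<kappa>) + M)) \<le> exp (- (spread_exp * ln (S 0 / \<kappa>\<^sup>2) + M * (0 - t1)))"
      by simp
    moreover have "exp (- (spread_exp * (ln (1 + \<beta>) - 2 * ln \<kappa>) + M)) = spread_const * \<kappa> powr (2 * spread_exp)"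
      using beta \<kappa> by (simp add: spread_const_def powr_def M_def exp_add[symmetric] algebra_simps)
    ultimately have "spread_const * \<kappa> powr (2 * spread_exp) \<le> exp (- (spread_exp * ln (S 0 / \<kappa>\<^sup>2) + M * (0 - t1)))" by (simp only:)
    then have "spread_const * \<kappa> powr (2 * spread_exp) * \<mu> \<le> exp (- (spread_exp * ln (S 0 / \<kappa>\<^sup>2) + M * (0 - t1))) * \<mu>"
      using \<mu> by (intro mult_right_mono) auto
    also have "\<dots> = f 0 * \<kappa>^4" using \<kappa> by (simp add: f_def)
    finally show ?thesis .
  qed
  also have "\<dots> \<le> \<Phi> (0, 0)"
  proof -
    have "\<kappa>\<^sup>2 \<le> \<rho> 0" using S[of 0] x1 \<kappa>2 by (simp add: \<rho>_def)
    then have "(\<kappa>\<^sup>2)\<^sup>2 \<le> (max 0 (\<rho> 0))\<^sup>2" by (intro power_mono) auto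
    then show ?thesis using fpos[of 0] by (simp add: \<Phi>_def \<xi>_def c_def mult_left_mono flip: power_mult)
  qed
  finally show ?thesis using main by linarith
qed

end

section \<open>Covering by grids, and measures of compact relations\<close>

lemma measure_cube:
  fixes a :: "'a::euclidean_space"
  assumes "0 \<le> \<rho>"
  shows "measure lebesgue (cbox (a - \<rho> *\<^sub>R One) (a + \<rho> *\<^sub>R One)) = (2 * \<rho>) ^ DIM('a)"
proof -
  have "measure lebesgue (cbox (a - \<rho> *\<^sub>R One) (a + \<rho> *\<^sub>R One))
      = (\<Prod>i\<in>Basis. ((a + \<rho> *\<^sub>R One) - (a - \<rho> *\<^sub>R One)) \<bullet> i)"
    using assms by (subst measure_completion)
      (auto simp: measure_lborel_cbox_eq inner_diff_left inner_add_left)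
  also have "\<dots> = (\<Prod>i\<in>(Basis::'a set). 2 * \<rho>)"
    by (intro prod.cong) (auto simp: inner_diff_left inner_add_left)
  finally show ?thesis by simp
qed

lemma measure_band:
  fixes K :: "'a::euclidean_space set"
  assumes K: "compact K" and f: "continuous_on K f" and H: "0 \<le> H"
  shows "{(y, h). y \<in> K \<and> \<bar>h - f y\<bar> \<le> H} \<in> lmeasurable"
    and "measure lebesgue {(y, h). y \<in> K \<and> \<bar>h - (f y :: real)\<bar> \<le> H} = measure lebesgue K * (2 * H)"
proof -
  let ?B = "{(y, h). y \<in> K \<and> \<bar>h - f y\<bar> \<le> H}"
  have "?B = (\<lambda>(y, s). (y, f y + s)) ` (K \<times> {-H..H})"
  proof (intro equalityI subsetI)
    fix p assume "p \<in> ?B"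
    then have "fst p \<in> K" "snd p - f (fst p) \<in> {-H..H}" by auto
    then show "p \<in> (\<lambda>(y, s). (y, f y + s)) ` (K \<times> {-H..H})"
      by (intro image_eqI[of _ _ "(fst p, snd p - f (fst p))"]) auto
  qed auto
  moreover have "compact ((\<lambda>(y, s). (y, f y + s)) ` (K \<times> {-H..H}))"
    unfolding case_prod_unfold
    by (intro compact_continuous_image compact_Times K compact_Icc continuous_intros
        continuous_on_compose2[OF f]) auto
  ultimately have c: "compact ?B" by simp
  then show lm: "?B \<in> lmeasurable" by (rule lmeasurable_compact)
  have bor: "?B \<in> sets (lborel \<Otimes>\<^sub>M lborel)" using borel_compact[OF c] unfolding lborel_prod by simp
  have sl: "emeasure lborel (Pair y -` ?B) = ennreal (2 * H) * indicator K y" for y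
  proof (cases "y \<in> K")
    case True
    then have "Pair y -` ?B = {f y - H..f y + H}" by (auto simp: abs_le_iff)
    then show ?thesis using True H by simp
  qed auto
  have "emeasure lborel ?B = (\<integral>\<^sup>+ y. emeasure lborel (Pair y -` ?B) \<partial>lborel)"
    using lborel.emeasure_pair_measure_alt[OF bor] by (simp add: lborel_prod)
  also have "\<dots> = ennreal (2 * H) * emeasure lborel K"
    unfolding sl using borel_compact[OF K] by (intro nn_integral_cmult_indicator) auto
  finally have "emeasure lebesgue ?B = ennreal (2 * H) * emeasure lebesgue K"
    using borel_compact[OF K] borel_compact[OF c] by simp
  then have "ennreal (measure lebesgue ?B) = ennreal (2 * H * measure lebesgue K)"
    using lm lmeasurable_compact[OF K] H by (simp add: emeasure_eq_measure2 ennreal_mult)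
  then show "measure lebesgue ?B = measure lebesgue K * (2 * H)" using H by simp
qed

lemma prod_Basis_Pair:
  fixes a :: "'a::euclidean_space" and b :: real
  shows "(\<Prod>i\<in>Basis. (a, b) \<bullet> i) = (\<Prod>i\<in>Basis. a \<bullet> i) * b"
proof -
  have "(\<Prod>i\<in>Basis. (a, b) \<bullet> i) = (\<Prod>i\<in>(\<lambda>u. (u, 0)) ` Basis. (a, b) \<bullet> i) * (\<Prod>i\<in>(\<lambda>u. (0, u)) ` Basis. (a, b) \<bullet> i)"
    unfolding Basis_prod_def by (rule prod.union_disjoint) auto
  also have "\<dots> = (\<Prod>i\<in>Basis. a \<bullet> i) * b"
    by (subst prod.reindex; simp add: inj_on_def)+
  finally show ?thesis .
qed

text \<open>
  The cells of a grid with side lengths \<open>d \<bullet> i\<close> are the level sets of this function, half-open boxes.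
\<close>

definition grid_index :: "'a::euclidean_space \<Rightarrow> 'a \<Rightarrow> 'a" where
  "grid_index d x = (\<Sum>i\<in>Basis. real_of_int \<lfloor>(x \<bullet> i) / (d \<bullet> i)\<rfloor> *\<^sub>R i)"

definition grid_lo :: "'a::euclidean_space \<Rightarrow> 'a \<Rightarrow> 'a" where
  "grid_lo d k = (\<Sum>i\<in>Basis. ((k \<bullet> i) * (d \<bullet> i)) *\<^sub>R i)"

lemma grid_index_inner: "i \<in> Basis \<Longrightarrow> grid_index d x \<bullet> i = real_of_int \<lfloor>(x \<bullet> i) / (d \<bullet> i)\<rfloor>"
  by (simp add: grid_index_def)

lemma grid_lo_inner: "i \<in> Basis \<Longrightarrow> grid_lo d k \<bullet> i = (k \<bullet> i) * (d \<bullet> i)"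
  by (simp add: grid_lo_def)

lemma in_grid_cell:
  assumes "\<And>i. i \<in> Basis \<Longrightarrow> 0 < d \<bullet> i"
  shows "x \<in> cbox (grid_lo d (grid_index d x)) (grid_lo d (grid_index d x) + d)"
proof -
  have "(grid_index d x \<bullet> i) * (d \<bullet> i) \<le> x \<bullet> i \<and> x \<bullet> i \<le> (grid_index d x \<bullet> i) * (d \<bullet> i) + d \<bullet> i"
    if i: "i \<in> Basis" for i
  proof -
    let ?q = "(x \<bullet> i) / (d \<bullet> i)"
    have "real_of_int \<lfloor>?q\<rfloor> * (d \<bullet> i) \<le> ?q * (d \<bullet> i)" "?q * (d \<bullet> i) \<le> (real_of_int \<lfloor>?q\<rfloor> + 1) * (d \<bullet> i)"
      using assms[OF i] by (intro mult_right_mono; linarith)+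
    then show ?thesis using assms[OF i] i by (simp add: grid_index_inner distrib_right)
  qed
  then show ?thesis by (simp add: mem_box grid_lo_inner inner_add_left)
qed

lemma grid_index_of_interior:
  assumes d: "\<And>i. i \<in> Basis \<Longrightarrow> 0 < d \<bullet> i"
    and z: "z \<in> box (grid_lo d (grid_index d x)) (grid_lo d (grid_index d x) + d)"
  shows "grid_index d z = grid_index d x"
proof (rule euclidean_eqI)
  fix i :: 'a assume i: "i \<in> Basis"
  let ?m = "\<lfloor>(x \<bullet> i) / (d \<bullet> i)\<rfloor>"
  have "real_of_int ?m * (d \<bullet> i) < z \<bullet> i" "z \<bullet> i < real_of_int ?m * (d \<bullet> i) + d \<bullet> i"
    using z i by (auto simp: mem_box grid_lo_inner inner_add_left grid_index_inner)
  then have "real_of_int ?m \<le> (z \<bullet> i) / (d \<bullet> i)" "(z \<bullet> i) / (d \<bullet> i) < real_of_int ?m + 1"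
    using d[OF i] by (auto simp: field_simps)
  then have "\<lfloor>(z \<bullet> i) / (d \<bullet> i)\<rfloor> = ?m" by (simp add: floor_eq_iff)
  then show "grid_index d z \<bullet> i = grid_index d x \<bullet> i" using i by (simp add: grid_index_inner)
qed

lemma grid_index_eq_imp_close:
  assumes d: "\<And>i. i \<in> Basis \<Longrightarrow> 0 < d \<bullet> i" and eq: "grid_index d x = grid_index d z" and i: "i \<in> Basis"
  shows "\<bar>(x - z) \<bullet> i\<bar> \<le> d \<bullet> i"
proof -
  let ?l = "grid_lo d (grid_index d z)"
  have "?l \<bullet> i \<le> w \<bullet> i \<and> w \<bullet> i \<le> ?l \<bullet> i + d \<bullet> i" if "w \<in> {x, z}" for w
    using in_grid_cell[OF d, of w] i that unfolding mem_box by (auto simp: eq inner_add_left)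
  from this[of x] this[of z] show ?thesis by (simp add: inner_diff_left abs_le_iff)
qed

lemma finite_grid_index_image:
  assumes d: "\<And>i. i \<in> Basis \<Longrightarrow> 0 < d \<bullet> i" and S: "bounded S"
  shows "finite (grid_index d ` S)"
proof -
  obtain B where B: "\<And>x. x \<in> S \<Longrightarrow> norm x \<le> B" using S bounded_iff by blast
  let ?F = "PiE Basis (\<lambda>i. {\<lfloor>- B / (d \<bullet> i)\<rfloor>..\<lfloor>B / (d \<bullet> i)\<rfloor>})"
  have "grid_index d ` S \<subseteq> (\<lambda>f. \<Sum>i\<in>Basis. real_of_int (f i) *\<^sub>R i) ` ?F"
  proof
    fix k assume "k \<in> grid_index d ` S"
    then obtain x where x: "x \<in> S" "k = grid_index d x" by blast
    define f where "f = restrict (\<lambda>i. \<lfloor>(x \<bullet> i) / (d \<bullet> i)\<rfloor>) Basis"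
    have "f \<in> ?F"
    proof (rule PiE_I)
      fix i :: 'a assume i: "i \<in> Basis"
      have "\<bar>x \<bullet> i\<bar> \<le> B" using Basis_le_norm[OF i, of x] B[OF x(1)] by simp
      then have "- B / (d \<bullet> i) \<le> (x \<bullet> i) / (d \<bullet> i)" "(x \<bullet> i) / (d \<bullet> i) \<le> B / (d \<bullet> i)"
        using d[OF i] by (intro divide_right_mono; linarith)+
      then show "f i \<in> {\<lfloor>- B / (d \<bullet> i)\<rfloor>..\<lfloor>B / (d \<bullet> i)\<rfloor>}"
        using i by (simp add: f_def floor_mono)
    qed (simp add: f_def)
    moreover have "k = (\<Sum>i\<in>Basis. real_of_int (f i) *\<^sub>R i)"
      unfolding x(2) grid_index_def f_def by (intro sum.cong) auto
    ultimately show "k \<in> (\<lambda>f. \<Sum>i\<in>Basis. real_of_int (f i) *\<^sub>R i) ` ?F" by blast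
  qed
  moreover have "finite ?F" by (intro finite_PiE) auto
  ultimately show ?thesis by (meson finite_imageI finite_subset)
qed

lemma grid_cells_content:
  assumes d: "\<And>i. i \<in> Basis \<Longrightarrow> 0 < d \<bullet> i" and K: "finite K" "K \<subseteq> range (grid_index d)"
    and U: "U \<in> lmeasurable" "\<And>k. k \<in> K \<Longrightarrow> cbox (grid_lo d k) (grid_lo d k + d) \<subseteq> U"
  shows "real (card K) * (\<Prod>i\<in>Basis. d \<bullet> i) \<le> measure lebesgue U"
proof -
  let ?b = "\<lambda>k. box (grid_lo d k) (grid_lo d k + d)"
  have disj: "disjoint_family_on ?b K"
    unfolding disjoint_family_on_def
  proof (intro ballI impI)
    fix k l assume kl: "k \<in> K" "l \<in> K" "k \<noteq> l"
    have "grid_index d z = k" if k: "k \<in> K" and z: "z \<in> ?b k" for z k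
    proof -
      obtain x where "k = grid_index d x" using K(2) k by blast
      moreover from z have "grid_index d z = grid_index d x"
        unfolding calculation by (intro grid_index_of_interior d)
      ultimately show ?thesis by simp
    qed
    then show "?b k \<inter> ?b l = {}"
      using kl by blast
  qed
  have m: "measure lebesgue (?b k) = (\<Prod>i\<in>Basis. d \<bullet> i)" for k
    using d by (simp add: measure_lborel_box_eq inner_add_left less_imp_le)
  have "real (card K) * (\<Prod>i\<in>Basis. d \<bullet> i) = (\<Sum>k\<in>K. measure lebesgue (?b k))"
    unfolding m by simp
  also have "\<dots> = measure lebesgue (\<Union>k\<in>K. ?b k)"
    using disj K(1) by (intro measure_finite_Union[symmetric])
      (auto simp: emeasure_lborel_box_eq less_top[symmetric])
  also have "\<dots> \<le> measure lebesgue U"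
  proof (rule measure_mono_fmeasurable)
    show "(\<Union>k\<in>K. ?b k) \<subseteq> U"
      using U(2) box_subset_cbox by blast
    show "(\<Union>k\<in>K. ?b k) \<in> sets lebesgue" using K(1) by (intro sets.finite_UN) auto
  qed (rule U(1))
  finally show ?thesis .
qed

text \<open>
  An outer measure argument: if the points of \<open>E\<close> whose image lies in one grid cell form a set of
  measure at most \<open>C\<close> times that of the cell, for all fine grids, then \<open>E\<close> has measure at most \<open>C\<close>
  times that of \<open>S\<close>. Only the cells inside an open set \<open>U\<close> slightly larger than \<open>S\<close> are counted. A point of \<open>E\<close> is seen by all grids that are fine enough,
  the required fineness depending on the point, hence the limit inferior of sets.
\<close>

lemma measure_le_grid_images:
  fixes g :: "'b::euclidean_space \<Rightarrow> 'a::euclidean_space" and d :: "nat \<Rightarrow> 'a"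
  assumes S: "S \<in> lmeasurable" "bounded S" and g: "g ` E \<subseteq> S" and E: "E \<in> sets lebesgue" and C: "0 \<le> C"
    and d: "\<And>m i. i \<in> Basis \<Longrightarrow> 0 < d m \<bullet> i" and lim: "d \<longlonglongrightarrow> 0"
    and cell: "eventually (\<lambda>m. \<forall>x\<in>E. \<exists>W. W \<in> lmeasurable \<and>
        {z\<in>E. grid_index (d m) (g z) = grid_index (d m) (g x)} \<subseteq> W \<and>
        measure lebesgue W \<le> C * (\<Prod>i\<in>Basis. d m \<bullet> i)) sequentially"
  shows "E \<in> lmeasurable" "measure lebesgue E \<le> C * measure lebesgue S"
proof -
  obtain m0 where m0: "\<And>m x. m \<ge> m0 \<Longrightarrow> x \<in> E \<Longrightarrow> \<exists>W. W \<in> lmeasurable \<and>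
        {z\<in>E. grid_index (d m) (g z) = grid_index (d m) (g x)} \<subseteq> W \<and>
        measure lebesgue W \<le> C * (\<Prod>i\<in>Basis. d m \<bullet> i)"
    using cell unfolding eventually_sequentially by blast
  have key: "emeasure lebesgue E \<le> ennreal (C * (measure lebesgue S + \<epsilon>))" if \<epsilon>: "\<epsilon> > 0" for \<epsilon>
  proof -
    obtain U where U: "open U" "S \<subseteq> U" "U - S \<in> lmeasurable" "emeasure lebesgue (U - S) < ennreal \<epsilon>"
      using sets_lebesgue_outer_open[of S \<epsilon>] S(1) \<epsilon> by (auto simp: fmeasurableD)
    have "U = S \<union> (U - S)" using U(2) by blast
    then have Um: "U \<in> lmeasurable" using S(1) U(3) by (metis fmeasurable.Un)
    have "measure lebesgue U \<le> measure lebesgue S + measure lebesgue (U - S)"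
      using measure_Un_le[of S lebesgue "U - S"] S(1) U(3) \<open>U = S \<union> (U - S)\<close> by (auto simp: fmeasurableD)
    moreover have "measure lebesgue (U - S) \<le> \<epsilon>"
      using U(3,4) \<epsilon> by (simp add: emeasure_eq_measure2 ennreal_less_iff)
    ultimately have U_le: "measure lebesgue U \<le> measure lebesgue S + \<epsilon>" by linarith
    define cl where "cl = (\<lambda>m x. cbox (grid_lo (d m) (grid_index (d m) x)) (grid_lo (d m) (grid_index (d m) x) + d m))"
    define Em where "Em = (\<lambda>m. {z\<in>E. cl m (g z) \<subseteq> U})"
    have V: "\<exists>V. V \<in> lmeasurable \<and> Em m \<subseteq> V \<and> measure lebesgue V \<le> C * measure lebesgue U" if m: "m \<ge> m0" for m
    proof -
      define K where "K = (\<lambda>z. grid_index (d m) (g z)) ` Em m"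
      have "K \<subseteq> grid_index (d m) ` S" using g by (auto simp: K_def Em_def)
      then have fin: "finite K" using finite_grid_index_image[OF d S(2)] finite_subset by blast
      have "\<forall>k\<in>K. \<exists>W. W \<in> lmeasurable \<and> {z\<in>E. grid_index (d m) (g z) = k} \<subseteq> W \<and>
        measure lebesgue W \<le> C * (\<Prod>i\<in>Basis. d m \<bullet> i)"
        using m0[OF m] by (auto simp: K_def Em_def)
      from bchoice[OF this] obtain W where "\<forall>k\<in>K. W k \<in> lmeasurable \<and>
        {z\<in>E. grid_index (d m) (g z) = k} \<subseteq> W k \<and> measure lebesgue (W k) \<le> C * (\<Prod>i\<in>Basis. d m \<bullet> i)" ..
      then have W: "\<And>k. k \<in> K \<Longrightarrow> W k \<in> lmeasurable"
        "\<And>k. k \<in> K \<Longrightarrow> {z\<in>E. grid_index (d m) (g z) = k} \<subseteq> W k"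
        "\<And>k. k \<in> K \<Longrightarrow> measure lebesgue (W k) \<le> C * (\<Prod>i\<in>Basis. d m \<bullet> i)" by blast+
      have "measure lebesgue (\<Union>k\<in>K. W k) \<le> (\<Sum>k\<in>K. measure lebesgue (W k))"
        using fin W(1) by (intro measure_UNION_le) (auto simp: fmeasurableD)
      also have "\<dots> \<le> (\<Sum>k\<in>K. C * (\<Prod>i\<in>Basis. d m \<bullet> i))" using W(3) by (intro sum_mono)
      also have "\<dots> = C * (real (card K) * (\<Prod>i\<in>Basis. d m \<bullet> i))" by simp
      also have "\<dots> \<le> C * measure lebesgue U"
      proof (intro mult_left_mono grid_cells_content d fin Um)
        fix k assume "k \<in> K"
        then show "cbox (grid_lo (d m) k) (grid_lo (d m) k + d m) \<subseteq> U"
          by (auto simp: K_def Em_def cl_def)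
      qed (use C in \<open>auto simp: K_def\<close>)
      finally have "measure lebesgue (\<Union>k\<in>K. W k) \<le> C * measure lebesgue U" .
      moreover have "Em m \<subseteq> (\<Union>k\<in>K. W k)" using W(2) by (fastforce simp: K_def Em_def)
      moreover have "(\<Union>k\<in>K. W k) \<in> lmeasurable" using fin W(1) by (intro fmeasurable.finite_UN) auto
      ultimately show ?thesis by blast
    qed
    then have "\<forall>m\<in>{m0..}. \<exists>V. V \<in> lmeasurable \<and> Em m \<subseteq> V \<and> measure lebesgue V \<le> C * measure lebesgue U"
      by simp
    from bchoice[OF this] obtain V where "\<forall>m\<in>{m0..}. V m \<in> lmeasurable \<and> Em m \<subseteq> V m
      \<and> measure lebesgue (V m) \<le> C * measure lebesgue U" ..
    then have V: "\<And>m. m \<ge> m0 \<Longrightarrow> V m \<in> lmeasurable" "\<And>m. m \<ge> m0 \<Longrightarrow> Em m \<subseteq> V m"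
      "\<And>m. m \<ge> m0 \<Longrightarrow> measure lebesgue (V m) \<le> C * measure lebesgue U" by simp_all
    define B where "B = (\<lambda>j. \<Inter>m\<in>{m0 + j..}. V m)"
    have Bs: "B j \<in> sets lebesgue" for j
      unfolding B_def using V(1) by (intro sets.countable_INT'') (auto simp: fmeasurableD)
    have Bm: "emeasure lebesgue (B j) \<le> ennreal (C * measure lebesgue U)" for j
    proof -
      have "emeasure lebesgue (B j) \<le> emeasure lebesgue (V (m0 + j))"
        using V(1)[of "m0 + j"] by (intro emeasure_mono) (auto simp: B_def fmeasurableD)
      also have "\<dots> \<le> ennreal (C * measure lebesgue U)"
        using V(1,3)[of "m0 + j"] by (simp add: emeasure_eq_measure2 ennreal_leI)
      finally show ?thesis .
    qed
    have inc: "incseq B" unfolding B_def incseq_def by (auto intro!: INT_I)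
    have "E \<subseteq> (\<Union>j. B j)"
    proof
      fix z assume z: "z \<in> E"
      then have "g z \<in> U" using g U(2) by auto
      then obtain r where r: "r > 0" "ball (g z) r \<subseteq> U" using U(1) openE by blast
      have "((\<lambda>m. \<Sum>i\<in>Basis. d m \<bullet> i) \<longlongrightarrow> (\<Sum>i\<in>Basis. (0::'a) \<bullet> i)) sequentially"
        by (intro tendsto_intros lim)
      then have "eventually (\<lambda>m. (\<Sum>i\<in>Basis. d m \<bullet> i) < r) sequentially"
        using r(1) by (intro order_tendstoD) auto
      then obtain j where j: "\<And>m. m \<ge> j \<Longrightarrow> (\<Sum>i\<in>Basis. d m \<bullet> i) < r"
        unfolding eventually_sequentially by blast
      have "cl m (g z) \<subseteq> U" if "m \<ge> j" for m
      proof
        fix w assume w: "w \<in> cl m (g z)"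
        have "norm (w - g z) \<le> (\<Sum>i\<in>Basis. \<bar>(w - g z) \<bullet> i\<bar>)" by (rule norm_le_l1)
        also have "\<dots> \<le> (\<Sum>i\<in>Basis. d m \<bullet> i)"
          using w in_grid_cell[of "d m" "g z", OF d] unfolding cl_def
          by (intro sum_mono) (simp add: mem_box inner_add_left inner_diff_left abs_le_iff, fastforce)
        also have "\<dots> < r" by (rule j[OF that])
        finally show "w \<in> U" using r(2) by (auto simp: dist_norm norm_minus_commute)
      qed
      then have "z \<in> Em m" if "m \<ge> j" for m using that z by (auto simp: Em_def)
      then have "z \<in> V m" if "m \<ge> m0 + j" for m
        using V(2)[of m] that by (meson add_leD1 add_leD2 subsetD)
      then have "z \<in> B j" by (auto simp: B_def)
      then show "z \<in> (\<Union>j. B j)" by blast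
    qed
    then have "emeasure lebesgue E \<le> emeasure lebesgue (\<Union>j. B j)"
      using Bs by (intro emeasure_mono) auto
    also have "\<dots> = (SUP j. emeasure lebesgue (B j))"
      using Bs inc by (intro SUP_emeasure_incseq[symmetric]) auto
    also have "\<dots> \<le> ennreal (C * measure lebesgue U)" using Bm by (intro SUP_least) auto
    also have "\<dots> \<le> ennreal (C * (measure lebesgue S + \<epsilon>))"
      using U_le C by (intro ennreal_leI mult_left_mono) auto
    finally show ?thesis .
  qed
  have "emeasure lebesgue E < \<infinity>" using key[of 1] by (simp add: order_le_less_trans ennreal_less_top)
  then show El: "E \<in> lmeasurable" using E by (simp add: fmeasurable_def)
  have le: "measure lebesgue E \<le> C * (measure lebesgue S + \<epsilon>)" if "\<epsilon> > 0" for \<epsilon>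
  proof -
    have "0 \<le> C * (measure lebesgue S + \<epsilon>)" using C that by (intro mult_nonneg_nonneg add_nonneg_nonneg) auto
    then show ?thesis using key[OF that] El by (simp add: emeasure_eq_measure2)
  qed
  show "measure lebesgue E \<le> C * measure lebesgue S"
  proof (rule field_le_epsilon)
    fix e :: real assume e: "0 < e"
    have "C * (e / (C + 1)) \<le> e" using e C by (simp add: field_simps)
    then show "measure lebesgue E \<le> C * measure lebesgue S + e"
      using le[of "e / (C + 1)"] e C by (simp add: distrib_left)
  qed
qed

lemma measure_le_expansive:
  fixes y :: "'a::euclidean_space \<Rightarrow> 'a"
  assumes E: "E \<in> sets lebesgue" and S: "S \<in> lmeasurable" "bounded S" and y: "y ` E \<subseteq> S" and L: "0 < L"
    and exp: "\<And>x z. x \<in> E \<Longrightarrow> z \<in> E \<Longrightarrow> norm (x - z) \<le> L * norm (y x - y z)"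
  shows "measure lebesgue E \<le> (2 * L * DIM('a)) ^ DIM('a) * measure lebesgue S"
proof (rule measure_le_grid_images(2)[where g = y and d = "\<lambda>m. (1 / real (Suc m)) *\<^sub>R One"])
  show "(\<lambda>m. (1 / real (Suc m)) *\<^sub>R One) \<longlonglongrightarrow> (0::'a)"
    using tendsto_scaleR[OF LIMSEQ_inverse_real_of_nat tendsto_const, of One]
    by (simp add: inverse_eq_divide)
  show "eventually (\<lambda>m. \<forall>x\<in>E. \<exists>W. W \<in> lmeasurable \<and>
        {z\<in>E. grid_index ((1 / real (Suc m)) *\<^sub>R One) (y z) = grid_index ((1 / real (Suc m)) *\<^sub>R One) (y x)} \<subseteq> W \<and>
        measure lebesgue W \<le> (2 * L * DIM('a)) ^ DIM('a) * (\<Prod>i\<in>Basis. (1 / real (Suc m)) *\<^sub>R One \<bullet> (i::'a))) sequentially"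
  proof (intro always_eventually allI ballI)
    fix m x assume x: "x \<in> E"
    define s where "s = 1 / real (Suc m)"
    define W where "W = cbox (x - (L * DIM('a) * s) *\<^sub>R One) (x + (L * DIM('a) * s) *\<^sub>R One)"
    have s: "s > 0" by (simp add: s_def)
    have "{z\<in>E. grid_index (s *\<^sub>R One) (y z) = grid_index (s *\<^sub>R One) (y x)} \<subseteq> W"
    proof clarify
      fix z assume z: "z \<in> E" "grid_index (s *\<^sub>R One) (y z) = grid_index (s *\<^sub>R One) (y x)"
      have "norm (y z - y x) \<le> (\<Sum>i\<in>Basis. \<bar>(y z - y x) \<bullet> i\<bar>)" by (rule norm_le_l1)
      also have "\<dots> \<le> (\<Sum>i\<in>(Basis::'a set). s)"
        using grid_index_eq_imp_close[OF _ z(2)] s by (intro sum_mono) (auto simp: inner_sum_left_Basis)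
      finally have "L * norm (y z - y x) \<le> L * (DIM('a) * s)" using L by simp
      then have n: "norm (z - x) \<le> L * DIM('a) * s" using exp[OF z(1) x] by (simp add: mult.assoc)
      show "z \<in> W" unfolding W_def mem_box
      proof
        fix i :: 'a assume i: "i \<in> Basis"
        have "\<bar>(z - x) \<bullet> i\<bar> \<le> L * DIM('a) * s" using Basis_le_norm[OF i, of "z - x"] n by simp
        then show "(x - (L * DIM('a) * s) *\<^sub>R One) \<bullet> i \<le> z \<bullet> i \<and> z \<bullet> i \<le> (x + (L * DIM('a) * s) *\<^sub>R One) \<bullet> i"
          using i by (auto simp: inner_diff_left inner_add_left)
      qed
    qed
    moreover have "measure lebesgue W = (2 * L * DIM('a)) ^ DIM('a) * (\<Prod>i\<in>Basis. s *\<^sub>R One \<bullet> (i::'a))"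
      unfolding W_def using L s
      by (subst measure_completion)
        (auto simp: measure_lborel_cbox_eq inner_diff_left inner_add_left power_mult_distrib[symmetric] mult_ac)
    moreover have "W \<in> lmeasurable" by (simp add: W_def)
    ultimately show "\<exists>W. W \<in> lmeasurable \<and>
        {z\<in>E. grid_index (s *\<^sub>R One) (y z) = grid_index (s *\<^sub>R One) (y x)} \<subseteq> W \<and>
        measure lebesgue W \<le> (2 * L * DIM('a)) ^ DIM('a) * (\<Prod>i\<in>Basis. s *\<^sub>R One \<bullet> (i::'a))" by auto
  qed
qed (use E S y L in auto)

lemma compact_slices:
  fixes K :: "('a::euclidean_space \<times> 'b::euclidean_space) set"
  assumes "compact K"
  shows "compact {x. (x, t) \<in> K}" "compact {t. (x, t) \<in> K}"
proof -
  have "{x. (x, t) \<in> K} = fst ` (K \<inter> (UNIV \<times> {t}))" "{t. (x, t) \<in> K} = snd ` (K \<inter> ({x} \<times> UNIV))" by force+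
  then show "compact {x. (x, t) \<in> K}" "compact {t. (x, t) \<in> K}"
    using assms by (auto intro!: compact_continuous_image compact_Int_closed closed_Times continuous_intros)
qed

text \<open>
  The relation pairs points \<open>(x, t)\<close> with parameters \<open>(y, h)\<close>. It is expansive from \<open>x\<close> to \<open>y\<close> only for
  fixed \<open>t\<close>, and from \<open>t\<close> to \<open>h\<close> only for fixed \<open>y\<close>, so the two measures are compared
  through the intermediate set of all \<open>(y, t)\<close>, slicing first by \<open>t\<close> and then by \<open>y\<close>. Compactness is
  what makes this projection measurable.
\<close>

lemma measure_compact_relation:
  fixes R :: "(('a::euclidean_space \<times> real) \<times> 'a \<times> real) set"
  assumes R: "compact R" and \<kappa>: "0 < \<kappa>"
    and space: "\<And>x1 x2 t y1 y2 h1 h2. ((x1, t), (y1, h1)) \<in> R \<Longrightarrow> ((x2, t), (y2, h2)) \<in> R \<Longrightarrow>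
      norm (x1 - x2) \<le> 2 * norm (y1 - y2)"
    and time: "\<And>x1 x2 t1 t2 y h1 h2. ((x1, t1), (y, h1)) \<in> R \<Longrightarrow> ((x2, t2), (y, h2)) \<in> R \<Longrightarrow>
      t1 < t2 \<Longrightarrow> \<kappa> * (t2 - t1) \<le> h1 - h2"
  shows "\<kappa> * measure lebesgue (fst ` R) \<le> 2 * (4 * DIM('a)) ^ DIM('a) * measure lebesgue (snd ` R)"
proof -
  define Z where "Z = (\<lambda>((x, t), (y, h)). (y, t)) ` R"
  have cZ: "compact Z" "compact (fst ` R)" "compact (snd ` R)"
    unfolding Z_def using R by (auto intro!: compact_continuous_image continuous_intros simp: case_prod_unfold)
  have bor: "K \<in> sets (lborel \<Otimes>\<^sub>M lborel)" "emeasure (lborel \<Otimes>\<^sub>M lborel) K = ennreal (measure lebesgue K)"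
    if "compact K" for K :: "('a \<times> real) set"
  proof -
    have "K \<in> lmeasurable" using that by (rule lmeasurable_compact)
    moreover have "K \<in> sets borel" using that by (simp add: borel_compact)
    ultimately show "K \<in> sets (lborel \<Otimes>\<^sub>M lborel)" "emeasure (lborel \<Otimes>\<^sub>M lborel) K = ennreal (measure lebesgue K)"
      unfolding lborel_prod using emeasure_eq_measure2[of K lebesgue] by (auto simp: main_part_sets)
  qed
  have em: "emeasure lborel T = ennreal (measure lebesgue T)" if "compact T" for T :: "'c::euclidean_space set"
    using emeasure_eq_measure2[OF lmeasurable_compact[OF that]] borel_compact[OF that] by simp
  have C: "0 \<le> (4 * real DIM('a)) ^ DIM('a)" by simp
  have sl1: "emeasure lborel {x. (x, t) \<in> fst ` R}
      \<le> ennreal ((4 * DIM('a)) ^ DIM('a)) * emeasure lborel {y. (y, t) \<in> Z}" for t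
  proof -
    have "\<forall>x\<in>{x. (x, t) \<in> fst ` R}. \<exists>y. \<exists>h. ((x, t), (y, h)) \<in> R" by force
    from bchoice[OF this] obtain y where y: "\<And>x. (x, t) \<in> fst ` R \<Longrightarrow> \<exists>h. ((x, t), (y x, h)) \<in> R" by blast
    have "measure lebesgue {x. (x, t) \<in> fst ` R} \<le> (2 * 2 * real DIM('a)) ^ DIM('a) * measure lebesgue {y. (y, t) \<in> Z}"
    proof (rule measure_le_expansive[where y = y])
      show "{x. (x, t) \<in> fst ` R} \<in> sets lebesgue"
        using compact_slices(1)[OF cZ(2)] lmeasurable_compact by blast
      show "{y. (y, t) \<in> Z} \<in> lmeasurable" "bounded {y. (y, t) \<in> Z}"
        using compact_slices(1)[OF cZ(1)] lmeasurable_compact compact_imp_bounded by blast+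
      show "y ` {x. (x, t) \<in> fst ` R} \<subseteq> {y. (y, t) \<in> Z}"
      proof (rule image_subsetI)
        fix x assume "x \<in> {x. (x, t) \<in> fst ` R}"
        then obtain h where "((x, t), (y x, h)) \<in> R" using y by blast
        then have "(y x, t) \<in> Z" unfolding Z_def by (rule rev_image_eqI) simp
        then show "y x \<in> {y. (y, t) \<in> Z}" by simp
      qed
      fix x z assume "x \<in> {x. (x, t) \<in> fst ` R}" "z \<in> {x. (x, t) \<in> fst ` R}"
      then show "norm (x - z) \<le> 2 * norm (y x - y z)" using y space by blast
    qed simp
    then show ?thesis
      using compact_slices(1)[OF cZ(2)] compact_slices(1)[OF cZ(1)]
      by (simp add: em ennreal_mult'[symmetric] ennreal_leI)
  qed
  have sl2: "ennreal \<kappa> * emeasure lborel {t. (y, t) \<in> Z} \<le> 2 * emeasure lborel {h. (y, h) \<in> snd ` R}" for y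
  proof -
    have "\<forall>t\<in>{t. (y, t) \<in> Z}. \<exists>h. \<exists>x. ((x, t), (y, h)) \<in> R" by (force simp: Z_def)
    from bchoice[OF this] obtain h where h: "\<And>t. (y, t) \<in> Z \<Longrightarrow> \<exists>x. ((x, t), (y, h t)) \<in> R" by blast
    have "measure lebesgue {t. (y, t) \<in> Z} \<le> (2 * (1 / \<kappa>) * DIM(real)) ^ DIM(real) * measure lebesgue {h. (y, h) \<in> snd ` R}"
    proof (rule measure_le_expansive[where y = h])
      show "{t. (y, t) \<in> Z} \<in> sets lebesgue"
        using compact_slices(2)[OF cZ(1)] lmeasurable_compact by blast
      show "{h. (y, h) \<in> snd ` R} \<in> lmeasurable" "bounded {h. (y, h) \<in> snd ` R}"
        using compact_slices(2)[OF cZ(3)] lmeasurable_compact compact_imp_bounded by blast+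
      show "h ` {t. (y, t) \<in> Z} \<subseteq> {h. (y, h) \<in> snd ` R}"
      proof (rule image_subsetI)
        fix t assume "t \<in> {t. (y, t) \<in> Z}"
        then obtain x where "((x, t), (y, h t)) \<in> R" using h by blast
        then have "(y, h t) \<in> snd ` R" by (rule rev_image_eqI) simp
        then show "h t \<in> {h. (y, h) \<in> snd ` R}" by simp
      qed
      fix s t assume "s \<in> {t. (y, t) \<in> Z}" "t \<in> {t. (y, t) \<in> Z}"
      then obtain x1 x2 where "((x1, s), (y, h s)) \<in> R" "((x2, t), (y, h t)) \<in> R" using h by blast
      then have "\<kappa> * \<bar>s - t\<bar> \<le> \<bar>h s - h t\<bar>"
        using time[of x1 s y "h s" x2 t "h t"] time[of x2 t y "h t" x1 s "h s"] by (cases s t rule: linorder_cases) auto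
      then show "norm (s - t) \<le> 1 / \<kappa> * norm (h s - h t)" using \<kappa> by (simp add: field_simps)
    qed (use \<kappa> in simp)
    then have "\<kappa> * measure lebesgue {t. (y, t) \<in> Z} \<le> 2 * measure lebesgue {h. (y, h) \<in> snd ` R}"
      using \<kappa> by (simp add: field_simps)
    then have "ennreal (\<kappa> * measure lebesgue {t. (y, t) \<in> Z}) \<le> ennreal (2 * measure lebesgue {h. (y, h) \<in> snd ` R})"
      by (rule ennreal_leI)
    then show ?thesis
      using compact_slices(2)[OF cZ(3)] compact_slices(2)[OF cZ(1)] \<kappa>
      by (simp add: em ennreal_mult)
  qed
  have "ennreal (measure lebesgue (fst ` R)) = (\<integral>\<^sup>+ t. emeasure lborel {x. (x, t) \<in> fst ` R} \<partial>lborel)"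
    using lborel_pair.emeasure_pair_measure_alt2[OF bor(1)[OF cZ(2)]] bor(2)[OF cZ(2)] by (simp add: vimage_def)
  also have "\<dots> \<le> (\<integral>\<^sup>+ t. ennreal ((4 * DIM('a)) ^ DIM('a)) * emeasure lborel {y. (y, t) \<in> Z} \<partial>lborel)"
    by (intro nn_integral_mono sl1)
  also have "\<dots> = ennreal ((4 * DIM('a)) ^ DIM('a)) * (\<integral>\<^sup>+ t. emeasure lborel {y. (y, t) \<in> Z} \<partial>lborel)"
    using lborel_pair.measurable_emeasure_Pair2[OF bor(1)[OF cZ(1)]]
    by (intro nn_integral_cmult) (simp add: vimage_def)
  also have "(\<integral>\<^sup>+ t. emeasure lborel {y. (y, t) \<in> Z} \<partial>lborel) = ennreal (measure lebesgue Z)"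
    using lborel_pair.emeasure_pair_measure_alt2[OF bor(1)[OF cZ(1)]] bor(2)[OF cZ(1)] by (simp add: vimage_def)
  finally have 1: "measure lebesgue (fst ` R) \<le> (4 * DIM('a)) ^ DIM('a) * measure lebesgue Z"
    by (simp add: ennreal_mult'[symmetric] ennreal_le_iff)
  have "ennreal \<kappa> * ennreal (measure lebesgue Z) = ennreal \<kappa> * (\<integral>\<^sup>+ y. emeasure lborel {t. (y, t) \<in> Z} \<partial>lborel)"
    using lborel.emeasure_pair_measure_alt[OF bor(1)[OF cZ(1)]] bor(2)[OF cZ(1)] by (simp add: vimage_def)
  also have "\<dots> = (\<integral>\<^sup>+ y. ennreal \<kappa> * emeasure lborel {t. (y, t) \<in> Z} \<partial>lborel)"
    using lborel.measurable_emeasure_Pair[OF bor(1)[OF cZ(1)]]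
    by (intro nn_integral_cmult[symmetric]) (simp add: vimage_def)
  also have "\<dots> \<le> (\<integral>\<^sup>+ y. 2 * emeasure lborel {h. (y, h) \<in> snd ` R} \<partial>lborel)"
    by (intro nn_integral_mono sl2)
  also have "\<dots> = 2 * (\<integral>\<^sup>+ y. emeasure lborel {h. (y, h) \<in> snd ` R} \<partial>lborel)"
    using lborel.measurable_emeasure_Pair[OF bor(1)[OF cZ(3)]]
    by (intro nn_integral_cmult) (simp add: vimage_def)
  also have "(\<integral>\<^sup>+ y. emeasure lborel {h. (y, h) \<in> snd ` R} \<partial>lborel) = ennreal (measure lebesgue (snd ` R))"
    using lborel.emeasure_pair_measure_alt[OF bor(1)[OF cZ(3)]] bor(2)[OF cZ(3)] by (simp add: vimage_def)
  also have "2 * ennreal (measure lebesgue (snd ` R)) = ennreal (2 * measure lebesgue (snd ` R))"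
    by (simp add: ennreal_mult)
  finally have "ennreal (\<kappa> * measure lebesgue Z) \<le> ennreal (2 * measure lebesgue (snd ` R))"
    using \<kappa> by (simp add: ennreal_mult)
  then have 2: "\<kappa> * measure lebesgue Z \<le> 2 * measure lebesgue (snd ` R)" by (simp add: ennreal_le_iff)
  have "\<kappa> * measure lebesgue (fst ` R) \<le> \<kappa> * ((4 * DIM('a)) ^ DIM('a) * measure lebesgue Z)"
    using 1 \<kappa> by (intro mult_left_mono) auto
  also have "\<dots> = (4 * DIM('a)) ^ DIM('a) * (\<kappa> * measure lebesgue Z)" by simp
  also have "\<dots> \<le> (4 * DIM('a)) ^ DIM('a) * (2 * measure lebesgue (snd ` R))"
    using 2 C by (intro mult_left_mono) auto
  finally show ?thesis by (simp add: mult_ac)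
qed

section \<open>The highest paraboloids below a supersolution\<close>

lemma continuous_on_Inf_compact:
  fixes G :: "'a::metric_space \<times> 'b::metric_space \<Rightarrow> real"
  assumes G: "continuous_on (P \<times> K) G" and K: "compact K" "K \<noteq> {}"
  shows "continuous_on P (\<lambda>p. Inf ((\<lambda>z. G (p, z)) ` K))"
    and "\<And>p. p \<in> P \<Longrightarrow> \<exists>z\<in>K. Inf ((\<lambda>z. G (p, z)) ` K) = G (p, z) \<and> (\<forall>w\<in>K. G (p, z) \<le> G (p, w))"
proof -
  show att: "\<exists>z\<in>K. Inf ((\<lambda>z. G (p, z)) ` K) = G (p, z) \<and> (\<forall>w\<in>K. G (p, z) \<le> G (p, w))" if p: "p \<in> P" for p
  proof -
    have "continuous_on K (\<lambda>z. G (p, z))"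
      by (rule continuous_on_compose2[OF G]) (use p in \<open>auto intro!: continuous_intros\<close>)
    then obtain z where z: "z \<in> K" "\<And>w. w \<in> K \<Longrightarrow> G (p, z) \<le> G (p, w)"
      using continuous_attains_inf[OF K] by blast
    have "Inf ((\<lambda>z. G (p, z)) ` K) = G (p, z)"
      using z by (intro cInf_eq_minimum) auto
    then show ?thesis using z by blast
  qed
  show "continuous_on P (\<lambda>p. Inf ((\<lambda>z. G (p, z)) ` K))"
    unfolding continuous_on_iff
  proof (intro ballI allI impI)
    fix p e assume p: "p \<in> P" and e: "0 < (e::real)"
    obtain X0 where X0: "p \<in> X0" "open X0" "\<forall>x\<in>X0 \<inter> P. \<forall>t\<in>K. dist (G (x, t)) (G (p, t)) \<le> e / 2"
      using continuous_on_prod_compactE[OF G K(1) p, of "e / 2"] e by auto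
    obtain d where d: "d > 0" "ball p d \<subseteq> X0" using X0(1,2) openE by blast
    show "\<exists>d>0. \<forall>x'\<in>P. dist x' p < d \<longrightarrow> dist (Inf ((\<lambda>z. G (x', z)) ` K)) (Inf ((\<lambda>z. G (p, z)) ` K)) < e"
    proof (intro exI[of _ d] conjI ballI impI d(1))
      fix x assume x: "x \<in> P" "dist x p < d"
      then have near: "\<bar>G (x, t) - G (p, t)\<bar> \<le> e / 2" if "t \<in> K" for t
        using X0(3) d(2) that by (auto simp: dist_commute dist_real_def subset_iff)
      obtain z where z: "z \<in> K" "Inf ((\<lambda>z. G (x, z)) ` K) = G (x, z)" "\<forall>w\<in>K. G (x, z) \<le> G (x, w)"
        using att[OF x(1)] by blast
      obtain w where w: "w \<in> K" "Inf ((\<lambda>z. G (p, z)) ` K) = G (p, w)" "\<forall>z\<in>K. G (p, w) \<le> G (p, z)"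
        using att[OF p] by blast
      have "G (x, z) \<le> G (x, w)" "G (p, w) \<le> G (p, z)" using z w by auto
      then show "dist (Inf ((\<lambda>z. G (x, z)) ` K)) (Inf ((\<lambda>z. G (p, z)) ` K)) < e"
        using near[OF z(1)] near[OF w(1)] e unfolding z(2) w(2) dist_real_def by linarith
    qed
  qed
qed

context nonneg_supersolution
begin

text \<open>
  The number \<open>h\<close> for which the paraboloid with vertex \<open>y\<close> and height \<open>h\<close> passes through the graph of \<open>u\<close>
  over \<open>z\<close>.
\<close>

definition height_at :: "real \<Rightarrow> real^'n \<Rightarrow> (real^'n) \<times> real \<Rightarrow> real" where
  "height_at A y z = u z - A * \<beta> * snd z + A / 2 * (norm (fst z - y))\<^sup>2"

lemma paraboloid_le_iff: "paraboloid A y h z \<le> u z \<longleftrightarrow> h \<le> height_at A y z"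
  and paraboloid_eq_iff: "u z = paraboloid A y h z \<longleftrightarrow> h = height_at A y z"
  by (auto simp: paraboloid_def height_at_def)

text \<open>
  The largest admissible height up to time \<open>t\<close> (\<open>below_iff_height\<close>). Clamping the time at \<open>t\<close> makes the
  infimum run over a compact set that does not depend on \<open>t\<close>, so that continuity in \<open>(y, t)\<close> is immediate.
\<close>

definition height :: "real \<Rightarrow> real^'n \<Rightarrow> real \<Rightarrow> real" where
  "height A y t = Inf ((\<lambda>z. height_at A y (fst z, min (snd z) t)) ` Q2bar)"

lemma min_in_Q2bar: "z \<in> Q2bar \<Longrightarrow> -4 \<le> t \<Longrightarrow> (fst z, min (snd z) t) \<in> Q2bar"
  by auto

lemma continuous_height_at:
  "continuous_on ((UNIV \<times> {-4..0}) \<times> Q2bar) (\<lambda>(p, z). height_at A (fst p) (fst z, min (snd z) (snd p)))"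
proof -
  have "continuous_on ((UNIV \<times> {-4..0}) \<times> Q2bar)
      (\<lambda>q :: ((real^'n) \<times> real) \<times> ((real^'n) \<times> real). u (fst (snd q), min (snd (snd q)) (snd (fst q))))"
    by (rule continuous_on_compose2[OF continuous_on_u]) (auto intro!: continuous_intros)
  then show ?thesis
    unfolding height_at_def case_prod_unfold fst_conv snd_conv
    by (intro continuous_on_add continuous_on_diff continuous_on_mult continuous_on_const
        continuous_on_power continuous_on_norm continuous_on_min continuous_on_fst continuous_on_snd continuous_on_id)
qed

lemma height_continuous: "continuous_on (UNIV \<times> {-4..0}) (\<lambda>p. height A (fst p) (snd p))"
proof -
  have "compact (Q2bar :: ((real^'n) \<times> real) set)" "Q2bar \<noteq> ({} :: ((real^'n) \<times> real) set)"
    by (auto intro!: compact_Times)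
  from continuous_on_Inf_compact(1)[OF continuous_height_at this, of A] show ?thesis
    by (simp only: height_def case_prod_conv)
qed

lemma height_attained:
  assumes t: "-4 \<le> t" "t \<le> 0"
  obtains z where "z \<in> Q2bar" "snd z \<le> t" "height A y t = height_at A y z"
    "\<And>w. w \<in> Q2bar \<Longrightarrow> snd w \<le> t \<Longrightarrow> height A y t \<le> height_at A y w"
proof -
  have "(y, t) \<in> UNIV \<times> {-4..0}" using t by simp
  moreover have "compact (Q2bar :: ((real^'n) \<times> real) set)" "Q2bar \<noteq> ({} :: ((real^'n) \<times> real) set)"
    by (auto intro!: compact_Times)
  ultimately obtain z where z: "z \<in> Q2bar" "height A y t = height_at A y (fst z, min (snd z) t)"
    "\<And>w. w \<in> Q2bar \<Longrightarrow> height_at A y (fst z, min (snd z) t) \<le> height_at A y (fst w, min (snd w) t)"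
    using continuous_on_Inf_compact(2)[OF continuous_height_at, of "(y, t)" A]
    unfolding height_def case_prod_conv fst_conv snd_conv by blast
  show ?thesis
  proof (rule that[of "(fst z, min (snd z) t)"])
    show "(fst z, min (snd z) t) \<in> Q2bar" using z(1) t(1) by (rule min_in_Q2bar)
    fix w :: "(real^'n) \<times> real" assume w: "w \<in> Q2bar" "snd w \<le> t"
    then have "(fst w, min (snd w) t) = w" by (simp add: min_absorb1)
    then show "height A y t \<le> height_at A y w" using z(3)[OF w(1)] z(2) by simp
  qed (use z in auto)
qed

lemma height_le_height_at:
  assumes "-4 \<le> t" "t \<le> 0" "w \<in> Q2bar" "snd w \<le> t"
  shows "height A y t \<le> height_at A y w"
  by (rule height_attained[OF assms(1,2), of A y]) (use assms(3,4) in simp)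

lemma below_iff_height:
  assumes t: "-4 \<le> t" "t \<le> 0"
  shows "below A y h t \<longleftrightarrow> h \<le> height A y t"
proof -
  obtain z where z: "z \<in> Q2bar" "snd z \<le> t" "height A y t = height_at A y z"
    "\<And>w. w \<in> Q2bar \<Longrightarrow> snd w \<le> t \<Longrightarrow> height A y t \<le> height_at A y w"
    by (rule height_attained[OF t, of A y]) (rule that)
  show ?thesis
    unfolding below_def paraboloid_le_iff
  proof
    assume "\<forall>z\<in>Q2bar. snd z \<le> t \<longrightarrow> h \<le> height_at A y z"
    then show "h \<le> height A y t" using z(1,2) unfolding z(3) by blast
  next
    assume "h \<le> height A y t"
    then show "\<forall>z\<in>Q2bar. snd z \<le> t \<longrightarrow> h \<le> height_at A y z" using z(4) order_trans by blast
  qed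
qed

lemma height_antimono:
  assumes "-4 \<le> s" "s \<le> t" "t \<le> 0"
  shows "height A y t \<le> height A y s"
proof -
  have "below A y (height A y t) t" using assms by (simp add: below_iff_height)
  then have "below A y (height A y t) s" using assms by (auto simp: below_def)
  then show ?thesis using assms by (simp add: below_iff_height)
qed

lemma touch_iff_height:
  assumes "z \<in> Q2bar"
  shows "touch A y h z \<longleftrightarrow> h = height_at A y z \<and> height A y (snd z) = height_at A y z"
proof -
  have t: "-4 \<le> snd z" "snd z \<le> 0" using assms by auto
  have "height A y (snd z) \<le> height_at A y z"
    using t assms by (intro height_le_height_at) auto
  then show ?thesis
    using assms t by (auto simp: touch_def below_iff_height paraboloid_eq_iff)
qed

text \<open>
  Up to a term depending on \<open>t\<close> only, the two sides are the values at \<open>x\<close> of the highest admissible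
  paraboloids with vertices \<open>y'\<close> and \<open>y\<close>.
\<close>

definition optimal :: "real \<Rightarrow> real^'n \<Rightarrow> real \<Rightarrow> real^'n \<Rightarrow> bool" where
  "optimal A x t y \<longleftrightarrow> (\<forall>y'. height A y' t - A / 2 * (norm (x - y'))\<^sup>2 \<le> height A y t - A / 2 * (norm (x - y))\<^sup>2)"

definition umax :: real where "umax = (SUP z\<in>Q2bar. u z)"

lemma u_le_umax: "z \<in> Q2bar \<Longrightarrow> u z \<le> umax"
proof -
  have "compact (u ` Q2bar)" by (intro compact_continuous_image continuous_on_u compact_Times) auto
  then have "bdd_above (u ` Q2bar)" by (intro bounded_imp_bdd_above compact_imp_bounded)
  then show "z \<in> Q2bar \<Longrightarrow> u z \<le> umax" unfolding umax_def by (rule cSUP_upper[rotated])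
qed

definition vertex_radius :: "real \<Rightarrow> real" where "vertex_radius A = 1 + 2 * (umax + 4 * A * \<beta> + A) / A"

text \<open>
  Half a unit closer to a far vertex the height drops by an amount proportional to the distance of
  the vertex. This keeps the vertices of optimal and of touching paraboloids in a bounded set.
\<close>

lemma height_at_shifted_le:
  assumes A: "0 < A" and x: "norm x \<le> 1" and t: "-4 \<le> t" "t \<le> 0" and far: "1/2 \<le> norm (x - y)"
  obtains x' where "norm x' \<le> 2" "height_at A y (x', t) \<le> umax + 4 * A * \<beta> + A + A / 2 * (norm (x - y))\<^sup>2 - A / 2 * norm (x - y)"
proof -
  define m where "m = norm (x - y)"
  define x' where "x' = x - (1 / (2 * m)) *\<^sub>R (x - y)"
  have m: "m > 0" "1/2 \<le> m" using far by (auto simp: m_def)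
  have "norm ((1 / (2 * m)) *\<^sub>R (x - y)) = 1/2" using m by (simp add: m_def[symmetric])
  then have n: "norm x' \<le> 2"
    using norm_triangle_ineq4[of x "(1 / (2 * m)) *\<^sub>R (x - y)"] x unfolding x'_def by linarith
  have "x' - y = (1 - 1 / (2 * m)) *\<^sub>R (x - y)" by (simp add: x'_def algebra_simps)
  then have "norm (x' - y) = (1 - 1 / (2 * m)) * m" using m by (simp add: m_def[symmetric])
  moreover have "(1 - 1 / (2 * m)) * m = m - 1/2" using m by (simp add: field_simps)
  ultimately have d: "norm (x' - y) = m - 1/2" by simp
  have "u (x', t) \<le> umax" using n t by (intro u_le_umax) auto
  moreover have "- (A * \<beta> * t) \<le> 4 * A * \<beta>"
    using mult_left_mono[of "-t" 4 "A * \<beta>"] t A beta(1) by simp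
  moreover have "A / 2 * (m - 1/2)\<^sup>2 = A / 2 * m\<^sup>2 - A / 2 * m + A / 8" by (simp add: power2_eq_square algebra_simps)
  ultimately have "height_at A y (x', t) \<le> umax + 4 * A * \<beta> + A + A / 2 * (norm (x - y))\<^sup>2 - A / 2 * norm (x - y)"
    using A unfolding height_at_def fst_conv snd_conv d m_def[symmetric] by linarith
  with n show ?thesis by (rule that)
qed

lemma height_nonneg:
  assumes A: "0 < A" and t: "-4 \<le> t" "t \<le> 0"
  shows "- (A * \<beta> * t) \<le> height A y t"
proof -
  obtain z where z: "z \<in> Q2bar" "snd z \<le> t" "height A y t = height_at A y z"
    by (rule height_attained[OF t, of A y]) (rule that)
  have "A * \<beta> * snd z \<le> A * \<beta> * t" using z(2) A beta(1) by (intro mult_left_mono) auto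
  moreover have "0 \<le> A / 2 * (norm (fst z - y))\<^sup>2" using A by simp
  ultimately show ?thesis using nonneg[OF z(1)] unfolding z(3) height_at_def by linarith
qed

lemma vertex_bounded:
  assumes A: "0 < A" and x: "norm x \<le> 1" and t: "-4 \<le> t" "t \<le> 0"
    and ge: "height A x t \<le> height A y t - A / 2 * (norm (x - y))\<^sup>2"
  shows "norm (x - y) \<le> vertex_radius A"
proof (cases "1/2 \<le> norm (x - y)")
  case True
  obtain x' where x': "norm x' \<le> 2" "height_at A y (x', t) \<le> umax + 4 * A * \<beta> + A + A / 2 * (norm (x - y))\<^sup>2 - A / 2 * norm (x - y)"
    by (rule height_at_shifted_le[OF A x t True])
  have "height A y t \<le> height_at A y (x', t)"
    using t x'(1) by (intro height_le_height_at) auto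
  moreover have "0 \<le> height A x t"
    using height_nonneg[OF A t, of x] mult_nonneg_nonpos[of "A * \<beta>" t] A beta(1) t by simp
  ultimately have "A / 2 * norm (x - y) \<le> umax + 4 * A * \<beta> + A" using ge x' by linarith
  then show ?thesis using A by (simp add: vertex_radius_def field_simps)
next
  case False
  have "0 \<le> umax" using u_le_umax[of "(0,0)"] nonneg[of "(0,0)"] by simp
  then have "0 \<le> 2 * (umax + 4 * A * \<beta> + A) / A" using A beta(1) by simp
  then show ?thesis using False by (simp add: vertex_radius_def)
qed

lemma optimal_bounded:
  assumes "0 < A" "norm x \<le> 1" "-4 \<le> t" "t \<le> 0" "optimal A x t y"
  shows "norm (x - y) \<le> vertex_radius A"
  using assms by (intro vertex_bounded) (auto simp: optimal_def dest: spec[of _ x])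

lemma optimal_exists:
  assumes A: "0 < A" and x: "norm x \<le> 1" and t: "-4 \<le> t" "t \<le> 0"
  shows "\<exists>y. optimal A x t y"
proof -
  have c: "continuous_on (cball x (vertex_radius A)) (\<lambda>y. height A y t - A / 2 * (norm (x - y))\<^sup>2)"
    using t by (intro continuous_intros continuous_on_compose2[OF height_continuous, of _ "\<lambda>y. (y, t)", simplified]) auto
  have "0 \<le> umax" using u_le_umax[of "(0,0)"] nonneg[of "(0,0)"] by simp
  then have "0 \<le> vertex_radius A" using A beta(1) by (simp add: vertex_radius_def)
  then have x_in: "x \<in> cball x (vertex_radius A)" by simp
  then obtain y where y: "y \<in> cball x (vertex_radius A)"
    "\<And>y'. y' \<in> cball x (vertex_radius A) \<Longrightarrow> height A y' t - A / 2 * (norm (x - y'))\<^sup>2 \<le> height A y t - A / 2 * (norm (x - y))\<^sup>2"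
    using continuous_attains_sup[OF compact_cball _ c] by blast
  have "optimal A x t y"
    unfolding optimal_def
  proof
    fix y'
    show "height A y' t - A / 2 * (norm (x - y'))\<^sup>2 \<le> height A y t - A / 2 * (norm (x - y))\<^sup>2"
    proof (cases "y' \<in> cball x (vertex_radius A)")
      case False
      then have "\<not> height A x t \<le> height A y' t - A / 2 * (norm (x - y'))\<^sup>2"
        using vertex_bounded[OF A x t, of y'] by (auto simp: dist_norm)
      then show ?thesis using y(2)[OF x_in] by simp
    qed (use y in auto)
  qed
  then show ?thesis ..
qed

lemma touch_bounded:
  assumes A: "0 < A" and z: "norm x \<le> 1" "-4 \<le> t" "t \<le> 0" and touch: "touch A y h (x, t)"
  shows "norm (x - y) \<le> vertex_radius A"
proof (cases "1/2 \<le> norm (x - y)")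
  case True
  obtain x' where x': "norm x' \<le> 2" "height_at A y (x', t) \<le> umax + 4 * A * \<beta> + A + A / 2 * (norm (x - y))\<^sup>2 - A / 2 * norm (x - y)"
    by (rule height_at_shifted_le[OF A z True])
  have "height A y t \<le> height_at A y (x', t)"
    using z x'(1) by (intro height_le_height_at) auto
  moreover have "height A y t = height_at A y (x, t)" using touch touch_iff_height[of "(x, t)"] z by auto
  moreover have "A / 2 * (norm (x - y))\<^sup>2 \<le> height_at A y (x, t)"
  proof -
    have "0 \<le> u (x, t)" using z by (intro nonneg) auto
    moreover have "A * \<beta> * t \<le> 0" using A beta(1) z by (intro mult_nonneg_nonpos) auto
    ultimately show ?thesis by (simp add: height_at_def)
  qed
  ultimately have "A / 2 * norm (x - y) \<le> umax + 4 * A * \<beta> + A" using x' by linarith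
  then show ?thesis using A by (simp add: vertex_radius_def field_simps)
next
  case False
  have "0 \<le> umax" using u_le_umax[of "(0,0)"] nonneg[of "(0,0)"] by simp
  then have "0 \<le> 2 * (umax + 4 * A * \<beta> + A) / A" using A beta(1) by simp
  then show ?thesis using False by (simp add: vertex_radius_def)
qed

text \<open>
  Contact means that \<open>height_at\<close> attains \<open>height\<close>, a closed condition on \<open>(z, y)\<close>, and the vertices
  that occur are bounded.
\<close>

lemma compact_contact:
  assumes A: "0 < A"
  shows "compact (contact A \<inter> (cball 0 1 \<times> {-1..0}))"
proof -
  let ?B = "(cball 0 1 \<times> {-1..0}) \<times> cball 0 (1 + vertex_radius A) :: (((real^'n) \<times> real) \<times> (real^'n)) set"
  let ?f = "\<lambda>(z, y). height_at A y z - height A y (snd z)"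
  have "continuous_on ?B (\<lambda>p. height_at A (snd p) (fst p))"
    unfolding height_at_def by (intro continuous_intros continuous_on_compose2[OF continuous_on_u]) auto
  moreover have "continuous_on ?B (\<lambda>p. height A (snd p) (snd (fst p)))"
  proof -
    have c: "continuous_on ?B (\<lambda>p. (snd p, snd (fst p)))" by (intro continuous_intros)
    have "(\<lambda>p. (snd p, snd (fst p))) ` ?B \<subseteq> UNIV \<times> {-4..0}" by auto
    from continuous_on_compose2[OF height_continuous c this, of A] show ?thesis by simp
  qed
  ultimately have "continuous_on ?B (\<lambda>p. height_at A (snd p) (fst p) - height A (snd p) (snd (fst p)))"
    by (rule continuous_on_diff)
  then have "continuous_on ?B ?f" by (simp add: case_prod_unfold)
  moreover have cB: "compact ?B" by (intro compact_Times) auto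
  ultimately have "closed (?B \<inter> ?f -` {0})" by (intro continuous_closed_preimage compact_imp_closed) auto
  then have "compact (?B \<inter> (?B \<inter> ?f -` {0}))" by (intro compact_Int_closed cB)
  then have "compact (?B \<inter> ?f -` {0})" by (simp only: Int_left_absorb)
  then have "compact (fst ` (?B \<inter> ?f -` {0}))" by (rule compact_continuous_image[rotated]) (intro continuous_intros)
  moreover have "contact A \<inter> (cball 0 1 \<times> {-1..0}) = fst ` (?B \<inter> ?f -` {0})"
  proof (intro equalityI subsetI)
    fix z assume z: "z \<in> contact A \<inter> (cball 0 1 \<times> {-1..0})"
    then obtain y h where t: "touch A y h z" by (auto simp: contact_def)
    have zQ: "z \<in> Q2bar" using z by auto
    have "norm (fst z - y) \<le> vertex_radius A" using touch_bounded[OF A, of "fst z" "snd z" y h] z t by auto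
    then have "norm y \<le> 1 + vertex_radius A" using z norm_triangle_ineq4[of "fst z" "fst z - y"] by auto
    then have "(z, y) \<in> ?B \<inter> ?f -` {0}" using z touch_iff_height[OF zQ] t by auto
    then show "z \<in> fst ` (?B \<inter> ?f -` {0})" by force
  next
    fix z assume "z \<in> fst ` (?B \<inter> ?f -` {0})"
    then obtain y where y: "z \<in> cball 0 1 \<times> {-1..0}" "height_at A y z = height A y (snd z)" by auto
    moreover have "z \<in> Q2bar" using y(1) by auto
    ultimately show "z \<in> contact A \<inter> (cball 0 1 \<times> {-1..0})"
      using touch_iff_height[of z A y "height_at A y z"] by (auto simp: contact_def)
  qed
  ultimately show ?thesis by simp
qed

section \<open>Doubling the opening\<close>

definition mid_vertex :: "real^'n \<Rightarrow> real^'n \<Rightarrow> real^'n" where "mid_vertex x y = (1/2) *\<^sub>R (x + y)"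

definition doubled_height :: "real \<Rightarrow> real^'n \<Rightarrow> real \<Rightarrow> real^'n \<Rightarrow> real \<Rightarrow> real" where
  "doubled_height A x t y h = h - A * \<beta> * t - A / 4 * (norm (x - y))\<^sup>2"

lemma paraboloid_double:
  "paraboloid (2 * A) (mid_vertex x y) (doubled_height A x t y h) z
    = paraboloid A y h z + A * \<beta> * (snd z - t) - A / 2 * (norm (fst z - x))\<^sup>2"
  unfolding paraboloid_def mid_vertex_def doubled_height_def power2_norm_eq_inner
  by (simp add: inner_simps inner_commute algebra_simps)

lemma paraboloid_shift:
  "paraboloid A y h (x', t') = paraboloid A y h (x, t) + A * ((y - x) \<bullet> (x' - x))
     - A / 2 * (norm (x' - x))\<^sup>2 + A * \<beta> * (t' - t)"
  unfolding paraboloid_def power2_norm_eq_inner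
  by (simp add: inner_simps inner_commute algebra_simps)

lemma touch_double:
  assumes A: "0 < A" and touch: "touch A y h (x, t)"
  shows "touch (2 * A) (mid_vertex x y) (doubled_height A x t y h) (x, t)"
  unfolding touch_def below_def
proof (intro conjI ballI impI)
  show "(x, t) \<in> Q2bar" "u (x, t) = paraboloid (2 * A) (mid_vertex x y) (doubled_height A x t y h) (x, t)"
    using touch by (auto simp: touch_def paraboloid_double)
  fix z :: "(real^'n) \<times> real" assume z: "z \<in> Q2bar" "snd z \<le> snd (x, t)"
  then have "paraboloid A y h z \<le> u z" using touch by (auto simp: touch_def below_def)
  moreover have "A * \<beta> * (snd z - t) \<le> 0" "0 \<le> A / 2 * (norm (fst z - x))\<^sup>2"
    using A z beta(1) by (auto intro!: mult_nonneg_nonpos)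
  ultimately show "paraboloid (2 * A) (mid_vertex x y) (doubled_height A x t y h) z \<le> u z"
    unfolding paraboloid_double by linarith
qed

lemma contact_mono: "0 < A \<Longrightarrow> contact A \<subseteq> contact (2 * A)"
  unfolding contact_def using touch_double by fast

text \<open>
  At a common contact point \<open>kink_bound\<close> holds for every small \<open>r\<close>. In effect \<open>u\<close> has a well-defined
  spatial gradient at contact points.
\<close>

lemma touch_vertex_unique:
  assumes A: "0 < A" and t1: "touch A y1 h1 (x, t)" and t2: "touch A y2 h2 (x, t)"
    and x: "norm x \<le> 1" "-1 \<le> t" "t \<le> 0"
  shows "y1 = y2"
proof (rule ccontr)
  assume "y1 \<noteq> y2"
  define d where "d = norm (y1 - y2)"
  have d: "d > 0" using \<open>y1 \<noteq> y2\<close> by (simp add: d_def)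
  define m where "m = \<beta> / lam"
  have m: "m > 0" using beta lam by (simp add: m_def)
  define r where "r = min (1 / (4 * d)) (d / (48 * m))"
  have r: "0 < r" "d * r < 1/2" "24 * m * r < d"
  proof -
    show "0 < r" using d m by (simp add: r_def)
    have "d * r \<le> d * (1 / (4 * d))" using d by (intro mult_left_mono) (auto simp: r_def)
    then show "d * r < 1/2" using d by simp
    have "24 * m * r \<le> 24 * m * (d / (48 * m))" using m by (intro mult_left_mono) (auto simp: r_def)
    then show "24 * m * r < d" using m d by simp
  qed
  have "d \<le> 24 * m * r"
    unfolding d_def m_def
  proof (rule kink_bound[OF A t1 _ x])
    show "below A y2 h2 t" "0 < r" "norm (y1 - y2) * r < 1 / 2"
      using t2 r by (auto simp: touch_def d_def)
    show "paraboloid A y1 h1 (x, t) - paraboloid A y2 h2 (x, t) \<le> A * norm (y1 - y2) * r"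
      using t1 t2 A r(1) by (simp add: touch_def)
  qed
  then show False using r(3) by simp
qed

text \<open>
  A paraboloid of opening \<open>A\<close> touching at \<open>(x', t')\<close>, when doubled there, would coincide with the given
  paraboloid of opening \<open>2 A\<close>. Undoing the doubling at \<open>(x', t')\<close> and at \<open>(x, t)\<close>, it exceeds the
  optimal one at \<open>(x, t)\<close> by \<open>A \<beta> (t' - t) + A/2 |x - x'|\<^sup>2\<close>, so optimality forces
  the two points to agree.
\<close>

lemma doubled_contact_new:
  assumes A: "0 < A" and optimal: "optimal A x t y" and t: "-4 \<le> t" "t \<le> t'" "t' \<le> 0" "-1 \<le> t'"
    and new: "(x, t) \<notin> contact A" and x': "norm x' \<le> 1"
    and touch: "touch (2 * A) (mid_vertex x y) (doubled_height A x t y (height A y t)) (x', t')"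
  shows "(x', t') \<notin> contact A"
proof
  assume "(x', t') \<in> contact A"
  then obtain y' h' where t': "touch A y' h' (x', t')" by (auto simp: contact_def)
  let ?h = "height A y t"
  have "mid_vertex x y = mid_vertex x' y'"
    using touch touch_double[OF A t'] A x' t by (intro touch_vertex_unique[of "2 * A"]) auto
  then have y': "mid_vertex x' y' = mid_vertex x y" ..
  have Ph: "doubled_height A x' t' y' h' = doubled_height A x t y ?h"
  proof -
    have "paraboloid (2 * A) (mid_vertex x y) (doubled_height A x' t' y' h') (x', t') = paraboloid (2 * A) (mid_vertex x y) (doubled_height A x t y ?h) (x', t')"
      using touch touch_double[OF A t'] unfolding y' touch_def by simp
    then show ?thesis by (simp add: paraboloid_def)
  qed
  have eq: "paraboloid A y' h' z + A * \<beta> * (snd z - t') - A / 2 * (norm (fst z - x'))\<^sup>2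
     = paraboloid A y ?h z + A * \<beta> * (snd z - t) - A / 2 * (norm (fst z - x))\<^sup>2" for z
    using paraboloid_double[of A x' y' t' h' z] paraboloid_double[of A x y t ?h z] unfolding y' Ph by simp
  have "below A y' h' t" using t' t by (auto simp: touch_def below_def)
  then have "h' \<le> height A y' t" using t by (simp add: below_iff_height)
  moreover have "height A y' t - A / 2 * (norm (x - y'))\<^sup>2 \<le> ?h - A / 2 * (norm (x - y))\<^sup>2"
    using optimal by (simp add: optimal_def)
  ultimately have "paraboloid A y' h' (x, t) \<le> paraboloid A y ?h (x, t)" by (simp add: paraboloid_def)
  with eq[of "(x, t)"] have "A * \<beta> * (t' - t) + A / 2 * (norm (x - x'))\<^sup>2 \<le> 0"
    by (simp add: algebra_simps)
  moreover have "0 \<le> A * \<beta> * (t' - t)" "0 \<le> A / 2 * (norm (x - x'))\<^sup>2" using A beta(1) t by auto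
  ultimately have "A * \<beta> * (t' - t) = 0" "A / 2 * (norm (x - x'))\<^sup>2 = 0" by linarith+
  then have "t' = t" "x' = x" using A beta(1) by auto
  then show False using new \<open>(x', t') \<in> contact A\<close> by simp
qed

text \<open>
  Adding the optimality of each vertex tested against the other gives \<open>(x1 - x2) \<bullet> (y1 - y2) \<ge> 0\<close>.
\<close>

lemma optimal_expansive:
  assumes "0 < A" "optimal A x1 t y1" "optimal A x2 t y2"
  shows "norm (x1 - x2) \<le> 2 * norm (mid_vertex x1 y1 - mid_vertex x2 y2)"
proof -
  have "height A y2 t - A / 2 * (norm (x1 - y2))\<^sup>2 \<le> height A y1 t - A / 2 * (norm (x1 - y1))\<^sup>2"
    "height A y1 t - A / 2 * (norm (x2 - y1))\<^sup>2 \<le> height A y2 t - A / 2 * (norm (x2 - y2))\<^sup>2"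
    using assms by (auto simp: optimal_def)
  then have "A / 2 * ((norm (x1 - y1))\<^sup>2 + (norm (x2 - y2))\<^sup>2) \<le> A / 2 * ((norm (x1 - y2))\<^sup>2 + (norm (x2 - y1))\<^sup>2)"
    by (simp add: distrib_left)
  then have "(norm (x1 - y1))\<^sup>2 + (norm (x2 - y2))\<^sup>2 \<le> (norm (x1 - y2))\<^sup>2 + (norm (x2 - y1))\<^sup>2"
    using assms(1) by simp
  then have mono: "0 \<le> (x1 - x2) \<bullet> (y1 - y2)"
    unfolding power2_norm_eq_inner by (simp add: inner_simps inner_commute algebra_simps)
  have "(norm (x1 - x2))\<^sup>2 \<le> (norm ((x1 - x2) + (y1 - y2)))\<^sup>2"
  proof -
    have "2 * ((x1 - x2) \<bullet> (y1 - y2)) = (norm ((x1 - x2) + (y1 - y2)))\<^sup>2 - (norm (x1 - x2))\<^sup>2 - (norm (y1 - y2))\<^sup>2"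
      by (simp add: dot_norm)
    then show ?thesis using mono zero_le_power2[of "norm (y1 - y2)"] by linarith
  qed
  then have "norm (x1 - x2) \<le> norm ((x1 - x2) + (y1 - y2))" by (rule power2_le_imp_le) simp
  also have "(x1 - x2) + (y1 - y2) = 2 *\<^sub>R (mid_vertex x1 y1 - mid_vertex x2 y2)"
    by (simp add: mid_vertex_def algebra_simps)
  finally show ?thesis by simp
qed

text \<open>
  The height decreases in time, and the term \<open>- A \<beta> t\<close> in the height of the doubled paraboloid
  makes the decrease strict. The remaining quadratic terms combine to a square because the vertices agree.
\<close>

lemma optimal_time_monotone:
  assumes A: "0 < A" and o: "optimal A x1 t1 y1" and Y: "mid_vertex x1 y1 = mid_vertex x2 y2"
    and t: "-4 \<le> t1" "t1 < t2" "t2 \<le> 0"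
  shows "A * \<beta> * (t2 - t1) \<le> doubled_height A x1 t1 y1 (height A y1 t1) - doubled_height A x2 t2 y2 (height A y2 t2)"
proof -
  have 1: "height A y2 t2 - A / 2 * (norm (x1 - y2))\<^sup>2 \<le> height A y1 t1 - A / 2 * (norm (x1 - y1))\<^sup>2"
  proof -
    have "height A y2 t2 \<le> height A y2 t1" using t by (intro height_antimono) auto
    moreover have "height A y2 t1 - A / 2 * (norm (x1 - y2))\<^sup>2 \<le> height A y1 t1 - A / 2 * (norm (x1 - y1))\<^sup>2"
      using o by (simp add: optimal_def)
    ultimately show ?thesis by linarith
  qed
  define p q where "p = x1 - mid_vertex x1 y1" and "q = x2 - mid_vertex x1 y1"
  have "x1 - y1 = 2 *\<^sub>R p" "x2 - y2 = 2 *\<^sub>R q" "x1 - y2 = p + q"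
  proof -
    show "x1 - y1 = 2 *\<^sub>R p"
      by (simp add: p_def mid_vertex_def scaleR_diff_right scaleR_add_right scaleR_2)
    show "x2 - y2 = 2 *\<^sub>R q"
      unfolding q_def Y by (simp add: mid_vertex_def scaleR_diff_right scaleR_add_right scaleR_2)
    have "x1 - y2 - (p + q) = 2 *\<^sub>R mid_vertex x1 y1 - x2 - y2" by (simp add: p_def q_def scaleR_2)
    also have "\<dots> = 0" unfolding Y by (simp add: mid_vertex_def)
    finally show "x1 - y2 = p + q" by simp
  qed
  then have 2: "(norm (x1 - y1))\<^sup>2 = 4 * (norm p)\<^sup>2" "(norm (x2 - y2))\<^sup>2 = 4 * (norm q)\<^sup>2"
    "(norm (x1 - y2))\<^sup>2 = 2 * (norm p)\<^sup>2 + 2 * (norm q)\<^sup>2 - (norm (p - q))\<^sup>2"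
    by (simp_all add: power2_norm_eq_inner inner_simps inner_commute)
  have "0 \<le> A / 2 * (norm (p - q))\<^sup>2" using A by simp
  then show ?thesis using 1 unfolding doubled_height_def 2 by (simp add: algebra_simps)
qed

end

section \<open>Locating the new contact points\<close>

lemma B1_eq: "B1 = {z :: (real^'n) \<times> real. -1 < snd z \<and> snd z < - (norm (fst z))\<^sup>2}"
proof (intro equalityI subsetI)
  fix z :: "(real^'n) \<times> real" assume z: "z \<in> {z. -1 < snd z \<and> snd z < - (norm (fst z))\<^sup>2}"
  then have "(norm (fst z))\<^sup>2 < 1\<^sup>2" by simp
  then have "norm (fst z) < 1" by (rule power_less_imp_less_base) simp
  moreover have "snd z \<le> 0" using z zero_le_power2[of "norm (fst z)"] unfolding mem_Collect_eq by linarith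
  ultimately show "z \<in> B1"
    using z by (cases z) (auto simp: B1_def backward_paraboloid_def parabolic_cylinder_def)
qed (auto simp: B1_def backward_paraboloid_def parabolic_cylinder_def)

lemma B1_subset: "B1 \<subseteq> (cball 0 1 \<times> {-1..0} :: ((real^'n) \<times> real) set)"
  by (auto simp: B1_def backward_paraboloid_def parabolic_cylinder_def)

lemma open_B1: "open (B1 :: ((real^'n) \<times> real) set)"
  unfolding B1_eq by (intro open_Collect_conj open_Collect_less continuous_intros)

lemma B1_lmeasurable: "(B1 :: ((real^'n) \<times> real) set) \<in> lmeasurable"
  by (intro lmeasurable_open open_B1 bounded_subset[OF _ B1_subset] bounded_Times) auto

context nonneg_supersolution
begin

lemma low_point_in_ball:
  assumes "norm x1 \<le> 1" "-1 \<le> t1" "t1 < 0" "(norm x1)\<^sup>2 \<le> - t1"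
    and "0 < \<kappa>" "\<kappa> \<le> 1/4" "\<kappa>\<^sup>2 \<le> - t1" "0 < \<mu>" "u (0, 0) < spread_const * \<kappa> powr (2 * spread_exp) * \<mu>"
  obtains x where "norm (x - x1) \<le> \<kappa>" "u (x, t1) < \<mu>"
proof -
  have "\<exists>x\<in>cball x1 \<kappa>. u (x, t1) < \<mu>"
  proof (rule ccontr)
    assume "\<not> (\<exists>x\<in>cball x1 \<kappa>. u (x, t1) < \<mu>)"
    then have "spread_const * \<kappa> powr (2 * spread_exp) * \<mu> \<le> u (0, 0)"
      by (intro spread_lower_bound[OF assms(1-8)]) (simp add: not_less)
    then show False using assms(9) by simp
  qed
  then show ?thesis using that by (auto simp: dist_norm norm_minus_commute)
qed

text \<open>
  Low points near \<open>(x, s)\<close> on the side to which \<open>v\<close> points. With \<open>v\<close> the direction of the gradient of a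
  paraboloid, the paraboloid does not decrease to first order from \<open>x\<close> to \<open>w\<close>.
\<close>

lemma low_point_ahead:
  assumes A: "0 < A" and \<delta>: "0 < \<delta>" and t: "-1 < t" "t + \<delta>\<^sup>2 < - (norm x + 4 * \<beta> * \<delta>)\<^sup>2"
    and small: "u (0, 0) < spread_const * (\<delta> / 8) powr (2 * spread_exp) * (A * \<delta>\<^sup>2 / 8)"
    and s: "s = t \<or> s = t + \<delta>\<^sup>2"
  obtains w where "norm (w - x) \<le> 5 / 8 * \<delta>" "norm v * (3 / 8 * \<delta>) \<le> v \<bullet> (w - x)"
    "(w, s) \<in> Q2bar" "u (w, s) < A * \<delta>\<^sup>2 / 8"
proof -
  have b\<delta>: "\<delta> \<le> \<beta> * \<delta>" using mult_right_mono[of 1 \<beta> \<delta>] beta(1) \<delta> by simp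
  have sq: "0 \<le> (norm x + 4 * \<beta> * \<delta>)\<^sup>2" "0 < \<delta>\<^sup>2" using \<delta> by auto
  have "(norm x + 4 * \<beta> * \<delta>)\<^sup>2 < 1\<^sup>2" using t sq unfolding power_one by linarith
  then have le1: "norm x + 4 * \<beta> * \<delta> < 1" by (rule power_less_imp_less_base) simp
  have \<delta>1: "\<delta> < 1/4" "norm x < 1" using le1 b\<delta> norm_ge_zero[of x] \<delta> by linarith+
  have t0: "t < 0" "t + \<delta>\<^sup>2 < 0" using t sq by linarith+
  define e where "e = (1 / norm v) *\<^sub>R v"
  define x1 where "x1 = x + (\<delta> / 2) *\<^sub>R e"
  have e: "norm e \<le> 1" "v \<bullet> e = norm v"
    by (cases "v = 0"; simp add: e_def power2_norm_eq_inner[symmetric] power2_eq_square)+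
  have e\<delta>: "norm ((\<delta> / 2) *\<^sub>R e) \<le> \<delta> / 2" using e(1) \<delta> by simp
  then have "norm x1 \<le> norm x + \<delta> / 2" unfolding x1_def by (rule norm_triangle_le[OF add_left_mono])
  then have x1: "norm x1 \<le> norm x + 4 * \<beta> * \<delta>" using b\<delta> \<delta> by linarith
  then have x1s: "(norm x1)\<^sup>2 \<le> (norm x + 4 * \<beta> * \<delta>)\<^sup>2" by (intro power_mono) auto
  have "(\<delta> / 8)\<^sup>2 \<le> (norm x + 4 * \<beta> * \<delta>)\<^sup>2"
    using b\<delta> \<delta> norm_ge_zero[of x] by (intro power_mono) linarith+
  then have "\<exists>w. norm (w - x1) \<le> \<delta> / 8 \<and> u (w, s) < A * \<delta>\<^sup>2 / 8"
    using low_point_in_ball[of x1 s "\<delta> / 8" "A * \<delta>\<^sup>2 / 8"] x1 x1s le1 t t0 s sq \<delta> \<delta>1 A small by fastforce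
  then obtain w where w: "norm (w - x1) \<le> \<delta> / 8" "u (w, s) < A * \<delta>\<^sup>2 / 8" by blast
  have eq: "w - x = (\<delta> / 2) *\<^sub>R e + (w - x1)" by (simp add: x1_def)
  have "norm (w - x) \<le> norm ((\<delta> / 2) *\<^sub>R e) + norm (w - x1)" unfolding eq by (rule norm_triangle_ineq)
  then have 1: "norm (w - x) \<le> 5 / 8 * \<delta>" using e\<delta> w(1) by simp
  have "\<bar>v \<bullet> (w - x1)\<bar> \<le> norm v * (\<delta> / 8)"
    using w(1) by (intro order_trans[OF Cauchy_Schwarz_ineq2] mult_left_mono) auto
  moreover have "v \<bullet> (w - x) = \<delta> / 2 * norm v + v \<bullet> (w - x1)"
    unfolding eq by (simp add: inner_add_right e(2))
  moreover have "norm v * (3 / 8 * \<delta>) = \<delta> / 2 * norm v - norm v * (\<delta> / 8)" by simp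
  ultimately have 2: "norm v * (3 / 8 * \<delta>) \<le> v \<bullet> (w - x)" by linarith
  have "norm w \<le> norm x1 + norm (w - x1)" by (metis norm_triangle_sub)
  then have "norm w \<le> 2" using w(1) x1 le1 \<delta>1 by linarith
  moreover have "-4 \<le> s" "s \<le> 0" using s t(1) t0 sq(2) by (elim disjE; linarith)+
  ultimately show ?thesis using that[OF 1 2] w(2) by simp
qed

text \<open>
  Low points at time \<open>t\<close> show that the optimal paraboloid has value of order \<open>A \<delta>\<^sup>2\<close> and slope at most
  \<open>A \<delta>\<close> at \<open>x\<close>. Low points at time \<open>t + \<delta>\<^sup>2\<close> force contact by then. The doubled paraboloid
  is negative up to that time outside the ball of radius \<open>4 \<beta> \<delta>\<close>, whereas \<open>u\<close> is nonnegative.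
\<close>

lemma contact_near:
  assumes A: "0 < A" and \<delta>: "0 < \<delta>" and t: "-1 < t" "t + \<delta>\<^sup>2 < - (norm x + 4 * \<beta> * \<delta>)\<^sup>2"
    and optimal: "optimal A x t y"
    and small: "u (0, 0) < spread_const * (\<delta> / 8) powr (2 * spread_exp) * (A * \<delta>\<^sup>2 / 8)"
  obtains x' t' where "touch (2 * A) (mid_vertex x y) (doubled_height A x t y (height A y t)) (x', t')"
    "t \<le> t'" "t' \<le> t + \<delta>\<^sup>2" "norm (x' - x) \<le> 4 * \<beta> * \<delta>"
proof -
  have b\<delta>: "\<delta> \<le> \<beta> * \<delta>" using mult_right_mono[of 1 \<beta> \<delta>] beta(1) \<delta> by simp
  have sq: "0 \<le> (norm x + 4 * \<beta> * \<delta>)\<^sup>2" "0 < \<delta>\<^sup>2" using \<delta> by auto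
  have t0: "t < 0" "t + \<delta>\<^sup>2 < 0" using t sq by linarith+
  define N where "N = norm (y - x)"
  have N0: "0 \<le> N" by (simp add: N_def)
  let ?P = "paraboloid A y (height A y t)"
  let ?P2 = "paraboloid (2 * A) (mid_vertex x y) (doubled_height A x t y (height A y t))"
  have P_le: "?P z \<le> u z" if "z \<in> Q2bar" "snd z \<le> t" for z
    using below_iff_height[of t A y "height A y t"] t t0 that by (auto simp: below_def)
  define p0 where "p0 = ?P (x, t)"
  have p0: "0 \<le> p0"
  proof -
    have "height A x t \<le> height A y t - A / 2 * (norm (x - y))\<^sup>2" using optimal by (auto simp: optimal_def dest: spec[of _ x])
    then show ?thesis using height_nonneg[OF A, of t x] t t0 by (simp add: p0_def paraboloid_def)
  qed
  have sqs: "A / 2 * (norm (w - x))\<^sup>2 \<le> A / 2 * (25 / 64 * \<delta>\<^sup>2)" if "norm (w - x) \<le> 5 / 8 * \<delta>" for w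
    using power_mono[OF that, of 2] A by (simp add: power_mult_distrib power_divide)
  have inner_ge: "A * (N * (3 / 8 * \<delta>)) \<le> A * ((y - x) \<bullet> (w - x))"
    if "N * (3 / 8 * \<delta>) \<le> (y - x) \<bullet> (w - x)" for w
    using that A by simp
  \<comment> \<open>At time \<open>t\<close> the optimal paraboloid lies below a low point in the direction of its own gradient;
    this bounds its value at \<open>x\<close> and its slope there.\<close>
  obtain w1 where w1: "norm (w1 - x) \<le> 5 / 8 * \<delta>" "N * (3 / 8 * \<delta>) \<le> (y - x) \<bullet> (w1 - x)"
    "(w1, t) \<in> Q2bar" "u (w1, t) < A * \<delta>\<^sup>2 / 8"
    unfolding N_def by (rule low_point_ahead[OF A \<delta> t small, of t "y - x"]) auto
  have "p0 + A * ((y - x) \<bullet> (w1 - x)) - A / 2 * (norm (w1 - x))\<^sup>2 \<le> u (w1, t)"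
    using P_le[OF w1(3)] paraboloid_shift[of A y "height A y t" w1 t x t] by (simp add: p0_def)
  then have "p0 + A * (N * (3 / 8 * \<delta>)) \<le> A * \<delta>\<^sup>2 / 8 + A / 2 * (25 / 64 * \<delta>\<^sup>2)"
    using w1(4) sqs[OF w1(1)] inner_ge[OF w1(2)] by linarith
  also have "\<dots> \<le> A * (3 / 8 * \<delta>\<^sup>2)" using A sq by simp
  finally have s1: "p0 + A * (N * (3 / 8 * \<delta>)) \<le> A * (3 / 8 * \<delta>\<^sup>2)" .
  have AN: "0 \<le> A * (N * (3 / 8 * \<delta>))" using A N0 \<delta> by simp
  have p0_le: "p0 \<le> A * (3 / 8 * \<delta>\<^sup>2)" using s1 AN by linarith
  have "(A * (3 / 8 * \<delta>)) * N \<le> (A * (3 / 8 * \<delta>)) * \<delta>"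
    using s1 p0 by (simp add: power2_eq_square algebra_simps)
  then have N\<delta>: "N \<le> \<delta>" using A \<delta> by simp
  \<comment> \<open>By time \<open>t + \<delta>\<^sup>2\<close> the doubled paraboloid has risen above a low point, so it has met \<open>u\<close> before.\<close>
  obtain w2 where w2: "norm (w2 - x) \<le> 5 / 8 * \<delta>" "N * (3 / 8 * \<delta>) \<le> (y - x) \<bullet> (w2 - x)"
    "(w2, t + \<delta>\<^sup>2) \<in> Q2bar" "u (w2, t + \<delta>\<^sup>2) < A * \<delta>\<^sup>2 / 8"
    unfolding N_def by (rule low_point_ahead[OF A \<delta> t small, of "t + \<delta>\<^sup>2" "y - x"]) auto
  have P2: "?P2 (x', t') = p0 + A * ((y - x) \<bullet> (x' - x)) - A * (norm (x' - x))\<^sup>2 + 2 * A * \<beta> * (t' - t)" for x' t'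
    unfolding paraboloid_double paraboloid_shift[of A y "height A y t" x' t' x t] p0_def by (simp add: algebra_simps)
  have "A * \<delta>\<^sup>2 / 8 \<le> ?P2 (w2, t + \<delta>\<^sup>2)"
  proof -
    have "0 \<le> A * ((y - x) \<bullet> (w2 - x))" using inner_ge[OF w2(2)] AN by linarith
    moreover have "A * \<delta>\<^sup>2 * 1 \<le> A * \<delta>\<^sup>2 * \<beta>" using A beta(1) by (intro mult_left_mono) auto
    moreover have "A * (norm (w2 - x))\<^sup>2 \<le> A * \<delta>\<^sup>2 * (25 / 64)" using sqs[OF w2(1)] by simp
    moreover have "0 \<le> A * \<delta>\<^sup>2" using A by simp
    ultimately show ?thesis unfolding P2 using p0 by (simp add: mult.commute mult.left_commute)
  qed
  then have cross: "u (w2, t + \<delta>\<^sup>2) \<le> ?P2 (w2, t + \<delta>\<^sup>2)" using w2(4) by linarith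
  let ?M = "{z \<in> cball 0 2 \<times> {t..0}. u z - ?P2 z \<le> 0}"
  have Pc: "continuous_on UNIV ?P2" unfolding paraboloid_def by (intro continuous_intros)
  have sub: "cball 0 2 \<times> {t..0} \<subseteq> (Q2bar :: ((real^'n) \<times> real) set)" using t by auto
  have fc: "continuous_on (cball 0 2 \<times> {t..0}) (\<lambda>z. u z - ?P2 z)"
    by (intro continuous_on_diff continuous_on_subset[OF continuous_on_u sub] continuous_on_subset[OF Pc]) auto
  have "closed ?M" by (intro continuous_on_closed_Collect_le fc continuous_on_const closed_Times) auto
  moreover have "bounded ?M" by (rule bounded_subset[of "cball 0 2 \<times> {t..0}"]) (auto intro!: bounded_Times)
  ultimately have "compact ?M" by (simp add: compact_eq_bounded_closed)
  moreover have "(w2, t + \<delta>\<^sup>2) \<in> ?M" using cross w2(3) t0 sq by auto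
  ultimately obtain z' where z': "z' \<in> ?M" "\<And>z. z \<in> ?M \<Longrightarrow> snd z' \<le> snd z"
    using continuous_attains_inf[of ?M snd] continuous_on_snd[OF continuous_on_id] by blast
  obtain x' t' where z'_eq: "z' = (x', t')" by fastforce
  have t': "t \<le> t'" "t' \<le> t + \<delta>\<^sup>2" "(x', t') \<in> Q2bar" "u (x', t') \<le> ?P2 (x', t')"
    using z'(1) z'(2)[OF \<open>(w2, t + \<delta>\<^sup>2) \<in> ?M\<close>] sub t(1) by (auto simp: z'_eq)
  have early: "?P2 z \<le> u z" if z: "z \<in> Q2bar" "snd z \<le> t" for z
  proof -
    have "A * \<beta> * (snd z - t) \<le> 0" "0 \<le> A / 2 * (norm (fst z - x))\<^sup>2"
      using A beta(1) z by (auto intro!: mult_nonneg_nonpos)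
    then show ?thesis using P_le[OF z] unfolding paraboloid_double by linarith
  qed
  have bel: "below (2 * A) (mid_vertex x y) (doubled_height A x t y (height A y t)) t'"
    unfolding below_def
  proof (intro ballI impI)
    fix z :: "(real^'n) \<times> real" assume z: "z \<in> Q2bar" "snd z \<le> t'"
    have before: "?P2 (fst z, s) \<le> u (fst z, s)" if "t \<le> s" "s < t'" for s
    proof (rule ccontr)
      assume "\<not> ?P2 (fst z, s) \<le> u (fst z, s)"
      then have "(fst z, s) \<in> ?M" using that z t' by auto
      from z'(2)[OF this] show False using that by (simp add: z'_eq)
    qed
    consider "snd z \<le> t" | "t < snd z" "snd z < t'" | "t < t'" "snd z = t'" using z by linarith
    then show "?P2 z \<le> u z"
    proof cases
      case 1
      then show ?thesis using early z by blast
    next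
      case 2
      then show ?thesis using before[of "snd z"] by simp
    next
      case 3
      have cl: "closure {t..<t'} = {t..t'}" using 3 by simp
      have "continuous_on {t..t'} (\<lambda>s. u (fst z, s) - ?P2 (fst z, s))"
        by (rule continuous_on_compose2[OF fc]) (use z t' in \<open>auto intro!: continuous_intros\<close>)
      then have "0 \<le> u (fst z, t') - ?P2 (fst z, t')"
        using 3 before by (intro continuous_ge_on_closure[of "{t..<t'}" "\<lambda>s. u (fst z, s) - ?P2 (fst z, s)" t' 0]) (auto simp: cl)
      then show ?thesis using 3 by (metis diff_ge_0_iff_ge prod.collapse)
    qed
  qed
  then have "touch (2 * A) (mid_vertex x y) (doubled_height A x t y (height A y t)) (x', t')"
    using t'(3,4) unfolding touch_def below_def by force
  moreover have "norm (x' - x) \<le> 4 * \<beta> * \<delta>"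
  proof (rule ccontr)
    define Z where "Z = norm (x' - x)"
    assume "\<not> norm (x' - x) \<le> 4 * \<beta> * \<delta>"
    then have Z: "4 * (\<beta> * \<delta>) < Z" by (simp add: Z_def)
    have "(y - x) \<bullet> (x' - x) \<le> N * Z" unfolding N_def Z_def by (rule norm_cauchy_schwarz)
    also have "\<dots> \<le> \<delta> * Z" using N\<delta> by (intro mult_right_mono) (auto simp: Z_def)
    finally have "A * ((y - x) \<bullet> (x' - x)) \<le> A * (\<delta> * Z)" using A by simp
    moreover have "2 * A * \<beta> * (t' - t) \<le> 2 * A * \<beta> * \<delta>\<^sup>2" using t' A beta(1) by (intro mult_left_mono) auto
    moreover have "0 \<le> u (x', t')" using nonneg t'(3) by blast
    ultimately have "A * Z\<^sup>2 \<le> A * (3 / 8 * \<delta>\<^sup>2) + A * (\<delta> * Z) + 2 * A * \<beta> * \<delta>\<^sup>2"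
      using t'(4) p0_le unfolding P2 Z_def[symmetric] by linarith
    then have "A * Z\<^sup>2 \<le> A * (3 / 8 * \<delta>\<^sup>2 + \<delta> * Z + 2 * \<beta> * \<delta>\<^sup>2)" by (simp add: algebra_simps)
    then have "Z\<^sup>2 \<le> 3 / 8 * \<delta>\<^sup>2 + \<delta> * Z + 2 * \<beta> * \<delta>\<^sup>2" using A by (simp only: mult_le_cancel_left_pos)
    then have 1: "Z * (Z - \<delta>) \<le> (3 / 8 + 2 * \<beta>) * \<delta>\<^sup>2" by (simp add: power2_eq_square algebra_simps)
    have "(4 * (\<beta> * \<delta>)) * (3 * \<delta>) \<le> Z * (Z - \<delta>)"
      using Z b\<delta> \<delta> by (intro mult_mono) linarith+
    then have "12 * \<beta> * \<delta>\<^sup>2 \<le> (3 / 8 + 2 * \<beta>) * \<delta>\<^sup>2" using 1 by (simp add: power2_eq_square)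
    then show False using sq beta(1) by simp
  qed
  ultimately show ?thesis using t' that by blast
qed

lemma compact_optimal:
  assumes A: "0 < A" and F: "compact F" "F \<subseteq> cball 0 1 \<times> {-1..0}"
  shows "compact {(z, y). z \<in> F \<and> optimal A (fst z) (snd z) y}"
proof -
  let ?B = "F \<times> cball 0 (1 + vertex_radius A) :: (((real^'n) \<times> real) \<times> (real^'n)) set"
  have cB: "compact ?B" using F by (intro compact_Times) auto
  have F4: "z \<in> F \<Longrightarrow> snd z \<in> {-4..0}" for z using F(2) by fastforce
  have h: "continuous_on ?B (\<lambda>p. height A (g p) (snd (fst p)))" if g: "continuous_on ?B g" for g
  proof -
    have c: "continuous_on ?B (\<lambda>p. (g p, snd (fst p)))" by (intro continuous_intros g)
    have "(\<lambda>p. (g p, snd (fst p))) ` ?B \<subseteq> UNIV \<times> {-4..0}" using F4 by auto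
    from continuous_on_compose2[OF height_continuous c this, of A] show ?thesis by simp
  qed
  have cl: "closed {p \<in> ?B. height A y' (snd (fst p)) - A / 2 * (norm (fst (fst p) - y'))\<^sup>2
      \<le> height A (snd p) (snd (fst p)) - A / 2 * (norm (fst (fst p) - snd p))\<^sup>2}" for y'
    by (intro continuous_on_closed_Collect_le continuous_on_diff h compact_imp_closed cB continuous_intros)
  have "closed (\<Inter>y'. {p \<in> ?B. height A y' (snd (fst p)) - A / 2 * (norm (fst (fst p) - y'))\<^sup>2
      \<le> height A (snd p) (snd (fst p)) - A / 2 * (norm (fst (fst p) - snd p))\<^sup>2})"
    using cl by (intro closed_INT) auto
  then have "compact (?B \<inter> (\<Inter>y'. {p \<in> ?B. height A y' (snd (fst p)) - A / 2 * (norm (fst (fst p) - y'))\<^sup>2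
      \<le> height A (snd p) (snd (fst p)) - A / 2 * (norm (fst (fst p) - snd p))\<^sup>2}))"
    by (intro compact_Int_closed cB)
  also have "?B \<inter> (\<Inter>y'. {p \<in> ?B. height A y' (snd (fst p)) - A / 2 * (norm (fst (fst p) - y'))\<^sup>2
      \<le> height A (snd p) (snd (fst p)) - A / 2 * (norm (fst (fst p) - snd p))\<^sup>2})
      = {(z, y). z \<in> F \<and> optimal A (fst z) (snd z) y}"
  proof (intro equalityI subsetI)
    fix p assume p: "p \<in> {(z, y). z \<in> F \<and> optimal A (fst z) (snd z) y}"
    obtain x t y where p_eq: "p = ((x, t), y)" by (metis prod.collapse)
    have xt: "(x, t) \<in> F" "optimal A x t y" using p by (auto simp: p_eq)
    have "norm x \<le> 1" "-4 \<le> t" "t \<le> 0" using xt(1) F(2) by auto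
    then have "norm (x - y) \<le> vertex_radius A" "norm x \<le> 1" using optimal_bounded[OF A _ _ _ xt(2)] by auto
    then have "norm y \<le> 1 + vertex_radius A" using norm_triangle_ineq4[of x "x - y"] by simp
    then show "p \<in> ?B \<inter> (\<Inter>y'. {p \<in> ?B. height A y' (snd (fst p)) - A / 2 * (norm (fst (fst p) - y'))\<^sup>2
      \<le> height A (snd p) (snd (fst p)) - A / 2 * (norm (fst (fst p) - snd p))\<^sup>2})"
      using xt by (auto simp: p_eq optimal_def)
  qed (auto simp: optimal_def)
  finally show ?thesis .
qed

section \<open>The measure of the new contact set\<close>

definition jacobian_const :: real where
  "jacobian_const = 792 * (384 * (real CARD('n))\<^sup>2) ^ CARD('n)"

text \<open>
  Grid cells of width \<open>s\<close> and duration \<open>(n s)\<^sup>2 / lam\<close>. By \<open>contact_box_bound\<close> the parameters belonging to one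
  cell lie over a cube of side \<open>96 (\<beta> / lam) n s\<close> in \<open>Y\<close>, in a band of width of order
  \<open>A (\<beta> / lam) (n s)\<^sup>2\<close> around the graph of a function \<open>f\<close>: the heights for which the paraboloids have
  the same value at a reference point.
\<close>

lemma contact_parameters_measure:
  assumes A: "0 < A" and W: "compact W" and S: "S \<in> lmeasurable" "S \<subseteq> cball 0 1 \<times> {-1..0}"
    and touch: "\<And>Y h. (Y, h) \<in> W \<Longrightarrow> \<exists>z\<in>S. touch A Y h z"
  shows "measure lebesgue W \<le> (96 * real CARD('n)) ^ CARD('n) * 198 * A * \<beta> * (\<beta> / lam) ^ CARD('n) * measure lebesgue S"
proof -
  define n where "n = real CARD('n)"
  define m where "m = \<beta> / lam"
  have n: "1 \<le> n" by (simp add: n_def Suc_le_eq)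
  have m: "0 < m" "m * lam = \<beta>" using beta lam by (auto simp: m_def)
  have "\<forall>w\<in>W. \<exists>z. z \<in> S \<and> touch A (fst w) (snd w) z" using touch by (metis prod.collapse)
  from bchoice[OF this] obtain g where "\<forall>w\<in>W. g w \<in> S \<and> touch A (fst w) (snd w) (g w)" ..
  then have g: "\<And>w. w \<in> W \<Longrightarrow> g w \<in> S" "\<And>w. w \<in> W \<Longrightarrow> touch A (fst w) (snd w) (g w)" by auto
  obtain Bw where Bw: "\<And>w. w \<in> W \<Longrightarrow> norm w \<le> Bw" using compact_imp_bounded[OF W] bounded_iff by blast
  obtain \<tau> where \<tau>: "\<tau> > 0"
    and box: "\<And>y1 h1 x1 t1 y2 h2 x2 t2 r. touch A y1 h1 (x1, t1) \<Longrightarrow> touch A y2 h2 (x2, t2) \<Longrightarrow>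
      norm x1 \<le> 1 \<Longrightarrow> norm x2 \<le> 1 \<Longrightarrow> -1 \<le> t1 \<Longrightarrow> t1 \<le> t2 \<Longrightarrow> t2 \<le> 0 \<Longrightarrow>
      0 < r \<Longrightarrow> norm (x1 - x2) \<le> r \<Longrightarrow> t2 - t1 \<le> r\<^sup>2 / lam \<Longrightarrow> t2 < t1 + \<tau> \<Longrightarrow> norm (y1 - y2) * r < 1/4 \<Longrightarrow>
      norm (y1 - y2) \<le> 48 * (\<beta> / lam) * r \<and>
      \<bar>paraboloid A y1 h1 (x1, t1) - paraboloid A y2 h2 (x1, t1)\<bar> \<le> 51 * A * (\<beta> / lam) * r\<^sup>2"
    by (rule contact_box_bound[OF A]) (rule that)
  define s where "s = (\<lambda>k. 1 / real (Suc k))"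
  have s: "0 < s k" for k by (simp add: s_def)
  have s_lim: "s \<longlonglongrightarrow> 0" unfolding s_def using LIMSEQ_inverse_real_of_nat by (simp add: inverse_eq_divide)
  define T where "T = (\<lambda>k. (n * s k)\<^sup>2 / lam)"
  have T: "0 < T k" for k using s[of k] n lam by (simp add: T_def)
  have T_lim: "T \<longlonglongrightarrow> 0"
  proof -
    have "(\<lambda>k. (n * s k)\<^sup>2 / lam) \<longlonglongrightarrow> (n * 0)\<^sup>2 / lam" by (intro tendsto_intros s_lim) (use lam in auto)
    then show ?thesis by (simp add: T_def)
  qed
  define d :: "nat \<Rightarrow> (real^'n) \<times> real" where "d = (\<lambda>k. (s k *\<^sub>R One, T k))"
  have dpos: "0 < d k \<bullet> i" if "i \<in> Basis" for k i
    using that s[of k] T[of k] by (auto simp: d_def Basis_prod_def inner_sum_left_Basis)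
  have dprod: "(\<Prod>i\<in>Basis. d k \<bullet> i) = (s k) ^ CARD('n) * T k" for k
    unfolding d_def prod_Basis_Pair by (simp add: inner_sum_left_Basis)
  let ?C = "(96 * n) ^ CARD('n) * 198 * A * \<beta> * m ^ CARD('n)"
  have "measure lebesgue W \<le> ?C * measure lebesgue S"
  proof (rule measure_le_grid_images(2)[where g = g and d = d])
    show "S \<in> lmeasurable" by (rule S(1))
    show "bounded S" by (rule bounded_subset[OF _ S(2)]) (auto intro!: bounded_Times)
    show "g ` W \<subseteq> S" using g(1) by blast
    show "W \<in> sets lebesgue" using lmeasurable_compact[OF W] by (rule fmeasurableD)
    show "0 \<le> ?C" using A beta(1) m n by simp
    show "0 < d k \<bullet> i" if "i \<in> Basis" for k i using dpos that .
    have "(\<lambda>k. (s k *\<^sub>R One, T k)) \<longlonglongrightarrow> ((0::real) *\<^sub>R (One :: real^'n), 0)"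
      by (intro tendsto_intros s_lim T_lim)
    then show "d \<longlonglongrightarrow> 0" by (simp add: d_def zero_prod_def)
    have ev1: "eventually (\<lambda>k. T k < \<tau>) sequentially" using T_lim \<tau> by (rule order_tendstoD)
    have "(\<lambda>k. 2 * Bw * (n * s k)) \<longlonglongrightarrow> 2 * Bw * (n * 0)" by (intro tendsto_intros s_lim)
    then have ev2: "eventually (\<lambda>k. 2 * Bw * (n * s k) < 1/4) sequentially"
      by (intro order_tendstoD) auto
    show "eventually (\<lambda>k. \<forall>w0\<in>W. \<exists>V. V \<in> lmeasurable \<and>
        {w\<in>W. grid_index (d k) (g w) = grid_index (d k) (g w0)} \<subseteq> V \<and>
        measure lebesgue V \<le> ?C * (\<Prod>i\<in>Basis. d k \<bullet> i)) sequentially"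
      using ev1 ev2
    proof eventually_elim
      case (elim k)
      define r where "r = n * s k"
      have r: "0 < r" using n s[of k] by (simp add: r_def)
      show ?case
      proof
        fix w0 assume w0: "w0 \<in> W"
        obtain Y0 h0 where w0_eq: "w0 = (Y0, h0)" by fastforce
        obtain x0 t0 where z0_eq: "g w0 = (x0, t0)" by fastforce
        have t0: "touch A Y0 h0 (x0, t0)" and b0: "norm x0 \<le> 1" "-1 \<le> t0" "t0 \<le> 0"
          using g[OF w0] S(2) unfolding z0_eq by (auto simp: w0_eq)
        define f where "f = (\<lambda>Y. h0 + A / 2 * (norm (x0 - Y))\<^sup>2 - A / 2 * (norm (x0 - Y0))\<^sup>2)"
        define \<rho> where "\<rho> = 48 * m * r"
        define H where "H = 99 * A * m * r\<^sup>2"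
        have pos: "0 \<le> \<rho>" "0 \<le> H" using m r A by (auto simp: \<rho>_def H_def)
        define K where "K = cbox (Y0 - \<rho> *\<^sub>R One) (Y0 + \<rho> *\<^sub>R One)"
        define V where "V = {(Y, h). Y \<in> K \<and> \<bar>h - f Y\<bar> \<le> H}"
        have cont: "continuous_on K f" unfolding f_def by (intro continuous_intros)
        have V: "V \<in> lmeasurable" "measure lebesgue V = measure lebesgue K * (2 * H)"
          unfolding V_def using measure_band[OF _ cont pos(2)] by (auto simp: K_def)
        have "measure lebesgue K = (2 * \<rho>) ^ CARD('n)"
          unfolding K_def using measure_cube[OF pos(1), of Y0] by simp
        then have "measure lebesgue V = (96 * n * m * s k) ^ CARD('n) * (198 * A * m * (n * s k)\<^sup>2)"
          unfolding V(2) by (simp add: \<rho>_def H_def r_def mult_ac)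
        also have "\<dots> = (96 * n) ^ CARD('n) * m ^ CARD('n) * s k ^ CARD('n) * (198 * A * (m * lam) * T k)"
          using lam by (simp add: power_mult_distrib T_def)
        also have "\<dots> = ?C * (\<Prod>i\<in>Basis. d k \<bullet> i)"
          unfolding m(2) dprod by (simp add: mult_ac)
        finally have Vm: "measure lebesgue V = ?C * (\<Prod>i\<in>Basis. d k \<bullet> i)" .
        have "{w\<in>W. grid_index (d k) (g w) = grid_index (d k) (g w0)} \<subseteq> V"
        proof
          fix w assume "w \<in> {w\<in>W. grid_index (d k) (g w) = grid_index (d k) (g w0)}"
          then have w: "w \<in> W" "grid_index (d k) (g w) = grid_index (d k) (g w0)" by auto
          obtain Y h where w_eq: "w = (Y, h)" by fastforce
          obtain x t where z_eq: "g w = (x, t)" by fastforce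
          have tz: "touch A Y h (x, t)" and bz: "norm x \<le> 1" "-1 \<le> t" "t \<le> 0"
            using g[OF w(1)] S(2) unfolding z_eq by (auto simp: w_eq)
          have close: "\<bar>((x, t) - (x0, t0)) \<bullet> i\<bar> \<le> d k \<bullet> i" if "i \<in> Basis" for i
            using grid_index_eq_imp_close[OF dpos w(2) that] unfolding z_eq z0_eq by simp
          have "norm (x - x0) \<le> (\<Sum>i\<in>Basis. \<bar>(x - x0) \<bullet> i\<bar>)" by (rule norm_le_l1)
          also have "\<dots> \<le> (\<Sum>i\<in>(Basis :: (real^'n) set). s k)"
          proof (rule sum_mono)
            fix i :: "real^'n" assume i: "i \<in> Basis"
            then show "\<bar>(x - x0) \<bullet> i\<bar> \<le> s k"
              using close[of "(i, 0)"] by (simp add: d_def inner_sum_left_Basis Basis_prod_def)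
          qed
          finally have xr: "norm (x - x0) \<le> r" by (simp add: r_def n_def)
          have tr: "\<bar>t - t0\<bar> \<le> r\<^sup>2 / lam"
            using close[of "(0, 1)"] by (simp add: d_def T_def r_def Basis_prod_def)
          have t\<tau>: "\<bar>t - t0\<bar> < \<tau>" using tr elim(1) by (simp add: T_def r_def)
          have "norm Y \<le> Bw" "norm Y0 \<le> Bw"
            using Bw[OF w(1)] Bw[OF w0] norm_fst_le[of Y h] norm_fst_le[of Y0 h0] by (auto simp: w_eq w0_eq)
          then have "norm (Y - Y0) \<le> 2 * Bw" using norm_triangle_ineq4[of Y Y0] by linarith
          then have "norm (Y - Y0) * r \<le> 2 * Bw * r" using r by (intro mult_right_mono) auto
          then have Yr: "norm (Y - Y0) * r < 1/4" using elim(2) by (simp add: r_def)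
          have "norm (Y - Y0) \<le> 48 * m * r \<and>
            (\<exists>x' t'. norm (x' - x0) \<le> r \<and>
              \<bar>paraboloid A Y h (x', t') - paraboloid A Y0 h0 (x', t')\<bar> \<le> 51 * A * m * r\<^sup>2)"
          proof (cases "t \<le> t0")
            case True
            have "norm (Y - Y0) \<le> 48 * (\<beta> / lam) * r \<and>
              \<bar>paraboloid A Y h (x, t) - paraboloid A Y0 h0 (x, t)\<bar> \<le> 51 * A * (\<beta> / lam) * r\<^sup>2"
              using True xr tr t\<tau> Yr bz b0 r by (intro box[OF tz t0]) auto
            then show ?thesis using xr unfolding m_def by blast
          next
            case False
            have "norm (Y0 - Y) \<le> 48 * (\<beta> / lam) * r \<and>
              \<bar>paraboloid A Y0 h0 (x0, t0) - paraboloid A Y h (x0, t0)\<bar> \<le> 51 * A * (\<beta> / lam) * r\<^sup>2"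
              using False xr tr t\<tau> Yr bz b0 r by (intro box[OF t0 tz]) (auto simp: norm_minus_commute)
            then show ?thesis using r unfolding m_def
              by (intro conjI exI[of _ x0] exI[of _ t0]) (auto simp: norm_minus_commute abs_minus_commute)
          qed
          then obtain x' t' where dY: "norm (Y - Y0) \<le> 48 * m * r" and x': "norm (x' - x0) \<le> r"
            "\<bar>paraboloid A Y h (x', t') - paraboloid A Y0 h0 (x', t')\<bar> \<le> 51 * A * m * r\<^sup>2" by blast
          have "A * norm (Y - Y0) * norm (x' - x0) \<le> A * (48 * m * r) * r"
            using dY x'(1) A r m by (intro mult_mono) auto
          then have "\<bar>paraboloid A Y h (x0, t0) - paraboloid A Y0 h0 (x0, t0)\<bar> \<le> 51 * A * m * r\<^sup>2 + A * (48 * m * r) * r"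
            using paraboloid_difference_bound[of A Y h x' t' Y0 h0 x0 t0] x'(2) A by linarith
          also have "\<dots> = H" by (simp add: H_def power2_eq_square algebra_simps)
          also have "paraboloid A Y h (x0, t0) - paraboloid A Y0 h0 (x0, t0) = h - f Y"
            by (simp add: paraboloid_def f_def)
          finally have hf: "\<bar>h - f Y\<bar> \<le> H" .
          have "Y \<in> K" unfolding K_def mem_box
          proof
            fix i :: "real^'n" assume i: "i \<in> Basis"
            have "\<bar>(Y - Y0) \<bullet> i\<bar> \<le> \<rho>" using Basis_le_norm[OF i, of "Y - Y0"] dY by (simp add: \<rho>_def)
            then show "(Y0 - \<rho> *\<^sub>R One) \<bullet> i \<le> Y \<bullet> i \<and> Y \<bullet> i \<le> (Y0 + \<rho> *\<^sub>R One) \<bullet> i"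
              using i by (auto simp: inner_diff_left inner_add_left inner_sum_left_Basis)
          qed
          then show "w \<in> V" using hf by (simp add: V_def w_eq)
        qed
        then show "\<exists>V. V \<in> lmeasurable \<and>
          {w\<in>W. grid_index (d k) (g w) = grid_index (d k) (g w0)} \<subseteq> V \<and>
          measure lebesgue V \<le> ?C * (\<Prod>i\<in>Basis. d k \<bullet> i)"
          using V(1) Vm by (intro exI[of _ V]) auto
      qed
    qed
  qed
  then show ?thesis by (simp add: n_def m_def)
qed

end

section \<open>Decay of the superlevel sets\<close>

lemma geometric_decay:
  fixes g \<delta> :: "nat \<Rightarrow> real"
  assumes \<theta>: "0 < \<theta>" "\<theta> \<le> 1" and q: "0 < q" "1 - \<theta> / 2 \<le> q" "\<mu> \<le> q" "0 \<le> \<mu>"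
    and C: "0 \<le> C" and g0: "g 0 \<le> K" and K: "2 * C \<le> K"
    and step: "\<And>k. g (Suc k) \<le> g k - \<theta> * (g k - C * \<mu> ^ k)"
  shows "g k \<le> K * q ^ k"
proof (induction k)
  case 0
  then show ?case using g0 by simp
next
  case (Suc k)
  have qk: "0 \<le> q ^ k" "\<mu> ^ k \<le> q ^ k" using q by (auto intro: power_mono)
  have "g (Suc k) \<le> (1 - \<theta>) * g k + \<theta> * C * \<mu> ^ k" using step[of k] by (simp add: algebra_simps)
  also have "\<dots> \<le> (1 - \<theta>) * (K * q ^ k) + \<theta> * C * q ^ k"
    using Suc qk \<theta> C by (intro add_mono mult_left_mono) auto
  also have "\<dots> = ((1 - \<theta>) * K + \<theta> * C) * q ^ k" by (simp add: algebra_simps)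
  also have "\<dots> \<le> (K * q) * q ^ k"
  proof (rule mult_right_mono)
    have "\<theta> * (2 * C) \<le> \<theta> * K" using K \<theta> by (intro mult_left_mono) auto
    moreover have "K * (1 - \<theta> / 2) \<le> K * q" using q K C by (intro mult_left_mono) auto
    ultimately show "(1 - \<theta>) * K + \<theta> * C \<le> K * q" by (simp add: algebra_simps)
  qed (rule qk)
  finally show ?case by simp
qed

lemma B1_measure_pos: "0 < measure lebesgue (B1 :: ((real^'n) \<times> real) set)"
proof -
  have "(0, -1/2) \<in> (B1 :: ((real^'n) \<times> real) set)" by (simp add: B1_eq)
  then have "\<not> negligible (B1 :: ((real^'n) \<times> real) set)" using open_not_negligible[OF open_B1] by blast
  then have "measure lebesgue (B1 :: ((real^'n) \<times> real) set) \<noteq> 0"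
    using B1_lmeasurable negligible_iff_measure by blast
  then show ?thesis by (simp add: zero_less_measure_iff)
qed

context nonneg_supersolution
begin

text \<open>
  The points of \<open>B1\<close> from which the displacements allowed by \<open>contact_near\<close> do not leave \<open>B1\<close>.
\<close>

definition interior_part :: "real \<Rightarrow> ((real^'n) \<times> real) set" where
  "interior_part \<delta> = {z. -1 < snd z \<and> snd z + \<delta>\<^sup>2 < - (norm (fst z) + 4 * \<beta> * \<delta>)\<^sup>2}"

lemma interior_part_subset: assumes "0 < \<delta>" shows "interior_part \<delta> \<subseteq> B1"
proof
  fix z :: "(real^'n) \<times> real" assume z: "z \<in> interior_part \<delta>"
  have "(norm (fst z))\<^sup>2 \<le> (norm (fst z) + 4 * \<beta> * \<delta>)\<^sup>2" using assms beta(1) by (intro power_mono) auto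
  moreover have "0 < \<delta>\<^sup>2" using assms by simp
  ultimately show "z \<in> B1" using z unfolding B1_eq interior_part_def mem_Collect_eq by linarith
qed

lemma open_interior_part: "open (interior_part \<delta>)"
  unfolding interior_part_def by (intro open_Collect_conj open_Collect_less continuous_intros)

lemma interior_part_lmeasurable: "0 < \<delta> \<Longrightarrow> interior_part \<delta> \<in> lmeasurable"
  by (intro lmeasurable_open open_interior_part
      bounded_subset[OF _ order_trans[OF interior_part_subset B1_subset]] bounded_Times) auto

definition layer_const :: real where
  "layer_const = measure lebesgue (cball (0::real^'n) 1) * (2 * (8 * \<beta> + 16 * \<beta>\<^sup>2 + 1))"

text \<open>
  For fixed \<open>x\<close> the times that are removed form an interval of length of order \<open>\<delta>\<close> below \<open>- |x|\<^sup>2\<close>.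
\<close>

lemma layer_measure:
  assumes \<delta>: "0 < \<delta>" "\<delta> \<le> 1"
  shows "measure lebesgue (B1 - interior_part \<delta>) \<le> layer_const * \<delta>"
proof -
  define H where "H = (8 * \<beta> + 16 * \<beta>\<^sup>2 + 1) * \<delta>"
  have H: "0 \<le> H" using \<delta> beta(1) by (simp add: H_def)
  let ?V = "{(x, t). x \<in> cball (0::real^'n) 1 \<and> \<bar>t - - (norm x)\<^sup>2\<bar> \<le> H}"
  have band: "?V \<in> lmeasurable" "measure lebesgue ?V = measure lebesgue (cball (0::real^'n) 1) * (2 * H)"
    by (rule measure_band[OF compact_cball _ H]; intro continuous_intros)+
  have "B1 - interior_part \<delta> \<subseteq> ?V"
  proof
    fix z :: "(real^'n) \<times> real" assume z: "z \<in> B1 - interior_part \<delta>"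
    define X where "X = norm (fst z)"
    have b: "-1 < snd z" "snd z < - X\<^sup>2" "0 \<le> X" using z by (auto simp: B1_eq X_def)
    have X1: "X \<le> 1" using z B1_subset by (auto simp: X_def)
    have "- (X + 4 * \<beta> * \<delta>)\<^sup>2 \<le> snd z + \<delta>\<^sup>2" using z b by (auto simp: interior_part_def X_def)
    moreover have "(X + 4 * \<beta> * \<delta>)\<^sup>2 = X\<^sup>2 + 8 * \<beta> * \<delta> * X + 16 * \<beta>\<^sup>2 * (\<delta> * \<delta>)"
      by (simp add: power2_eq_square algebra_simps)
    moreover have "8 * \<beta> * \<delta> * X \<le> 8 * \<beta> * \<delta> * 1" using X1 \<delta> beta(1) by (intro mult_left_mono) auto
    moreover have dd: "\<delta> * \<delta> \<le> \<delta> * 1" using \<delta> by (intro mult_left_mono) auto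
    moreover have "16 * \<beta>\<^sup>2 * (\<delta> * \<delta>) \<le> 16 * \<beta>\<^sup>2 * (\<delta> * 1)" by (rule mult_left_mono[OF dd]) simp
    ultimately have "- X\<^sup>2 - H \<le> snd z" unfolding H_def by (simp add: power2_eq_square algebra_simps)
    then have "\<bar>snd z - - X\<^sup>2\<bar> \<le> H" using b(2) by (simp add: abs_le_iff)
    then show "z \<in> ?V" using X1 by (cases z) (simp add: X_def)
  qed
  moreover have "B1 - interior_part \<delta> \<in> sets lebesgue"
    by (intro sets.Diff fmeasurableD B1_lmeasurable interior_part_lmeasurable \<delta>)
  ultimately have "measure lebesgue (B1 - interior_part \<delta>) \<le> measure lebesgue ?V"
    using band(1) by (intro measure_mono_fmeasurable)
  then show ?thesis unfolding band(2) by (simp add: layer_const_def H_def mult_ac)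
qed

definition new_contact :: "real \<Rightarrow> ((real^'n) \<times> real) set" where
  "new_contact A = (contact (2 * A) - contact A) \<inter> B1"

lemma contact_B1_lmeasurable:
  assumes "0 < A"
  shows "contact A \<inter> B1 \<in> lmeasurable"
proof -
  have "contact A \<inter> B1 = (contact A \<inter> (cball 0 1 \<times> {-1..0})) \<inter> B1" using B1_subset by blast
  moreover have "(contact A \<inter> (cball 0 1 \<times> {-1..0})) \<inter> B1 \<in> lmeasurable"
    using lmeasurable_compact[OF compact_contact[OF assms]] B1_lmeasurable by (rule fmeasurable_Int_fmeasurable[OF _ fmeasurableD])
  ultimately show ?thesis by simp
qed

lemma B1_minus_contact_lmeasurable:
  assumes "0 < A"
  shows "B1 - contact A \<in> lmeasurable"
proof -
  have "B1 - contact A = B1 - contact A \<inter> B1" by blast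
  then show ?thesis
    using fmeasurable.Diff[OF B1_lmeasurable contact_B1_lmeasurable[OF assms]] by simp
qed

text \<open>
  The points of \<open>F\<close> are compared with the parameters of their doubled optimal paraboloids, and these
  with the new contact points. The factors \<open>A \<beta>\<close> of the two comparisons cancel.
\<close>

lemma measure_non_contact_compact:
  assumes A: "0 < A" and \<delta>: "0 < \<delta>"
    and small: "u (0, 0) < spread_const * (\<delta> / 8) powr (2 * spread_exp) * (A * \<delta>\<^sup>2 / 8)"
    and F: "compact F" "F \<subseteq> interior_part \<delta> - contact A"
  shows "measure lebesgue F \<le> jacobian_const * (\<beta> / lam) ^ CARD('n) * measure lebesgue (new_contact A)"
proof -
  define n where "n = real CARD('n)"
  have F1: "F \<subseteq> cball 0 1 \<times> {-1..0}" using F(2) interior_part_subset[OF \<delta>] B1_subset by blast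
  define Op where "Op = {(z, y). z \<in> F \<and> optimal A (fst z) (snd z) y}"
  have cO: "compact Op" unfolding Op_def by (rule compact_optimal[OF A F(1) F1])
  define \<Theta> where "\<Theta> = (\<lambda>(z, y). (z, (mid_vertex (fst z) y, doubled_height A (fst z) (snd z) y (height A y (snd z)))))"
  define R where "R = \<Theta> ` Op"
  have h: "continuous_on Op (\<lambda>p. height A (snd p) (snd (fst p)))"
  proof -
    have c: "continuous_on Op (\<lambda>p. (snd p, snd (fst p)))" by (intro continuous_intros)
    have "(\<lambda>p. (snd p, snd (fst p))) ` Op \<subseteq> UNIV \<times> {-4..0}" using F1 by (auto simp: Op_def)
    from continuous_on_compose2[OF height_continuous c this, of A] show ?thesis by simp
  qed
  have cR: "compact R" unfolding R_def
  proof (rule compact_continuous_image[OF _ cO])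
    show "continuous_on Op \<Theta>"
      unfolding \<Theta>_def mid_vertex_def doubled_height_def case_prod_unfold by (intro continuous_intros h)
  qed
  have memR: "((x, t), (Y, h)) \<in> R \<longleftrightarrow> (x, t) \<in> F \<and> (\<exists>y. optimal A x t y \<and> Y = mid_vertex x y \<and> h = doubled_height A x t y (height A y t))"
    for x t Y h by (force simp: R_def \<Theta>_def Op_def)
  have fst_R: "fst ` R = F"
  proof (intro equalityI subsetI)
    fix z assume z: "z \<in> F"
    obtain x t where z_eq: "z = (x, t)" by fastforce
    have "norm x \<le> 1" "-4 \<le> t" "t \<le> 0" using z F1 by (auto simp: z_eq)
    then obtain y where "optimal A x t y" using optimal_exists[OF A] by blast
    then have "((x, t), (mid_vertex x y, doubled_height A x t y (height A y t))) \<in> R" using z by (auto simp: memR z_eq)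
    then show "z \<in> fst ` R" unfolding z_eq by (rule rev_image_eqI) simp
  qed (auto simp: R_def \<Theta>_def Op_def)
  have A\<beta>: "0 < A * \<beta>" using A beta(1) by simp
  have "A * \<beta> * measure lebesgue (fst ` R) \<le> 2 * (4 * DIM(real^'n)) ^ DIM(real^'n) * measure lebesgue (snd ` R)"
  proof (rule measure_compact_relation[OF cR A\<beta>])
    fix x1 x2 :: "real^'n" and t y1 y2 h1 h2
    assume "((x1, t), (y1, h1)) \<in> R" "((x2, t), (y2, h2)) \<in> R"
    then show "norm (x1 - x2) \<le> 2 * norm (y1 - y2)"
      unfolding memR using optimal_expansive[OF A] by blast
  next
    fix x1 x2 :: "real^'n" and t1 t2 y h1 h2
    assume r: "((x1, t1), (y, h1)) \<in> R" "((x2, t2), (y, h2)) \<in> R" "t1 < t2"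
    then have "-4 \<le> t1" "t2 \<le> 0" using F1 by (auto simp: memR)
    then show "A * \<beta> * (t2 - t1) \<le> h1 - h2"
      using r unfolding memR using optimal_time_monotone[OF A] by blast
  qed
  moreover have "measure lebesgue (snd ` R) \<le> (96 * n) ^ CARD('n) * 198 * (2 * A) * \<beta> * (\<beta> / lam) ^ CARD('n)
      * measure lebesgue (new_contact A)"
    unfolding n_def
  proof (rule contact_parameters_measure)
    show "0 < 2 * A" using A by simp
    show "compact (snd ` R)" by (intro compact_continuous_image cR continuous_intros)
    have "new_contact A = contact (2 * A) \<inter> B1 - contact A \<inter> B1" by (auto simp: new_contact_def)
    then show "new_contact A \<in> lmeasurable"
      using fmeasurable.Diff[OF contact_B1_lmeasurable contact_B1_lmeasurable, of "2 * A" A] A by simp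
    show "new_contact A \<subseteq> cball 0 1 \<times> {-1..0}" using B1_subset by (auto simp: new_contact_def)
    fix Y h assume "(Y, h) \<in> snd ` R"
    then obtain x t where "((x, t), (Y, h)) \<in> R" by force
    then obtain y where y: "(x, t) \<in> F" "optimal A x t y" "Y = mid_vertex x y" "h = doubled_height A x t y (height A y t)"
      by (auto simp: memR)
    have xt: "-1 < t" "t + \<delta>\<^sup>2 < - (norm x + 4 * \<beta> * \<delta>)\<^sup>2" "(x, t) \<notin> contact A"
      using y(1) F(2) by (auto simp: interior_part_def)
    obtain x' t' where "touch (2 * A) (mid_vertex x y) (doubled_height A x t y (height A y t)) (x', t')"
      and near: "t \<le> t'" "t' \<le> t + \<delta>\<^sup>2" "norm (x' - x) \<le> 4 * \<beta> * \<delta>"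
      by (rule contact_near[OF A \<delta> xt(1,2) y(2) small]) (rule that)
    with y(3,4) have z': "touch (2 * A) Y h (x', t')" "t \<le> t'" "t' \<le> t + \<delta>\<^sup>2" "norm (x' - x) \<le> 4 * \<beta> * \<delta>"
      by simp_all
    have "norm x' \<le> norm x + norm (x' - x)" by (metis norm_triangle_sub)
    then have "(norm x')\<^sup>2 \<le> (norm x + 4 * \<beta> * \<delta>)\<^sup>2" using z'(4) by (intro power_mono) auto
    then have B: "(x', t') \<in> B1"
      using z'(2,3) xt(1,2) unfolding B1_eq mem_Collect_eq fst_conv snd_conv by linarith
    then have b: "norm x' \<le> 1" "t' \<le> 0" "-1 \<le> t'" using B1_subset by auto
    have "(x', t') \<notin> contact A"
    proof (rule doubled_contact_new[OF A y(2) _ z'(2) b(2,3) xt(3) b(1)])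
      show "-4 \<le> t" using xt(1) by linarith
      show "touch (2 * A) (mid_vertex x y) (doubled_height A x t y (height A y t)) (x', t')" using z'(1) by (simp only: y(3,4))
    qed
    then have "(x', t') \<in> new_contact A" using B z'(1) by (auto simp: new_contact_def contact_def)
    then show "\<exists>z\<in>new_contact A. touch (2 * A) Y h z" using z'(1) by blast
  qed
  then have "2 * (4 * DIM(real^'n)) ^ DIM(real^'n) * measure lebesgue (snd ` R)
    \<le> 2 * (4 * DIM(real^'n)) ^ DIM(real^'n) * ((96 * n) ^ CARD('n) * 198 * (2 * A) * \<beta> * (\<beta> / lam) ^ CARD('n)
      * measure lebesgue (new_contact A))"
    by (intro mult_left_mono) auto
  moreover have "2 * (4 * DIM(real^'n)) ^ DIM(real^'n) * ((96 * n) ^ CARD('n) * 198 * (2 * A) * \<beta> * (\<beta> / lam) ^ CARD('n)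
      * measure lebesgue (new_contact A))
    = (A * \<beta>) * (jacobian_const * (\<beta> / lam) ^ CARD('n) * measure lebesgue (new_contact A))"
  proof -
    have "384 * n\<^sup>2 = (4 * n) * (96 * n)" by (simp add: power2_eq_square)
    then have cc: "jacobian_const = 792 * ((4 * n) ^ CARD('n) * (96 * n) ^ CARD('n))"
      unfolding jacobian_const_def n_def[symmetric] by (simp only: power_mult_distrib)
    have "real DIM(real^'n) = n" by (simp add: n_def)
    then show ?thesis unfolding cc by (simp add: algebra_simps)
  qed
  ultimately have "(A * \<beta>) * measure lebesgue F
    \<le> (A * \<beta>) * (jacobian_const * (\<beta> / lam) ^ CARD('n) * measure lebesgue (new_contact A))"
    unfolding fst_R by linarith
  then show ?thesis using A\<beta> by (simp only: mult_le_cancel_left_pos)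
qed

lemma measure_non_contact:
  assumes A: "0 < A" and \<delta>: "0 < \<delta>" "\<delta> \<le> 1"
    and small: "u (0, 0) < spread_const * (\<delta> / 8) powr (2 * spread_exp) * (A * \<delta>\<^sup>2 / 8)"
  shows "measure lebesgue (B1 - contact A) - layer_const * \<delta>
    \<le> jacobian_const * (\<beta> / lam) ^ CARD('n) * (measure lebesgue (B1 - contact A) - measure lebesgue (B1 - contact (2 * A)))"
proof -
  let ?K = "contact A \<inter> (cball 0 1 \<times> {-1..0})"
  let ?Fo = "interior_part \<delta> - contact A"
  have "?Fo = interior_part \<delta> - ?K" using interior_part_subset[OF \<delta>(1)] B1_subset by blast
  then have op: "open ?Fo" using compact_imp_closed[OF compact_contact[OF A]] open_interior_part by (simp add: open_Diff)
  have bd: "bounded ?Fo"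
    by (rule bounded_subset[of "cball 0 1 \<times> {-1..0}"])
      (use interior_part_subset[OF \<delta>(1)] B1_subset in \<open>auto intro!: bounded_Times\<close>)
  have lm: "?Fo \<in> lmeasurable" by (rule lmeasurable_open[OF bd op])
  let ?X = "jacobian_const * (\<beta> / lam) ^ CARD('n) * measure lebesgue (new_contact A)"
  have Fo: "measure lebesgue ?Fo \<le> ?X"
  proof (rule field_le_epsilon)
    fix e :: real assume e: "0 < e"
    obtain T where T: "closed T" "T \<subseteq> ?Fo" "?Fo - T \<in> lmeasurable" "emeasure lebesgue (?Fo - T) < ennreal e"
      using sets_lebesgue_inner_closed[of ?Fo e] lm e by (auto simp: fmeasurableD)
    have cT: "compact T" using T(1,2) bd bounded_subset compact_eq_bounded_closed by blast
    have "measure lebesgue ?Fo \<le> measure lebesgue T + measure lebesgue (?Fo - T)"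
      using measure_Un_le[of T lebesgue "?Fo - T"] T(2,3) lmeasurable_compact[OF cT]
      by (simp add: fmeasurableD Un_absorb1 Un_Diff_cancel)
    moreover have "measure lebesgue (?Fo - T) \<le> e"
      using T(3,4) e by (simp add: emeasure_eq_measure2 ennreal_less_iff)
    moreover have "measure lebesgue T \<le> ?X"
      by (rule measure_non_contact_compact[OF A \<delta>(1) small cT T(2)])
    ultimately show "measure lebesgue ?Fo \<le> ?X + e" by linarith
  qed
  have lm1: "B1 - contact A \<in> lmeasurable" "B1 - contact (2 * A) \<in> lmeasurable"
    using B1_minus_contact_lmeasurable A by auto
  have lmL: "B1 - interior_part \<delta> \<in> lmeasurable"
    by (intro fmeasurable.Diff B1_lmeasurable interior_part_lmeasurable \<delta>)
  have "B1 - contact A \<subseteq> ?Fo \<union> (B1 - interior_part \<delta>)" by blast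
  then have "measure lebesgue (B1 - contact A) \<le> measure lebesgue (?Fo \<union> (B1 - interior_part \<delta>))"
    using lm lmL lm1 by (intro measure_mono_fmeasurable) (auto simp: fmeasurableD)
  also have "\<dots> \<le> measure lebesgue ?Fo + measure lebesgue (B1 - interior_part \<delta>)"
    using lm lmL by (intro measure_Un_le) (auto simp: fmeasurableD)
  also have "\<dots> \<le> ?X + layer_const * \<delta>" using Fo layer_measure[OF \<delta>] by linarith
  finally have 1: "measure lebesgue (B1 - contact A) - layer_const * \<delta> \<le> ?X" by linarith
  have "new_contact A = (B1 - contact A) - (B1 - contact (2 * A))"
    by (auto simp: new_contact_def)
  moreover have "B1 - contact (2 * A) \<subseteq> B1 - contact A" using contact_mono[OF A] by blast
  ultimately have "measure lebesgue (new_contact A)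
      = measure lebesgue (B1 - contact A) - measure lebesgue (B1 - contact (2 * A))"
    using lm1 by (simp add: measurable_measure_Diff fmeasurableD)
  with 1 show ?thesis by simp
qed

text \<open>
  A touching paraboloid with larger value would exceed \<open>A \<delta>\<^sup>2 / 8\<close> at a low point ahead of it.
\<close>

lemma contact_value_bound:
  assumes A: "0 < A" and \<delta>: "0 < \<delta>" "\<delta> \<le> 1"
    and small: "u (0, 0) < spread_const * (\<delta> / 8) powr (2 * spread_exp) * (A * \<delta>\<^sup>2 / 8)"
    and z: "z \<in> interior_part \<delta>" "z \<in> contact A"
  shows "u z < A"
proof -
  obtain x t where z_eq: "z = (x, t)" by fastforce
  have xt: "-1 < t" "t + \<delta>\<^sup>2 < - (norm x + 4 * \<beta> * \<delta>)\<^sup>2" using z by (auto simp: interior_part_def z_eq)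
  obtain y h where touch: "touch A y h (x, t)" using z by (auto simp: contact_def z_eq)
  obtain w where w: "norm (w - x) \<le> 5 / 8 * \<delta>" "norm (y - x) * (3 / 8 * \<delta>) \<le> (y - x) \<bullet> (w - x)"
    "(w, t) \<in> Q2bar" "u (w, t) < A * \<delta>\<^sup>2 / 8"
    by (rule low_point_ahead[OF A \<delta>(1) xt small, of t "y - x"]) auto
  have "0 \<le> norm (y - x) * (3 / 8 * \<delta>)" using \<delta> by simp
  then have "0 \<le> (y - x) \<bullet> (w - x)" using w(2) by linarith
  then have "0 \<le> A * ((y - x) \<bullet> (w - x))" using A by simp
  moreover have "A / 2 * (norm (w - x))\<^sup>2 \<le> A / 2 * (5 / 8 * \<delta>)\<^sup>2"
    using w(1) A by (intro mult_left_mono power_mono) auto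
  moreover have "paraboloid A y h (w, t) \<le> u (w, t)" using touch w(3) by (auto simp: touch_def below_def)
  moreover have "u (x, t) = paraboloid A y h (x, t)" using touch by (simp add: touch_def)
  ultimately have "u (x, t) < A * \<delta>\<^sup>2 / 8 + A / 2 * (5 / 8 * \<delta>)\<^sup>2"
    using w(4) paraboloid_shift[of A y h w t x t] by simp
  also have "\<dots> \<le> A * \<delta>\<^sup>2" using A by (simp add: power2_eq_square)
  also have "\<dots> \<le> A * 1" using A \<delta> by (intro mult_left_mono) (auto simp: power_le_one)
  finally show ?thesis by (simp add: z_eq)
qed

definition \<theta> :: real where "\<theta> = 1 / (jacobian_const * (\<beta> / lam) ^ CARD('n))"

lemma theta: "0 < \<theta>" "\<theta> \<le> 1"
proof -
  have n: "1 \<le> real CARD('n)" by (simp add: Suc_le_eq)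
  have "1 \<le> 384 * (real CARD('n))\<^sup>2" using one_le_power[OF n, of 2] by linarith
  then have "1 \<le> (384 * (real CARD('n))\<^sup>2) ^ CARD('n)" by (rule one_le_power)
  then have "1 \<le> jacobian_const" by (simp add: jacobian_const_def)
  moreover have "1 \<le> (\<beta> / lam) ^ CARD('n)" using beta(4) by (rule one_le_power)
  ultimately have "1 * 1 \<le> jacobian_const * (\<beta> / lam) ^ CARD('n)" by (intro mult_mono) auto
  then show "0 < \<theta>" "\<theta> \<le> 1" by (auto simp: \<theta>_def)
qed

text \<open>
  With \<open>A = start_const * u (0, 0) * 2\<^sup>k\<close> and \<open>\<delta>\<close> the corresponding power of \<open>2\<close>, the smallness condition of
  \<open>contact_near\<close> reads \<open>u (0, 0) < 2 * u (0, 0)\<close>.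
\<close>

definition start_const :: real where "start_const = 16 * 8 powr (2 * spread_exp) / spread_const"

lemma start_const_pos: "0 < start_const" using beta by (simp add: start_const_def spread_const_def)

lemma superlevel_lmeasurable: "{z \<in> B1. c \<le> u z} \<in> lmeasurable"
proof -
  have eq: "{z \<in> B1. c \<le> u z} = {z \<in> Q2bar. c \<le> u z} \<inter> B1" using B1_subset by fastforce
  have "closed {z \<in> Q2bar. c \<le> u z}"
    by (intro continuous_on_closed_Collect_le continuous_on_const continuous_on_u closed_Times) auto
  then have "{z \<in> Q2bar. c \<le> u z} \<in> sets lebesgue" by (simp add: borel_closed)
  then have "{z \<in> B1. c \<le> u z} \<in> sets lebesgue"
    unfolding eq by (rule sets.Int[OF _ fmeasurableD[OF B1_lmeasurable]])
  then show ?thesis by (rule fmeasurableI2[OF B1_lmeasurable, rotated]) auto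
qed

text \<open>
  After \<open>k\<close> doublings the layer has width \<open>\<delta> = \<mu>\<^sup>k\<close>, where \<open>\<mu>\<close> is chosen so that
  \<open>\<delta>\<^sup>2\<^sup>p\<^sup>+\<^sup>2 2\<^sup>k = 1\<close> with \<open>p = spread_exp\<close>. The two upper bounds on \<open>\<epsilon>\<close> say that \<open>2\<^sup>-\<^sup>\<epsilon>\<close> decays
  neither faster than \<open>1 - \<theta>/2\<close> nor faster than \<open>\<mu>\<close>.
\<close>

lemma superlevel_decay:
  assumes u0: "0 < u (0, 0)" and \<epsilon>: "0 < \<epsilon>" "\<epsilon> \<le> \<theta> / 2" "\<epsilon> \<le> 1 / (2 * spread_exp + 2)"
  shows "measure lebesgue {z \<in> B1. start_const * u (0, 0) * 2 ^ k \<le> u z}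
    \<le> (measure lebesgue (B1 :: ((real^'n) \<times> real) set) + 3 * layer_const) * (2 powr - \<epsilon>) ^ k"
proof -
  define m where "m = u (0, 0)"
  define A where "A = (\<lambda>k::nat. start_const * m * 2 ^ k)"
  define P where "P = 2 * spread_exp + 2"
  have P: "0 < P" using lam beta by (simp add: P_def spread_exp_def add_pos_pos)
  define \<mu> where "\<mu> = 2 powr (- 1 / P)"
  have \<mu>: "0 < \<mu>" "\<mu> \<le> 1" using P powr_mono[of "- 1 / P" 0 2] by (auto simp: \<mu>_def)
  define \<delta> where "\<delta> = (\<lambda>k::nat. \<mu> ^ k)"
  have \<delta>: "0 < \<delta> k" "\<delta> k \<le> 1" for k using \<mu> by (auto simp: \<delta>_def power_le_one)
  have Ap: "0 < A k" for k using start_const_pos u0 by (simp add: A_def m_def)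
  have sc: "0 < spread_const" using beta by (simp add: spread_const_def)
  have small: "u (0, 0) < spread_const * (\<delta> k / 8) powr (2 * spread_exp) * (A k * (\<delta> k)\<^sup>2 / 8)" for k
  proof -
    have "\<delta> k powr P = ((2 powr (- 1 / P)) powr (real k)) powr P"
    proof -
      have "\<mu> ^ k = \<mu> powr real k" using powr_realpow[OF \<mu>(1)] by simp
      then show ?thesis by (simp only: \<delta>_def) (simp only: \<mu>_def)
    qed
    also have "\<dots> = 2 powr (- real k)" using P by (simp add: powr_powr)
    also have "\<dots> = 1 / 2 ^ k" by (simp add: powr_minus_divide powr_realpow)
    finally have dP: "\<delta> k powr P * 2 ^ k = 1" by simp
    have "\<delta> k powr P = \<delta> k powr (2 * spread_exp) * (\<delta> k)\<^sup>2"
      using \<delta>(1)[of k] by (simp add: P_def powr_add)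
    then have d: "\<delta> k powr (2 * spread_exp) * (\<delta> k)\<^sup>2 * 2 ^ k = 1" using dP by simp
    have "spread_const * (\<delta> k / 8) powr (2 * spread_exp) * (A k * (\<delta> k)\<^sup>2 / 8)
      = spread_const * (\<delta> k powr (2 * spread_exp) / 8 powr (2 * spread_exp)) * (start_const * m * 2 ^ k * (\<delta> k)\<^sup>2 / 8)"
      using \<delta>(1)[of k] by (simp add: powr_divide A_def)
    also have "\<dots> = 2 * m * (\<delta> k powr (2 * spread_exp) * (\<delta> k)\<^sup>2 * 2 ^ k)"
      using sc by (simp add: start_const_def)
    also have "\<dots> = 2 * m" by (simp add: d)
    finally show ?thesis using u0 by (simp add: m_def)
  qed
  define M where "M = measure lebesgue (B1 :: ((real^'n) \<times> real) set)"
  have L0: "0 \<le> layer_const" using beta(1) by (simp add: layer_const_def)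
  define K where "K = M + 2 * layer_const"
  define q where "q = 2 powr - \<epsilon>"
  have q: "0 < q" "1 - \<theta> / 2 \<le> q" "\<mu> \<le> q"
  proof -
    show "0 < q" by (simp add: q_def)
    have "1 - \<epsilon> * ln 2 \<le> q"
      using exp_ge_add_one_self[of "- \<epsilon> * ln 2"] by (simp add: q_def powr_def)
    moreover have "\<epsilon> * ln 2 \<le> \<epsilon> * 1" using \<epsilon> ln_le_minus_one[of "2::real"] by (intro mult_left_mono) auto
    ultimately show "1 - \<theta> / 2 \<le> q" using \<epsilon>(2) by linarith
    show "\<mu> \<le> q" unfolding \<mu>_def q_def using \<epsilon>(3) by (intro powr_mono) (auto simp: P_def)
  qed
  have step: "measure lebesgue (B1 - contact (A (Suc k))) \<le> measure lebesgue (B1 - contact (A k))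
      - \<theta> * (measure lebesgue (B1 - contact (A k)) - layer_const * \<mu> ^ k)" for k
  proof -
    define X where "X = jacobian_const * (\<beta> / lam) ^ CARD('n)"
    have X: "0 < X" "\<theta> = 1 / X" using theta(1) by (auto simp: \<theta>_def X_def)
    have "measure lebesgue (B1 - contact (A k)) - layer_const * \<mu> ^ k
       \<le> X * (measure lebesgue (B1 - contact (A k)) - measure lebesgue (B1 - contact (A (Suc k))))"
      using measure_non_contact[OF Ap \<delta> small, of k] by (simp add: X_def \<delta>_def A_def mult.commute mult.left_commute)
    from mult_left_mono[OF this, of \<theta>]
    have "\<theta> * (measure lebesgue (B1 - contact (A k)) - layer_const * \<mu> ^ k)
       \<le> \<theta> * X * (measure lebesgue (B1 - contact (A k)) - measure lebesgue (B1 - contact (A (Suc k))))"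
      using theta(1) by (simp only: mult.assoc less_imp_le)
    moreover have "\<theta> * X = 1" using X by simp
    ultimately show ?thesis by simp
  qed
  have decay: "measure lebesgue (B1 - contact (A k)) \<le> K * q ^ k"
  proof (rule geometric_decay[OF theta q _ L0])
    show "0 \<le> \<mu>" using \<mu> by simp
    have "measure lebesgue (B1 - contact (A 0)) \<le> M"
      unfolding M_def using B1_minus_contact_lmeasurable[OF Ap[of 0]] B1_lmeasurable
      by (intro measure_mono_fmeasurable) (auto simp: fmeasurableD)
    then show "measure lebesgue (B1 - contact (A 0)) \<le> K" using L0 by (simp add: K_def)
    show "2 * layer_const \<le> K" by (simp add: K_def M_def)
  qed (rule step)
  let ?E = "{z \<in> B1. start_const * u (0, 0) * 2 ^ k \<le> u z}"
  have lmL: "B1 - interior_part (\<delta> k) \<in> lmeasurable"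
    by (intro fmeasurable.Diff B1_lmeasurable interior_part_lmeasurable \<delta>)
  have "?E \<subseteq> (B1 - contact (A k)) \<union> (B1 - interior_part (\<delta> k))"
    using contact_value_bound[OF Ap \<delta> small] by (force simp: A_def m_def)
  moreover have "?E \<in> sets lebesgue" by (rule fmeasurableD[OF superlevel_lmeasurable])
  ultimately have "measure lebesgue ?E \<le> measure lebesgue ((B1 - contact (A k)) \<union> (B1 - interior_part (\<delta> k)))"
    using lmL B1_minus_contact_lmeasurable[OF Ap[of k]] by (intro measure_mono_fmeasurable) auto
  also have "\<dots> \<le> measure lebesgue (B1 - contact (A k)) + measure lebesgue (B1 - interior_part (\<delta> k))"
    using lmL B1_minus_contact_lmeasurable[OF Ap[of k]] by (intro measure_Un_le) (auto simp: fmeasurableD)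
  also have "\<dots> \<le> K * q ^ k + layer_const * q ^ k"
  proof (rule add_mono[OF decay])
    have "measure lebesgue (B1 - interior_part (\<delta> k)) \<le> layer_const * \<mu> ^ k"
      using layer_measure[OF \<delta>] by (simp add: \<delta>_def)
    also have "\<dots> \<le> layer_const * q ^ k" using L0 q \<mu> by (intro mult_left_mono power_mono) auto
    finally show "measure lebesgue (B1 - interior_part (\<delta> k)) \<le> layer_const * q ^ k" .
  qed
  also have "\<dots> = (M + 3 * layer_const) * q ^ k" by (simp add: K_def algebra_simps)
  finally show ?thesis by (simp add: M_def q_def)
qed

text \<open>
  The factor in \<open>superlevel_decay\<close>, relative to the measure of \<open>B1\<close>; one factor 2 pays for rounding the
  level to a power of 2. It is absorbed into the constant multiplying \<open>u (0, 0)\<close> by raising it to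
  the power \<open>1 / \<epsilon>\<close>.
\<close>

definition measure_ratio :: real where
  "measure_ratio = 2 * (measure lebesgue (B1 :: ((real^'n) \<times> real) set) + 3 * layer_const)
    / measure lebesgue (B1 :: ((real^'n) \<times> real) set)"

lemma measure_ratio_ge_1: "1 \<le> measure_ratio"
proof -
  have "0 \<le> layer_const" using beta(1) by (simp add: layer_const_def)
  then show ?thesis unfolding measure_ratio_def using B1_measure_pos[where 'n = 'n] by (subst pos_le_divide_eq) auto
qed

lemma superlevel_measure:
  assumes u0: "0 < u (0, 0)" and \<epsilon>: "0 < \<epsilon>" "\<epsilon> \<le> \<theta> / 2" "\<epsilon> \<le> 1 / (2 * spread_exp + 2)" and t: "0 < t"
  shows "measure lebesgue {z \<in> B1. start_const * measure_ratio powr (1 / \<epsilon>) * u (0, 0) * t \<le> u z}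
    \<le> measure lebesgue (B1 :: ((real^'n) \<times> real) set) * t powr (- \<epsilon>)"
proof -
  let ?M = "measure lebesgue (B1 :: ((real^'n) \<times> real) set)"
  define D where "D = measure_ratio powr (1 / \<epsilon>)"
  have D: "1 \<le> D" using measure_ratio_ge_1 \<epsilon> by (simp add: D_def ge_one_powr_ge_zero)
  have D\<epsilon>: "D powr - \<epsilon> = 1 / measure_ratio"
    using \<epsilon> measure_ratio_ge_1 by (simp add: D_def powr_powr powr_minus_divide)
  let ?S = "\<lambda>c. {z \<in> B1. c \<le> u z}"
  show ?thesis
  proof (cases "t < 1")
    case True
    have "measure lebesgue (?S (start_const * D * u (0, 0) * t)) \<le> ?M"
      using B1_lmeasurable fmeasurableD[OF superlevel_lmeasurable] by (intro measure_mono_fmeasurable) auto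
    also have "?M \<le> ?M * t powr (- \<epsilon>)"
      using True t \<epsilon> powr_mono2'[of "- \<epsilon>" t 1] mult_left_mono[of 1 "t powr (- \<epsilon>)" ?M] by simp
    finally show ?thesis unfolding D_def .
  next
    case False
    then have Dt: "1 \<le> D * t" using D mult_mono[of 1 D 1 t] by simp
    define l where "l = log 2 (D * t)"
    have l: "0 \<le> l" using Dt by (simp add: l_def)
    define k where "k = nat \<lfloor>l\<rfloor>"
    have k: "real k \<le> l" "l < real k + 1" using l by (simp_all add: k_def)
    have l2: "2 powr l = D * t" using Dt by (simp add: l_def)
    have "2 ^ k \<le> D * t"
      using k(1) powr_mono[of "real k" l 2] by (simp add: l2 powr_realpow)
    then have "start_const * u (0, 0) * 2 ^ k \<le> start_const * u (0, 0) * (D * t)"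
      using start_const_pos u0 by (intro mult_left_mono) auto
    then have "?S (start_const * D * u (0, 0) * t) \<subseteq> ?S (start_const * u (0, 0) * 2 ^ k)"
      by (auto simp: mult_ac)
    then have "measure lebesgue (?S (start_const * D * u (0, 0) * t)) \<le> measure lebesgue (?S (start_const * u (0, 0) * 2 ^ k))"
      by (intro measure_mono_fmeasurable fmeasurableD superlevel_lmeasurable)
    also have "\<dots> \<le> (?M * measure_ratio / 2) * (2 powr - \<epsilon>) ^ k"
    proof -
      have eq: "?M * measure_ratio = 2 * (?M + 3 * layer_const)"
        unfolding measure_ratio_def using B1_measure_pos[where 'n = 'n] by simp
      have "?M * measure_ratio / 2 = ?M + 3 * layer_const" unfolding eq by simp
      then show ?thesis using superlevel_decay[OF u0 \<epsilon>, of k] by (simp only:)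
    qed
    also have "\<dots> \<le> (?M * measure_ratio / 2) * (2 * (D * t) powr - \<epsilon>)"
    proof (rule mult_left_mono)
      have "0 < spread_exp" using lam beta(1) by (simp add: spread_exp_def)
      then have "1 / (2 * spread_exp + 2) \<le> 1" by (simp add: field_simps)
      then have e1: "\<epsilon> \<le> 1" using \<epsilon>(3) by linarith
      have "(2 powr - \<epsilon>) ^ k = 2 powr (- \<epsilon> * real k)" by (simp add: powr_realpow[symmetric] powr_powr)
      also have "\<dots> \<le> 2 powr (1 + l * - \<epsilon>)"
      proof (rule powr_mono)
        have "\<epsilon> * (l - real k) \<le> 1 * 1" using k \<epsilon>(1) e1 by (intro mult_mono) auto
        then show "- \<epsilon> * real k \<le> 1 + l * - \<epsilon>" by (simp add: algebra_simps)
      qed simp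
      also have "\<dots> = 2 * (D * t) powr - \<epsilon>" by (simp only: powr_add l2[symmetric] powr_powr) simp
      finally show "(2 powr - \<epsilon>) ^ k \<le> 2 * (D * t) powr - \<epsilon>" .
      show "0 \<le> ?M * measure_ratio / 2" using measure_ratio_ge_1 by simp
    qed
    also have "\<dots> = ?M * t powr - \<epsilon>"
      using D t measure_ratio_ge_1 D\<epsilon> by (simp add: powr_mult)
    finally show ?thesis unfolding D_def .
  qed
qed

text \<open>
  Both \<open>1 / \<theta>\<close> and \<open>2 * spread_exp + 2\<close> are bounded by a multiple of \<open>(\<beta> / lam)\<^sup>n\<close> depending on \<open>n\<close> only;
  for the second one this uses \<open>\<beta> / lam \<ge> 1\<close>.
\<close>

lemma exponent_admissible:
  assumes c: "0 < c" "c \<le> 1 / (2 * jacobian_const)" "c \<le> 1 / 34"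
  shows "c * lam ^ CARD('n) / \<beta> ^ CARD('n) \<le> \<theta> / 2"
    and "c * lam ^ CARD('n) / \<beta> ^ CARD('n) \<le> 1 / (2 * spread_exp + 2)"
proof -
  define X where "X = (\<beta> / lam) ^ CARD('n)"
  have X: "\<beta> / lam \<le> X" unfolding X_def using beta(4) by (intro self_le_power) auto
  have X0: "0 < X" using X beta(4) by linarith
  have eq: "c * lam ^ CARD('n) / \<beta> ^ CARD('n) = c * (1 / X)"
    by (simp add: X_def power_divide)
  have "c * (1 / X) \<le> 1 / (2 * jacobian_const) * (1 / X)" using c X0 by (intro mult_right_mono) auto
  then show "c * lam ^ CARD('n) / \<beta> ^ CARD('n) \<le> \<theta> / 2"
    unfolding eq by (simp add: \<theta>_def X_def)
  have "2 * spread_exp + 2 \<le> 34 * X" using X beta(4) by (simp add: spread_exp_def)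
  moreover have "0 < 2 * spread_exp + 2" using lam beta by (simp add: spread_exp_def add_pos_pos)
  ultimately have "1 / (34 * X) \<le> 1 / (2 * spread_exp + 2)" by (intro divide_left_mono) (auto simp: X0)
  moreover have "c * (1 / X) \<le> 1 / 34 * (1 / X)" using c X0 by (intro mult_right_mono) auto
  ultimately show "c * lam ^ CARD('n) / \<beta> ^ CARD('n) \<le> 1 / (2 * spread_exp + 2)"
    unfolding eq by simp
qed

end

theorem theorem2p1:
  shows "\<exists>c>0. \<forall>lam Lam :: real. 0 < lam \<longrightarrow> lam \<le> Lam \<longrightarrow>
    (\<exists>\<epsilon>>0. \<exists>C>0.
       \<epsilon> = c * lam ^ CARD('n) / (real CARD('n) * Lam + 1) ^ CARD('n) \<and>
       (\<forall>u :: (real^'n) \<times> real \<Rightarrow> real.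
          viscosity_supersolution lam Lam (parabolic_cylinder 2 (0, 0)) u \<longrightarrow>
          (\<forall>z \<in> closure (parabolic_cylinder 2 (0, 0)). 0 \<le> u z) \<longrightarrow>
          0 < u (0, 0) \<longrightarrow>
          (\<forall>t>0. measure lebesgue {z \<in> B1. u z \<ge> C * u (0, 0) * t}
                   \<le> measure lebesgue (B1 :: ((real^'n) \<times> real) set) * t powr (- \<epsilon>))))"
proof -
  define n where "n = real CARD('n)"
  have n: "0 < n" by (simp add: n_def)
  \<comment> \<open>The two bounds required in \<open>exponent_admissible\<close>; the first one is \<open>1 / (2 * jacobian_const)\<close>.\<close>
  define c where "c = min (1 / (2 * (792 * (384 * n\<^sup>2) ^ CARD('n)))) (1 / 34)"
  have c: "0 < c" using n by (simp add: c_def)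
  show ?thesis
  proof (rule exI[of _ c], intro conjI allI impI c)
    fix lam Lam :: real
    assume lam: "0 < lam" "lam \<le> Lam"
    define b where "b = 1 + n * Lam"
    have b: "0 < b" using n lam by (simp add: b_def add_pos_nonneg)
    define \<epsilon> where "\<epsilon> = c * lam ^ CARD('n) / (real CARD('n) * Lam + 1) ^ CARD('n)"
    have b_eq: "real CARD('n) * Lam + 1 = b" by (simp add: b_def n_def)
    have \<epsilon>: "0 < \<epsilon>" using c lam b unfolding \<epsilon>_def b_eq by simp
    define p where "p = 16 * b / lam"
    define M where "M = measure lebesgue (B1 :: ((real^'n) \<times> real) set)"
    define layer where "layer = measure lebesgue (cball (0::real^'n) 1) * (2 * (8 * b + 16 * b\<^sup>2 + 1))"
    \<comment> \<open>\<open>C\<close> precedes \<open>u\<close>, so \<open>start_const * measure_ratio powr (1 / \<epsilon>)\<close> is spelled out in \<open>lam\<close> and \<open>Lam\<close>.\<close>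
    define C where "C = 16 * 8 powr (2 * p) / ((1 + b) powr (- p) * exp (- (128 * b\<^sup>2 / lam)))
      * (2 * (M + 3 * layer) / M) powr (1 / \<epsilon>)"
    have M: "0 < M"
      unfolding M_def by (rule B1_measure_pos)
    have "0 \<le> layer" using b by (simp add: layer_def)
    then have C_pos: "0 < C" using M b by (simp add: C_def)
    have main: "measure lebesgue {z \<in> B1. u z \<ge> C * u (0, 0) * t}
         \<le> measure lebesgue (B1 :: ((real^'n) \<times> real) set) * t powr (- \<epsilon>)"
      if u: "viscosity_supersolution lam Lam (parabolic_cylinder 2 (0, 0)) u"
        "\<forall>z \<in> closure (parabolic_cylinder 2 (0, 0)). 0 \<le> u z" "0 < u (0, 0)" and t: "0 < t"
      for u :: "(real^'n) \<times> real \<Rightarrow> real" and t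
    proof -
      interpret nonneg_supersolution lam Lam u
        using lam u by unfold_locales (auto simp: closure_cylinder)
      have \<beta>: "\<beta> = b" by (simp add: \<beta>_def b_def n_def)
      have C: "C = start_const * measure_ratio powr (1 / \<epsilon>)"
        unfolding C_def start_const_def measure_ratio_def layer_const_def spread_const_def spread_exp_def \<beta> p_def layer_def M_def ..
      have "c \<le> 1 / (2 * jacobian_const)" "c \<le> 1 / 34"
        by (auto simp: c_def jacobian_const_def n_def)
      note adm = exponent_admissible[OF c this]
      have e: "\<epsilon> = c * lam ^ CARD('n) / \<beta> ^ CARD('n)" by (simp only: \<epsilon>_def b_eq \<beta>)
      show ?thesis
        unfolding C by (rule superlevel_measure[OF u(3) \<epsilon> adm[folded e] t])
    qed
    show "\<exists>\<epsilon>>0. \<exists>C>0.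
       \<epsilon> = c * lam ^ CARD('n) / (real CARD('n) * Lam + 1) ^ CARD('n) \<and>
       (\<forall>u :: (real^'n) \<times> real \<Rightarrow> real.
          viscosity_supersolution lam Lam (parabolic_cylinder 2 (0, 0)) u \<longrightarrow>
          (\<forall>z \<in> closure (parabolic_cylinder 2 (0, 0)). 0 \<le> u z) \<longrightarrow>
          0 < u (0, 0) \<longrightarrow>
          (\<forall>t>0. measure lebesgue {z \<in> B1. u z \<ge> C * u (0, 0) * t}
                   \<le> measure lebesgue (B1 :: ((real^'n) \<times> real) set) * t powr (- \<epsilon>)))"
    proof (rule exI[of _ \<epsilon>], rule conjI[OF \<epsilon>], rule exI[of _ C], rule conjI[OF C_pos], rule conjI[OF \<epsilon>_def])
      show "\<forall>u :: (real^'n) \<times> real \<Rightarrow> real.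
          viscosity_supersolution lam Lam (parabolic_cylinder 2 (0, 0)) u \<longrightarrow>
          (\<forall>z \<in> closure (parabolic_cylinder 2 (0, 0)). 0 \<le> u z) \<longrightarrow>
          0 < u (0, 0) \<longrightarrow>
          (\<forall>t>0. measure lebesgue {z \<in> B1. u z \<ge> C * u (0, 0) * t}
                   \<le> measure lebesgue (B1 :: ((real^'n) \<times> real) set) * t powr (- \<epsilon>))"
        by (intro allI impI main)
    qed
  qed
qed

end
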